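(* Let $T\in\mathbb R^{p\times q\times r_1\times\cdots\times r_s}$ be an order-$(s+2)$ tensor and let $g_1\sim\mathcal N(0,\Sigma_1),\ldots,g_s\sim\mathcal N(0,\Sigma_s)$ be independent Gaussian vectors with $0\preceq\Sigma_i\preceq\mathrm{Id}_{r_i}$ for each $i\in[s]$. Let $\bar r=\max_{i\in[s]}\{r_i+2\}$. Then for every $t\ge0$, \[ \Pr\Bigl\{\bigl\|(\mathrm{Id}\otimes\mathrm{Id}\otimes g_1^{\mathsf T}\otimes\cdots\otimes g_s^{\mathsf T})T\bigr\|_{\{1\},\{2\}}\ge t^s\cdot\max_{S\subseteq[s+2]:\,1\in S,\,2\notin S}\|T\|_{S,S^c}\Bigr\}\le4(p+q)\,\bar r^{\,s-1}e^{-t^2/2}. \]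
   Context: The modes of $T$ are numbered $1,\ldots,s+2$, with mode $1$ of dimension $p$, mode $2$ of dimension $q$, and mode $j+2$ of dimension $r_j$. $(\mathrm{Id}\otimes\mathrm{Id}\otimes g_1^{\mathsf T}\otimes\cdots\otimes g_s^{\mathsf T})T$ denotes the contraction of modes $3,\ldots,s+2$ with $g_1,\ldots,g_s$ respectively, viewed as a $p\times q$ matrix. For a bipartition $S,S^c$ of the modes, $\|T\|_{S,S^c}$ is the spectral norm of the matrix unfolding with rows indexed by the modes in $S$ and columns indexed by the modes in $S^c$.
   Formalization: The tensor T is assumed to be nonzero, since for T = 0 the event has probability 1 while the right-hand side tends to 0 as t grows; s ≥ 1 is made explicit, as the maximum defining r̄ requires it. *)

theory Defs
  imports "HOL-Probability.Probability"
begin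

text \<open>
  Matrices with rows indexed by \<open>I\<close> and columns indexed by \<open>J\<close> are functions of two arguments;
  only the entries on \<open>I \<times> J\<close> matter. The spectral norm is the \<open>\<ell>\<^sub>2 \<rightarrow> \<ell>\<^sub>2\<close> operator norm.
\<close>

definition spectral_norm :: "'i set \<Rightarrow> 'j set \<Rightarrow> ('i \<Rightarrow> 'j \<Rightarrow> real) \<Rightarrow> real" where
  "spectral_norm I J A =
     (SUP x \<in> {x. L2_set x J \<le> 1}. L2_set (\<lambda>i. \<Sum>j\<in>J. A i j * x j) I)"

definition psd :: "nat \<Rightarrow> (nat \<Rightarrow> nat \<Rightarrow> real) \<Rightarrow> bool" where
  "psd n A \<longleftrightarrow>
     (\<forall>i\<in>{1..n}. \<forall>j\<in>{1..n}. A i j = A j i) \<and>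
     (\<forall>x. 0 \<le> (\<Sum>i=1..n. \<Sum>j=1..n. x i * A i j * x j))"

definition loewner_le :: "nat \<Rightarrow> (nat \<Rightarrow> nat \<Rightarrow> real) \<Rightarrow> (nat \<Rightarrow> nat \<Rightarrow> real) \<Rightarrow> bool" where
  "loewner_le n A B \<longleftrightarrow> psd n (\<lambda>i j. B i j - A i j)"

definition id_matrix :: "nat \<Rightarrow> nat \<Rightarrow> real" where
  "id_matrix i j = (if i = j then 1 else 0)"

text \<open>The library's \<^const>\<open>normal_density\<close> does not cover variance 0, which is the point mass.\<close>

definition normal_measure :: "real \<Rightarrow> real \<Rightarrow> real measure" where
  "normal_measure m v =
     (if v = 0 then return borel m else density lborel (normal_density m (sqrt v)))"

text \<open>
  \<open>X\<close> is a random vector in \<open>\<real>\<^sup>n\<close> with law \<open>N(0, C)\<close>; \<open>C\<close> may be singular, so there need not be a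
  density and the law is given through its one-dimensional projections.
\<close>

definition gaussian_vector ::
    "'a measure \<Rightarrow> nat \<Rightarrow> ('a \<Rightarrow> nat \<Rightarrow> real) \<Rightarrow> (nat \<Rightarrow> nat \<Rightarrow> real) \<Rightarrow> bool" where
  "gaussian_vector M n X C \<longleftrightarrow>
     (\<forall>j\<in>{1..n}. (\<lambda>\<omega>. X \<omega> j) \<in> borel_measurable M) \<and>
     (\<forall>u. distr M borel (\<lambda>\<omega>. \<Sum>j=1..n. u j * X \<omega> j) =
          normal_measure 0 (\<Sum>i=1..n. \<Sum>j=1..n. u i * C i j * u j))"

text \<open>
  A tensor whose set of modes is \<open>U\<close>, mode \<open>k\<close> having dimension \<open>d k\<close>, is a function on the
  multi-indices in \<open>multi_index d U\<close>; its values elsewhere are irrelevant.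
\<close>

definition multi_index :: "(nat \<Rightarrow> nat) \<Rightarrow> nat set \<Rightarrow> (nat \<Rightarrow> nat) set" where
  "multi_index d U = (\<Pi>\<^sub>E k\<in>U. {1..d k})"

definition unfolding_norm ::
    "(nat \<Rightarrow> nat) \<Rightarrow> nat set \<Rightarrow> nat set \<Rightarrow> ((nat \<Rightarrow> nat) \<Rightarrow> real) \<Rightarrow> real" where
  "unfolding_norm d S S' T =
     spectral_norm (multi_index d S) (multi_index d S') (\<lambda>x y. T (merge S S' (x, y)))"

text \<open>
  Contraction of the modes \<open>k \<in> K\<close> of a tensor with modes \<open>U \<union> K\<close> (\<open>U\<close>, \<open>K\<close> disjoint) with the
  vectors \<open>v k\<close>; the result is a tensor with modes \<open>U\<close>.
\<close>

definition contract ::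
    "(nat \<Rightarrow> nat) \<Rightarrow> nat set \<Rightarrow> nat set \<Rightarrow> (nat \<Rightarrow> nat \<Rightarrow> real) \<Rightarrow>
     ((nat \<Rightarrow> nat) \<Rightarrow> real) \<Rightarrow> (nat \<Rightarrow> nat) \<Rightarrow> real" where
  "contract d U K v T x =
     (\<Sum>y \<in> multi_index d K. T (merge U K (x, y)) * (\<Prod>k\<in>K. v k (y k)))"

definition mode_dim :: "nat \<Rightarrow> nat \<Rightarrow> (nat \<Rightarrow> nat) \<Rightarrow> nat \<Rightarrow> nat" where
  "mode_dim p q r k = (if k = 1 then p else if k = 2 then q else r (k - 2))"

end

theory Submission
  imports Defs
begin

text \<open>
  The modes \<open>s + 2, \<dots>, 3\<close> are contracted one at a time. A single contraction turns every unfolding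
  with row modes \<open>S\<close> into a Gaussian matrix series whose two variance parameters are bounded by the
  norms of the unfoldings of the previous tensor obtained by adding the contracted mode to the rows
  or to the columns. A matrix Gaussian tail bound and a union bound over \<open>S\<close> then show that, outside an
  event of probability \<open>2 (p + q) (\<Prod>i. 1 + r\<^sub>i) exp (-t\<^sup>2/2)\<close>, the maximal unfolding norm grows by at
  most the factor \<open>t\<close>; here \<open>\<Sum>\<^sub>S (\<Prod>i\<in>S. r\<^sub>i) = \<Prod>i. (1 + r\<^sub>i)\<close>.

  The tail bound is obtained from moments. For a symmetric Gaussian series \<open>X = \<Sum>\<^sub>k g\<^sub>k A\<^sub>k\<close>,
  integration by parts writes \<open>E tr X\<^sup>2\<^sup>m\<^sup>+\<^sup>2\<close> as a sum of \<open>2m + 1\<close> terms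
  \<open>E \<Sum>\<^sub>k\<^sub>l C\<^sub>k\<^sub>l tr (A\<^sub>k X\<^sup>a A\<^sub>l X\<^sup>b)\<close> with \<open>a + b = 2m\<close>. By Cauchy-Schwarz these are log-convex along
  even \<open>a\<close>, hence maximal at \<open>a = 0\<close>, where the term is at most \<open>\<sigma>\<^sup>2 E tr X\<^sup>2\<^sup>m\<close>. So the even trace
  moments are dominated by those of a scalar Gaussian, and \<open>cosh\<close> with Markov's inequality gives
  the tail.
\<close>

section \<open>Trace inequalities for symmetric matrices\<close>

text \<open>The covariances may be singular, so \<open>g\<close> need not have a density and
  integration by parts cannot be done on densities. It is extracted from the moments of
  one-dimensional projections: both sides are polynomials in a perturbation parameter
  \<open>s\<close>, and their derivatives at \<open>s = 0\<close> are compared.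

  Only traces of powers occur. Log-convexity replaces eigenvalues, and the Hermitian dilation
  carries the bounds over to rectangular unfoldings.

  All intermediate tail events are strict, because a partially contracted tensor may vanish: then
  \<open>> 0\<close> is an empty event while \<open>\<ge> 0\<close> is the whole space. The
  non-strict event is recovered at the end by letting the parameter increase to \<open>t\<close>,
  which needs a positive threshold; this is where a nonzero entry of \<open>T\<close> enters.

  With R the maximum of the \<open>r i + 1\<close>, each factor 1 + r_i is at most R, and the
  \<open>s\<close> contractions contribute a geometric sum 1 + R + ... + R^(s-1), at most (R +
  1)^(s-1). This is the stated power of the maximum of the \<open>r i + 2\<close>.\<close>

definition mat_mul :: "'i set \<Rightarrow> ('i \<Rightarrow> 'i \<Rightarrow> real) \<Rightarrow> ('i \<Rightarrow> 'i \<Rightarrow> real) \<Rightarrow> 'i \<Rightarrow> 'i \<Rightarrow> real" where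
  "mat_mul I A B = (\<lambda>i j. \<Sum>k\<in>I. A i k * B k j)"

definition mat_one :: "'i set \<Rightarrow> 'i \<Rightarrow> 'i \<Rightarrow> real" where
  "mat_one I = (\<lambda>i j. if i = j \<and> i \<in> I then 1 else 0)"

primrec mat_pow :: "'i set \<Rightarrow> ('i \<Rightarrow> 'i \<Rightarrow> real) \<Rightarrow> nat \<Rightarrow> 'i \<Rightarrow> 'i \<Rightarrow> real" where
  "mat_pow I A 0 = mat_one I"
| "mat_pow I A (Suc n) = mat_mul I A (mat_pow I A n)"

definition mat_tr :: "'i set \<Rightarrow> ('i \<Rightarrow> 'i \<Rightarrow> real) \<Rightarrow> real" where
  "mat_tr I A = (\<Sum>i\<in>I. A i i)"

definition mat_transpose :: "('i \<Rightarrow> 'i \<Rightarrow> real) \<Rightarrow> 'i \<Rightarrow> 'i \<Rightarrow> real" where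
  "mat_transpose A = (\<lambda>i j. A j i)"

text \<open>Symmetric matrices vanishing off \<open>I \<times> I\<close>, so that \<^term>\<open>mat_one I\<close> is neutral for them.\<close>

definition sym_mat :: "'i set \<Rightarrow> ('i \<Rightarrow> 'i \<Rightarrow> real) \<Rightarrow> bool" where
  "sym_mat I A \<longleftrightarrow> (\<forall>i j. A i j = A j i) \<and> (\<forall>i j. i \<notin> I \<longrightarrow> A i j = 0)"

lemma mat_mul_assoc: "mat_mul I (mat_mul I A B) C = mat_mul I A (mat_mul I B C)"
proof (intro ext)
  fix i j
  have "mat_mul I (mat_mul I A B) C i j = (\<Sum>k\<in>I. \<Sum>l\<in>I. A i l * B l k * C k j)"
    by (simp add: mat_mul_def sum_distrib_right)
  also have "\<dots> = (\<Sum>l\<in>I. \<Sum>k\<in>I. A i l * B l k * C k j)"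
    by (rule sum.swap)
  also have "\<dots> = mat_mul I A (mat_mul I B C) i j"
    by (simp add: mat_mul_def sum_distrib_left mult.assoc)
  finally show "mat_mul I (mat_mul I A B) C i j = mat_mul I A (mat_mul I B C) i j" .
qed

lemma mat_tr_commute: "mat_tr I (mat_mul I A B) = mat_tr I (mat_mul I B A)"
  unfolding mat_tr_def mat_mul_def by (subst sum.swap) (simp add: mult.commute)

lemma mat_transpose_mul:
  "mat_transpose (mat_mul I A B) = mat_mul I (mat_transpose B) (mat_transpose A)"
  by (simp add: mat_transpose_def mat_mul_def mult.commute)

lemma sym_mat_transpose: "sym_mat I A \<Longrightarrow> mat_transpose A = A"
  unfolding sym_mat_def mat_transpose_def by (intro ext) blast

lemma mat_one_mul:
  assumes "finite I" "\<And>i j. i \<notin> I \<Longrightarrow> A i j = 0"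
  shows "mat_mul I (mat_one I) A = A"
proof (intro ext)
  fix i j
  have "mat_mul I (mat_one I) A i j = (\<Sum>k\<in>I. if k = i then A k j else 0)"
    unfolding mat_mul_def mat_one_def by (intro sum.cong) auto
  also have "\<dots> = A i j"
    using assms by (simp add: sum.delta)
  finally show "mat_mul I (mat_one I) A i j = A i j" .
qed

lemma mat_mul_one:
  assumes "finite I" "\<And>i j. j \<notin> I \<Longrightarrow> A i j = 0"
  shows "mat_mul I A (mat_one I) = A"
proof (intro ext)
  fix i j
  have "mat_mul I A (mat_one I) i j = (\<Sum>k\<in>I. if k = j then A i k else 0)"
    unfolding mat_mul_def mat_one_def by (intro sum.cong) auto
  also have "\<dots> = A i j"
    using assms by (simp add: sum.delta)
  finally show "mat_mul I A (mat_one I) i j = A i j" .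
qed

lemma mat_pow_outside:
  assumes "sym_mat I X" "i \<notin> I"
  shows "mat_pow I X n i j = 0"
  using assms by (cases n) (auto simp: mat_one_def mat_mul_def sym_mat_def)

lemma mat_pow_add:
  assumes "finite I" "sym_mat I X"
  shows "mat_mul I (mat_pow I X a) (mat_pow I X b) = mat_pow I X (a + b)"
  by (induction a) (simp_all add: mat_one_mul assms mat_pow_outside mat_mul_assoc)

lemma mat_pow_Suc_right:
  assumes "finite I" "sym_mat I X"
  shows "mat_pow I X (Suc n) = mat_mul I (mat_pow I X n) X"
proof -
  have "mat_mul I X (mat_one I) = X"
  proof (rule mat_mul_one[OF assms(1)])
    show "X i j = 0" if "j \<notin> I" for i j
      using assms(2) that unfolding sym_mat_def by metis
  qed
  then have "mat_pow I X 1 = X" by simp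
  then show ?thesis
    using mat_pow_add[OF assms, of n 1] by simp
qed

lemma sym_mat_pow:
  assumes "finite I" "sym_mat I X"
  shows "sym_mat I (mat_pow I X n)"
proof -
  have "mat_transpose (mat_pow I X n) = mat_pow I X n"
  proof (induction n)
    case 0
    show ?case by (auto simp: mat_transpose_def mat_one_def fun_eq_iff)
  next
    case (Suc n)
    have "mat_transpose (mat_pow I X (Suc n)) = mat_mul I (mat_pow I X n) X"
      using Suc assms(2) by (simp add: mat_transpose_mul sym_mat_transpose)
    then show ?case
      using mat_pow_Suc_right[OF assms] by simp
  qed
  then have "mat_pow I X n i j = mat_pow I X n j i" for i j
    unfolding mat_transpose_def by metis
  then show ?thesis
    using mat_pow_outside[OF assms(2)] by (simp add: sym_mat_def)
qed

section \<open>Frobenius products and Cauchy-Schwarz for families of matrices\<close>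

lemma mat_tr_transpose_mul:
  "mat_tr I (mat_mul I (mat_transpose F) G) = (\<Sum>i\<in>I. \<Sum>j\<in>I. F i j * G i j)"
  unfolding mat_tr_def mat_mul_def mat_transpose_def by (rule sum.swap)

text \<open>The form to which this is applied is only semidefinite, so \<open>c = 0\<close> does
  occur: an affine function that is nonnegative everywhere is constant. For \<open>c > 0\<close> the
  parabola is evaluated at its minimum \<open>- b / c\<close>.\<close>

lemma nonneg_quadratic_discriminant:
  fixes a b c :: real
  assumes "\<And>t. 0 \<le> a + 2 * b * t + c * t\<^sup>2" and "0 \<le> c"
  shows "b\<^sup>2 \<le> a * c"
proof (cases "c = 0")
  case True
  have "b = 0"
  proof (rule ccontr)
    assume "b \<noteq> 0"
    then have "a + 2 * b * (- (a + 1) / (2 * b)) = - 1" by (simp add: field_simps)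
    then show False using assms(1)[of "- (a + 1) / (2 * b)"] True by simp
  qed
  then show ?thesis using True by simp
next
  case False
  then have "c > 0" using \<open>0 \<le> c\<close> by simp
  have "0 \<le> a + 2 * b * (- b / c) + c * (- b / c)\<^sup>2" by (rule assms(1))
  also have "\<dots> = a - b\<^sup>2 / c"
    using False by (simp add: field_simps power2_eq_square)
  finally show ?thesis using \<open>c > 0\<close> by (simp add: field_simps)
qed

lemma psd_sum_nonneg:
  assumes "psd n C"
  shows "0 \<le> (\<Sum>k=1..n. \<Sum>l=1..n. C k l * (x k * x l))"
proof -
  have "(\<Sum>k=1..n. \<Sum>l=1..n. C k l * (x k * x l)) = (\<Sum>k=1..n. \<Sum>l=1..n. x k * C k l * x l)"
    by (intro sum.cong) (auto simp: mult_ac)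
  then show ?thesis using assms by (simp add: psd_def)
qed

text \<open>A semi-inner product on \<open>n\<close>-tuples of matrices: the Frobenius product,
  coupled across the tuple by \<open>C\<close>. For centred coefficients with covariance
  \<open>C\<close> it is the expected Frobenius product of the two random series.\<close>

definition gram :: "nat \<Rightarrow> (nat \<Rightarrow> nat \<Rightarrow> real) \<Rightarrow> 'i set \<Rightarrow> (nat \<Rightarrow> 'i \<Rightarrow> 'i \<Rightarrow> real)
    \<Rightarrow> (nat \<Rightarrow> 'i \<Rightarrow> 'i \<Rightarrow> real) \<Rightarrow> real" where
  "gram n C I F G = (\<Sum>k=1..n. \<Sum>l=1..n. C k l * (\<Sum>i\<in>I. \<Sum>j\<in>I. F k i j * G l i j))"

text \<open>With the entry \<open>(i, j)\<close> outermost, each summand is a scalar quadratic or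
  bilinear form of \<open>C\<close>, so positivity and comparison with the identity can be applied
  entry by entry.\<close>

lemma gram_coordinates:
  "gram n C I F G = (\<Sum>i\<in>I. \<Sum>j\<in>I. \<Sum>k=1..n. \<Sum>l=1..n. C k l * (F k i j * G l i j))"
proof -
  have "gram n C I F G = (\<Sum>k=1..n. \<Sum>l=1..n. \<Sum>i\<in>I. \<Sum>j\<in>I. C k l * (F k i j * G l i j))"
    by (simp add: gram_def sum_distrib_left)
  also have "\<dots> = (\<Sum>k=1..n. \<Sum>i\<in>I. \<Sum>l=1..n. \<Sum>j\<in>I. C k l * (F k i j * G l i j))"
    by (rule sum.cong[OF refl sum.swap])
  also have "\<dots> = (\<Sum>i\<in>I. \<Sum>k=1..n. \<Sum>l=1..n. \<Sum>j\<in>I. C k l * (F k i j * G l i j))"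
    by (rule sum.swap)
  also have "\<dots> = (\<Sum>i\<in>I. \<Sum>k=1..n. \<Sum>j\<in>I. \<Sum>l=1..n. C k l * (F k i j * G l i j))"
    by (rule sum.cong[OF refl sum.cong[OF refl sum.swap]])
  also have "\<dots> = (\<Sum>i\<in>I. \<Sum>j\<in>I. \<Sum>k=1..n. \<Sum>l=1..n. C k l * (F k i j * G l i j))"
    by (rule sum.cong[OF refl sum.swap])
  finally show ?thesis .
qed

lemma gram_nonneg: "psd n C \<Longrightarrow> 0 \<le> gram n C I F F"
  unfolding gram_coordinates by (intro sum_nonneg psd_sum_nonneg)

lemma gram_sym:
  assumes "psd n C"
  shows "gram n C I F G = gram n C I G F"
proof -
  have "gram n C I F G = (\<Sum>l=1..n. \<Sum>k=1..n. C k l * (\<Sum>i\<in>I. \<Sum>j\<in>I. F k i j * G l i j))"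
    unfolding gram_def by (rule sum.swap)
  also have "\<dots> = gram n C I G F"
    unfolding gram_def using assms
    by (intro sum.cong refl) (auto simp: psd_def mult.commute)
  finally show ?thesis .
qed

lemma gram_Cauchy_Schwarz:
  assumes "psd n C"
  shows "(gram n C I F G)\<^sup>2 \<le> gram n C I F F * gram n C I G G"
proof (rule nonneg_quadratic_discriminant)
  fix t :: real
  let ?H = "\<lambda>k i j. F k i j + t * G k i j"
  have "gram n C I ?H ?H = gram n C I F F + t * gram n C I F G + t * gram n C I G F
      + t\<^sup>2 * gram n C I G G"
    by (simp add: gram_def algebra_simps sum.distrib sum_distrib_left power2_eq_square)
  also have "\<dots> = gram n C I F F + 2 * gram n C I F G * t + gram n C I G G * t\<^sup>2"
    using gram_sym[OF assms, of I G F] by simp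
  finally show "0 \<le> gram n C I F F + 2 * gram n C I F G * t + gram n C I G G * t\<^sup>2"
    using gram_nonneg[OF assms, of I ?H] by simp
qed (rule gram_nonneg[OF assms])

text \<open>Take the leftmost point where the maximum \<open>K\<close> is attained. If it were
  interior, its left neighbour would be strictly below \<open>K\<close> and its right neighbour at
  most \<open>K\<close>, so their product would be less than the square of \<open>K\<close>. No
  logarithm is taken, so zeros of \<open>f\<close> are harmless.\<close>

lemma log_convex_le_endpoints:
  fixes f :: "nat \<Rightarrow> real"
  assumes nonneg: "\<And>u. u \<le> m \<Longrightarrow> 0 \<le> f u"
    and convex: "\<And>u. 0 < u \<Longrightarrow> u < m \<Longrightarrow> (f u)\<^sup>2 \<le> f (u - 1) * f (u + 1)"
    and "u \<le> m"
  shows "f u \<le> max (f 0) (f m)"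
proof -
  define K where "K = Max (f ` {..m})"
  have le: "f v \<le> K" if "v \<le> m" for v
    using that by (auto simp: K_def)
  have "K \<in> f ` {..m}"
    unfolding K_def by (rule Max_in) auto
  then have ex: "\<exists>v. v \<le> m \<and> f v = K" by auto
  define v where "v = (LEAST v. v \<le> m \<and> f v = K)"
  have v: "v \<le> m" "f v = K"
    using LeastI_ex[OF ex] by (auto simp: v_def)
  have "v = 0 \<or> v = m"
  proof (rule ccontr)
    assume "\<not> ?thesis"
    then have v': "0 < v" "v < m" using v by auto
    have "\<not> (v - 1 \<le> m \<and> f (v - 1) = K)"
      using not_less_Least[of "v - 1" "\<lambda>v. v \<le> m \<and> f v = K"] v' by (simp add: v_def)
    then have lt: "f (v - 1) < K" using le[of "v - 1"] v' by fastforce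
    have "0 \<le> f (v - 1)" using v' by (intro nonneg) simp
    then have "K > 0" using lt by simp
    have "K\<^sup>2 \<le> f (v - 1) * f (v + 1)" using convex[OF v'] v by simp
    also have "\<dots> \<le> f (v - 1) * K"
      using le[of "v + 1"] \<open>0 \<le> f (v - 1)\<close> v' by (intro mult_left_mono) auto
    also have "\<dots> < K * K" using lt \<open>K > 0\<close> by simp
    finally show False by (simp add: power2_eq_square)
  qed
  then show ?thesis using v le[OF \<open>u \<le> m\<close>] by auto
qed

context
  fixes I :: "'i set" and n :: nat and C :: "nat \<Rightarrow> nat \<Rightarrow> real"
    and A :: "nat \<Rightarrow> 'i \<Rightarrow> 'i \<Rightarrow> real" and X :: "'i \<Rightarrow> 'i \<Rightarrow> real"
  assumes finI: "finite I" and C: "psd n C"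
    and A: "\<And>k. sym_mat I (A k)" and X: "sym_mat I X"
begin

private abbreviation mm (infixl "\<diamondop>" 70) where "mm \<equiv> mat_mul I"
private abbreviation XX where "XX \<equiv> mat_pow I X"

definition sandwich :: "nat \<Rightarrow> nat \<Rightarrow> real" where
  "sandwich a b = (\<Sum>k=1..n. \<Sum>l=1..n. C k l * mat_tr I (A k \<diamondop> XX a \<diamondop> A l \<diamondop> XX b))"

text \<open>By symmetry and cyclicity of the trace, the powers of \<open>X\<close> on the left
  combine to \<open>u + v\<close> and those on the right to \<open>2 * m - (u + v)\<close>. Taking
  \<open>u = v\<close> shows that \<open>sandwich\<close> is nonnegative at even exponents;
  different \<open>u\<close>, \<open>v\<close> feed Cauchy-Schwarz.\<close>

lemma gram_eq_sandwich:
  assumes "u \<le> m" "v \<le> m"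
  shows "gram n C I (\<lambda>k. XX u \<diamondop> A k \<diamondop> XX (m - u)) (\<lambda>k. XX v \<diamondop> A k \<diamondop> XX (m - v))
    = sandwich (u + v) (2 * m - (u + v))"
proof -
  have "(\<Sum>i\<in>I. \<Sum>j\<in>I. (XX u \<diamondop> A k \<diamondop> XX (m - u)) i j * (XX v \<diamondop> A l \<diamondop> XX (m - v)) i j)
      = mat_tr I (A k \<diamondop> XX (u + v) \<diamondop> A l \<diamondop> XX (2 * m - (u + v)))" for k l
  proof -
    have "(\<Sum>i\<in>I. \<Sum>j\<in>I. (XX u \<diamondop> A k \<diamondop> XX (m - u)) i j * (XX v \<diamondop> A l \<diamondop> XX (m - v)) i j)
        = mat_tr I (mat_transpose (XX u \<diamondop> A k \<diamondop> XX (m - u)) \<diamondop> (XX v \<diamondop> A l \<diamondop> XX (m - v)))"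
      by (rule mat_tr_transpose_mul[symmetric])
    also have "mat_transpose (XX u \<diamondop> A k \<diamondop> XX (m - u)) = XX (m - u) \<diamondop> (A k \<diamondop> XX u)"
      by (simp add: mat_transpose_mul sym_mat_transpose[OF sym_mat_pow[OF finI X]]
          sym_mat_transpose[OF A])
    also have "mat_tr I (XX (m - u) \<diamondop> (A k \<diamondop> XX u) \<diamondop> (XX v \<diamondop> A l \<diamondop> XX (m - v)))
        = mat_tr I (A k \<diamondop> XX u \<diamondop> (XX v \<diamondop> A l \<diamondop> XX (m - v)) \<diamondop> XX (m - u))"
      unfolding mat_mul_assoc[of I "XX (m - u)"] by (rule mat_tr_commute)
    also have "A k \<diamondop> XX u \<diamondop> (XX v \<diamondop> A l \<diamondop> XX (m - v)) \<diamondop> XX (m - u)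
        = A k \<diamondop> (XX u \<diamondop> XX v) \<diamondop> A l \<diamondop> (XX (m - v) \<diamondop> XX (m - u))"
      by (simp add: mat_mul_assoc)
    also have "\<dots> = A k \<diamondop> XX (u + v) \<diamondop> A l \<diamondop> XX (2 * m - (u + v))"
      using assms by (simp add: mat_pow_add[OF finI X] mult_2 add.commute)
    finally show ?thesis .
  qed
  then show ?thesis by (simp add: gram_def sandwich_def)
qed

text \<open>Cyclicity of the trace exchanges the roles of \<open>k\<close> and \<open>l\<close>, and
  \<open>C\<close> is symmetric. This makes the two endpoint values in \<open>sandwich_le\<close>
  equal.\<close>

lemma sandwich_swap: "sandwich a b = sandwich b a"
proof -
  have "mat_tr I (A k \<diamondop> XX a \<diamondop> A l \<diamondop> XX b) = mat_tr I (A l \<diamondop> XX b \<diamondop> A k \<diamondop> XX a)" for k l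
    using mat_tr_commute[of I "A k \<diamondop> XX a" "A l \<diamondop> XX b"] by (simp add: mat_mul_assoc)
  then have "sandwich a b = (\<Sum>k=1..n. \<Sum>l=1..n. C k l * mat_tr I (A l \<diamondop> XX b \<diamondop> A k \<diamondop> XX a))"
    by (simp add: sandwich_def)
  also have "\<dots> = (\<Sum>l=1..n. \<Sum>k=1..n. C k l * mat_tr I (A l \<diamondop> XX b \<diamondop> A k \<diamondop> XX a))"
    by (rule sum.swap)
  also have "\<dots> = sandwich b a"
    unfolding sandwich_def using C by (intro sum.cong refl) (auto simp: psd_def)
  finally show ?thesis .
qed

text \<open>Nonnegativity, and hence log-convexity, is available only along even exponents;
  \<open>f u\<close> is the value at \<open>2 * u\<close>. An odd exponent is bounded through its
  two even neighbours.\<close>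

lemma sandwich_le:
  assumes "a + b = 2 * m"
  shows "sandwich a b \<le> sandwich 0 (2 * m)"
proof -
  define f where "f u = sandwich (2 * u) (2 * m - 2 * u)" for u
  have cs: "(sandwich (u + v) (2 * m - (u + v)))\<^sup>2 \<le> f u * f v" if "u \<le> m" "v \<le> m" for u v
    using gram_Cauchy_Schwarz[OF C, of I "\<lambda>k. XX u \<diamondop> A k \<diamondop> XX (m - u)"
        "\<lambda>k. XX v \<diamondop> A k \<diamondop> XX (m - v)"] that
    by (simp add: gram_eq_sandwich f_def mult_2)
  have nonneg: "0 \<le> f u" if "u \<le> m" for u
    using gram_nonneg[OF C, of I "\<lambda>k. XX u \<diamondop> A k \<diamondop> XX (m - u)"] that
    by (simp add: gram_eq_sandwich f_def mult_2)
  have f0: "f 0 = sandwich 0 (2 * m)" "f m = sandwich 0 (2 * m)"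
    using sandwich_swap[of 0 "2 * m"] by (auto simp: f_def)
  have f_le: "f u \<le> sandwich 0 (2 * m)" if "u \<le> m" for u
  proof -
    have "f u \<le> max (f 0) (f m)"
    proof (rule log_convex_le_endpoints[OF nonneg _ that])
      fix u assume u: "0 < u" "u < m"
      \<comment> \<open>Cauchy-Schwarz between the indices \<open>u - 1\<close> and
        \<open>u + 1\<close> controls the value at their sum, which is the exponent of
        \<open>f u\<close>.\<close>
      then have e: "u - 1 + (u + 1) = 2 * u" by simp
      have "(sandwich (u - 1 + (u + 1)) (2 * m - (u - 1 + (u + 1))))\<^sup>2 \<le> f (u - 1) * f (u + 1)"
        by (rule cs) (use u in auto)
      then show "(f u)\<^sup>2 \<le> f (u - 1) * f (u + 1)" unfolding e f_def[of u] .
    qed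
    then show ?thesis by (simp add: f0)
  qed
  \<comment> \<open>The two halves of \<open>a\<close>, differing by at most one: for even
    \<open>a\<close> they coincide, for odd \<open>a\<close> Cauchy-Schwarz interpolates between
    \<open>f u\<close> and \<open>f v\<close>.\<close>
  define u v where "u = a div 2" and "v = a - a div 2"
  have uv: "u \<le> m" "v \<le> m" "a = u + v" using assms by (auto simp: u_def v_def)
  have "(sandwich a b)\<^sup>2 \<le> f u * f v"
    using cs[OF uv(1,2)] uv(3) assms by (metis diff_add_inverse)
  also have "\<dots> \<le> (sandwich 0 (2 * m))\<^sup>2"
    unfolding power2_eq_square using uv f_le nonneg by (intro mult_mono) (auto intro: order_trans)
  finally show ?thesis
    by (rule power2_le_imp_le) (use nonneg[of 0] f0 in simp)
qed

text \<open>At exponent 0 the term is a \<open>gram\<close> square of the matrices A_k X^m. Bounding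
  \<open>C\<close> by the identity leaves the sum over \<open>k\<close> of their squared Frobenius
  norms, to which the hypothesis applies column by column.\<close>

lemma sandwich_0_le:
  assumes le: "loewner_le n C id_matrix"
    and \<sigma>: "\<And>y. (\<Sum>k=1..n. \<Sum>i\<in>I. (\<Sum>j\<in>I. A k i j * y j)\<^sup>2) \<le> \<sigma>\<^sup>2 * (\<Sum>j\<in>I. (y j)\<^sup>2)"
  shows "sandwich 0 (2 * m) \<le> \<sigma>\<^sup>2 * mat_tr I (XX (2 * m))"
proof -
  have C_le: "(\<Sum>k=1..n. \<Sum>l=1..n. C k l * (x k * x l)) \<le> (\<Sum>k=1..n. (x k)\<^sup>2)" for x
  proof -
    have "0 \<le> (\<Sum>k=1..n. \<Sum>l=1..n. (id_matrix k l - C k l) * (x k * x l))"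
      using le psd_sum_nonneg unfolding loewner_le_def by blast
    also have "\<dots> = (\<Sum>k=1..n. \<Sum>l=1..n. id_matrix k l * (x k * x l))
        - (\<Sum>k=1..n. \<Sum>l=1..n. C k l * (x k * x l))"
      by (simp add: left_diff_distrib sum_subtractf)
    also have "(\<Sum>k=1..n. \<Sum>l=1..n. id_matrix k l * (x k * x l)) = (\<Sum>k=1..n. (x k)\<^sup>2)"
    proof (intro sum.cong refl)
      fix k assume k: "k \<in> {1..n}"
      have "(\<Sum>l=1..n. id_matrix k l * (x k * x l)) = (\<Sum>l=1..n. if l = k then (x k)\<^sup>2 else 0)"
        by (intro sum.cong) (auto simp: id_matrix_def power2_eq_square)
      then show "(\<Sum>l=1..n. id_matrix k l * (x k * x l)) = (x k)\<^sup>2"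
        using k by (simp add: sum.delta)
    qed
    finally show ?thesis by simp
  qed
  have one: "XX 0 \<diamondop> A k \<diamondop> XX (m - 0) = A k \<diamondop> XX m" for k
    using A[of k] by (simp add: mat_one_mul[OF finI] sym_mat_def)
  have "sandwich 0 (2 * m) = gram n C I (\<lambda>k. A k \<diamondop> XX m) (\<lambda>k. A k \<diamondop> XX m)"
    using gram_eq_sandwich[of 0 m 0] unfolding one by simp
  also have "\<dots> \<le> (\<Sum>i\<in>I. \<Sum>j\<in>I. \<Sum>k=1..n. ((A k \<diamondop> XX m) i j)\<^sup>2)"
    unfolding gram_coordinates by (intro sum_mono C_le)
  also have "\<dots> = (\<Sum>j\<in>I. \<Sum>i\<in>I. \<Sum>k=1..n. ((A k \<diamondop> XX m) i j)\<^sup>2)"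
    by (rule sum.swap)
  also have "\<dots> = (\<Sum>j\<in>I. \<Sum>k=1..n. \<Sum>i\<in>I. ((A k \<diamondop> XX m) i j)\<^sup>2)"
    by (rule sum.cong[OF refl sum.swap])
  \<comment> \<open>The vector \<open>y\<close> in the hypothesis is the \<open>j\<close>-th column
    of \<open>XX m\<close>.\<close>
  also have "\<dots> \<le> (\<Sum>j\<in>I. \<sigma>\<^sup>2 * (\<Sum>i\<in>I. (XX m i j)\<^sup>2))"
    unfolding mat_mul_def by (intro sum_mono \<sigma>)
  also have "\<dots> = \<sigma>\<^sup>2 * (\<Sum>i\<in>I. \<Sum>j\<in>I. XX m i j * XX m i j)"
    by (subst sum.swap) (simp add: sum_distrib_left power2_eq_square)
  also have "\<dots> = \<sigma>\<^sup>2 * mat_tr I (XX (2 * m))"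
    by (simp add: mat_tr_transpose_mul[symmetric] sym_mat_transpose[OF sym_mat_pow[OF finI X]]
        mat_pow_add[OF finI X] mult_2)
  finally show ?thesis .
qed

end

text \<open>Replaces the spectral theorem. The norms \<open>c N\<close> of X^N y form a log-convex
  sequence with \<open>c 0 \<le> 1\<close>, which forces \<open>c 1 ^ N \<le> c N\<close>. In turn
  \<open>c N\<close> is at most the Frobenius norm of X^N, whose square is the trace of X^(2N).
  Nonemptiness of \<open>I\<close> matters for \<open>N = 0\<close>, where the trace is
  \<open>card I\<close>.\<close>

lemma norm_power_le_trace:
  assumes finI: "finite I" and X: "sym_mat I X" and y: "L2_set y I \<le> 1" and "I \<noteq> {}"
  shows "L2_set (\<lambda>i. \<Sum>j\<in>I. X i j * y j) I ^ (2 * N) \<le> mat_tr I (mat_pow I X (2 * N))"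
proof -
  define z where "z N i = (\<Sum>j\<in>I. mat_pow I X N i j * y j)" for N i
  define c where "c N = L2_set (z N) I" for N
  have z_Suc: "z (Suc N) i = (\<Sum>j\<in>I. X i j * z N j)" for N i
  proof -
    have "z (Suc N) i = (\<Sum>j\<in>I. \<Sum>k\<in>I. X i k * mat_pow I X N k j * y j)"
      by (simp add: z_def mat_mul_def sum_distrib_right)
    also have "\<dots> = (\<Sum>k\<in>I. \<Sum>j\<in>I. X i k * mat_pow I X N k j * y j)" by (rule sum.swap)
    finally show ?thesis by (simp add: z_def sum_distrib_left mult.assoc)
  qed
  have z0: "z 0 i = y i" if "i \<in> I" for i
  proof -
    have "z 0 i = (\<Sum>j\<in>I. if j = i then y j else 0)"
      unfolding z_def by (intro sum.cong) (auto simp: mat_one_def that)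
    then show ?thesis using that finI by simp
  qed
  have c0: "c 0 \<le> 1"
  proof -
    have "c 0 = L2_set y I" unfolding c_def by (intro L2_set_cong) (auto simp: z0)
    then show ?thesis using y by simp
  qed
  have c_nonneg: "0 \<le> c N" for N by (simp add: c_def)
  \<comment> \<open>Symmetry of \<open>X\<close> moves one factor across the inner product: the
    square of \<open>c (Suc N)\<close> is the inner product of \<open>z N\<close> with
    \<open>z (Suc (Suc N))\<close>.\<close>
  have conv: "(c (Suc N))\<^sup>2 \<le> c N * c (Suc (Suc N))" for N
  proof -
    have "(c (Suc N))\<^sup>2 = (\<Sum>i\<in>I. (z (Suc N) i)\<^sup>2)"
      by (simp add: c_def L2_set_def sum_nonneg)
    also have "\<dots> = (\<Sum>i\<in>I. \<Sum>j\<in>I. X i j * z N j * z (Suc N) i)"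
      by (intro sum.cong refl) (simp add: power2_eq_square z_Suc[of N] sum_distrib_right)
    also have "\<dots> = (\<Sum>j\<in>I. \<Sum>i\<in>I. X i j * z N j * z (Suc N) i)" by (rule sum.swap)
    also have "\<dots> = (\<Sum>j\<in>I. z N j * z (Suc (Suc N)) j)"
    proof (intro sum.cong refl)
      fix j
      have "(\<Sum>i\<in>I. X i j * z N j * z (Suc N) i) = (\<Sum>i\<in>I. z N j * (X j i * z (Suc N) i))"
        using X by (intro sum.cong refl) (simp add: sym_mat_def)
      then show "(\<Sum>i\<in>I. X i j * z N j * z (Suc N) i) = z N j * z (Suc (Suc N)) j"
        by (simp add: z_Suc[of "Suc N"] sum_distrib_left)
    qed
    also have "\<dots> \<le> (\<Sum>j\<in>I. \<bar>z N j\<bar> * \<bar>z (Suc (Suc N)) j\<bar>)"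
      by (intro sum_mono) (metis abs_ge_self abs_mult)
    also have "\<dots> \<le> c N * c (Suc (Suc N))"
      unfolding c_def by (rule L2_set_mult_ineq)
    finally show ?thesis .
  qed
  \<comment> \<open>The ratios of consecutive \<open>c\<close> are nondecreasing and the first one
    is at least \<open>c 1\<close> because \<open>c 0 \<le> 1\<close>. A zero \<open>c N\<close>
    forces \<open>c (Suc N) = 0\<close> and is treated separately.\<close>
  have step: "c 1 * c N \<le> c (Suc N)" for N
  proof (induction N)
    case 0
    show ?case using c0 c_nonneg[of 1] by (simp add: mult_left_le)
  next
    case (Suc N)
    show ?case
    proof (cases "c N = 0")
      case True
      then have "(c (Suc N))\<^sup>2 \<le> 0" using conv[of N] by simp
      then have "c (Suc N) = 0" by simp
      then show ?thesis using c_nonneg by simp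
    next
      case False
      have "c N * (c 1 * c (Suc N)) \<le> c (Suc N) * c (Suc N)"
        using mult_right_mono[OF Suc c_nonneg[of "Suc N"]] by (simp add: mult_ac)
      also have "\<dots> \<le> c N * c (Suc (Suc N))" using conv[of N] by (simp add: power2_eq_square)
      finally show ?thesis using False c_nonneg[of N] by (simp add: mult_le_cancel_left)
    qed
  qed
  have power: "c 1 ^ N \<le> c N" if "N \<ge> 1" for N
    using that
  proof (induction N rule: dec_induct)
    case (step N)
    have "c 1 ^ Suc N \<le> c 1 * c N" using step c_nonneg[of 1] by (simp add: mult_left_mono)
    then show ?case using \<open>\<And>N. c 1 * c N \<le> c (Suc N)\<close>[of N] by simp
  qed simp
  have z1: "L2_set (\<lambda>i. \<Sum>j\<in>I. X i j * y j) I = c 1"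
    unfolding c_def by (intro L2_set_cong) (auto simp: z_Suc[of 0] z0 cong: sum.cong)
  show ?thesis
  proof (cases "N = 0")
    case True
    have "1 \<le> real (card I)" using finI \<open>I \<noteq> {}\<close> by (simp add: Suc_le_eq card_gt_0_iff)
    then show ?thesis using True by (simp add: mat_tr_def mat_one_def)
  next
    case False
    have "c 1 ^ (2 * N) = (c 1 ^ N)\<^sup>2" by (simp add: power_mult mult.commute)
    also have "\<dots> \<le> (c N)\<^sup>2" using power[of N] False c_nonneg[of 1] by (intro power_mono) auto
    also have "\<dots> = (\<Sum>i\<in>I. (z N i)\<^sup>2)"
      by (simp add: c_def L2_set_def sum_nonneg)
    also have "\<dots> \<le> (\<Sum>i\<in>I. (\<Sum>j\<in>I. (mat_pow I X N i j)\<^sup>2))"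
    proof (intro sum_mono)
      fix i
      have "\<bar>z N i\<bar> \<le> (\<Sum>j\<in>I. \<bar>mat_pow I X N i j\<bar> * \<bar>y j\<bar>)"
        unfolding z_def by (rule order_trans[OF sum_abs]) (simp add: abs_mult)
      also have "\<dots> \<le> L2_set (mat_pow I X N i) I * L2_set y I" by (rule L2_set_mult_ineq)
      also have "\<dots> \<le> L2_set (mat_pow I X N i) I" using y by (simp add: mult_left_le)
      finally have "\<bar>z N i\<bar>\<^sup>2 \<le> (L2_set (mat_pow I X N i) I)\<^sup>2" by (intro power_mono) auto
      then show "(z N i)\<^sup>2 \<le> (\<Sum>j\<in>I. (mat_pow I X N i j)\<^sup>2)"
        by (simp add: L2_set_def sum_nonneg)
    qed
    also have "\<dots> = (\<Sum>i\<in>I. \<Sum>j\<in>I. mat_pow I X N i j * mat_pow I X N i j)"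
      by (simp add: power2_eq_square)
    also have "\<dots> = mat_tr I (mat_pow I X (2 * N))"
      by (simp add: mat_tr_transpose_mul[symmetric] sym_mat_transpose[OF sym_mat_pow[OF finI X]]
          mat_pow_add[OF finI X] mult_2)
    finally show ?thesis unfolding z1 .
  qed
qed

section \<open>Gaussian integration by parts\<close>

text \<open>The moments of the standard normal law: for even \<open>N\<close> the double factorial
  (N-1)!!, written with factorials.\<close>

definition gauss_moment :: "nat \<Rightarrow> real" where
  "gauss_moment N = (if even N then fact N / (2 ^ (N div 2) * fact (N div 2)) else 0)"

text \<open>The scalar recurrence that the trace moments will be shown to obey as an
  inequality.\<close>

lemma gauss_moment_Suc_Suc: "gauss_moment (Suc (Suc N)) = real (Suc N) * gauss_moment N"
proof (cases "even N")
  case True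
  then obtain k where k: "N = 2 * k" using evenE by blast
  have "gauss_moment (Suc (Suc N)) = fact (2 * k + 2) / (2 ^ (k + 1) * fact (k + 1))"
    by (simp add: gauss_moment_def k)
  also have "(fact (2 * k + 2) :: real) = (2 * real k + 2) * (2 * real k + 1) * fact (2 * k)"
    by (simp add: algebra_simps)
  also have "(2 ^ (k + 1) * fact (k + 1) :: real) = (2 * real k + 2) * (2 ^ k * fact k)"
    by (simp add: algebra_simps)
  also have "(2 * real k + 2) * (2 * real k + 1) * fact (2 * k) / ((2 * real k + 2) * (2 ^ k * fact k))
      = (2 * real k + 1) * (fact (2 * k) / (2 ^ k * fact k))"
    by (simp only: mult.assoc) (subst mult_divide_mult_cancel_left, auto)
  finally show ?thesis by (simp add: gauss_moment_def k)
qed (simp add: gauss_moment_def)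

lemma normal_measure_moment:
  assumes "v \<ge> 0"
  shows "has_bochner_integral (normal_measure 0 v) (\<lambda>x. x ^ N) (gauss_moment N * v ^ (N div 2))"
proof (cases "v = 0")
  case True
  interpret prob_space "return borel (0 :: real)"
    by (rule prob_space_return) simp
  \<comment> \<open>For the point mass, \<open>0 ^ 0 = 1\<close> gives the moment of order 0. For
    \<open>N = 1\<close> the exponent \<open>N div 2\<close> is 0 as well, and the factor
    \<open>gauss_moment 1 = 0\<close> is what makes the product vanish.\<close>
  have eq: "gauss_moment N * 0 ^ (N div 2) = 0 ^ N"
  proof (cases "even N \<and> N \<noteq> 0")
    case True
    then have "N div 2 \<noteq> 0" by auto
    then show ?thesis using True by (simp add: power_0_left)
  qed (auto simp: gauss_moment_def power_0_left)
  have "has_bochner_integral (return borel (0 :: real)) (\<lambda>x. 0 ^ N) (0 ^ N :: real)"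
    unfolding has_bochner_integral_iff lebesgue_integral_const prob_space
    by (intro conjI integrable_const) simp
  then have "has_bochner_integral (return borel (0 :: real)) (\<lambda>x. x ^ N) (0 ^ N)"
    by (rule has_bochner_integralI_AE) (auto simp: AE_return)
  then show ?thesis by (simp add: True normal_measure_def eq)
next
  case False
  then have v: "v > 0" using assms by simp
  have "has_bochner_integral lborel (\<lambda>x. normal_density 0 (sqrt v) x * x ^ N)
      (gauss_moment N * v ^ (N div 2))"
  proof (cases "even N")
    case True
    then obtain k where k: "N = 2 * k" using evenE by blast
    show ?thesis
      using normal_moment_even[of "sqrt v" 0 k] v
      by (simp add: k gauss_moment_def power_divide)
  next
    case False
    then obtain k where k: "N = 2 * k + 1" using oddE by blast
    show ?thesis
      using normal_moment_odd[of "sqrt v" 0 k] v by (simp add: k gauss_moment_def)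
  qed
  then have "has_bochner_integral (density lborel (normal_density 0 (sqrt v))) (\<lambda>x. x ^ N)
      (gauss_moment N * v ^ (N div 2))"
    by (intro has_bochner_integral_density) (auto simp: normal_density_nonneg)
  then show ?thesis using v by (simp add: normal_measure_def)
qed

text \<open>A class of random variables closed under sums and products, so every integrability side
  condition about polynomials in \<open>g\<close> becomes structural.\<close>

definition all_moments :: "'a measure \<Rightarrow> ('a \<Rightarrow> real) \<Rightarrow> bool" where
  "all_moments M f \<longleftrightarrow> f \<in> borel_measurable M \<and> (\<forall>N. integrable M (\<lambda>x. f x ^ N))"

lemma all_moments_measurable: "all_moments M f \<Longrightarrow> f \<in> borel_measurable M"
  by (simp add: all_moments_def)

lemma all_moments_integrable: "all_moments M f \<Longrightarrow> integrable M f"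
  unfolding all_moments_def by (drule conjunct2, drule spec[of _ 1]) simp

lemma all_moments_integrable_mult:
  assumes f: "all_moments M f" and g: "all_moments M g"
  shows "integrable M (\<lambda>x. f x ^ a * g x ^ b)"
proof (rule Bochner_Integration.integrable_bound)
  show "integrable M (\<lambda>x. f x ^ (2 * a) + g x ^ (2 * b))"
    using f g by (intro Bochner_Integration.integrable_add) (auto simp: all_moments_def)
  show "(\<lambda>x. f x ^ a * g x ^ b) \<in> borel_measurable M"
    using f g by (auto simp: all_moments_def)
  have "\<bar>u * v\<bar> \<le> u\<^sup>2 + v\<^sup>2" for u v :: real
  proof -
    have "0 \<le> (\<bar>u\<bar> - \<bar>v\<bar>)\<^sup>2" by simp
    then have "2 * \<bar>u * v\<bar> \<le> u\<^sup>2 + v\<^sup>2" by (simp add: power2_diff abs_mult)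
    moreover have "0 \<le> u\<^sup>2 + v\<^sup>2" by simp
    ultimately show ?thesis by linarith
  qed
  from this[of "f x ^ a" "g x ^ b" for x]
  show "AE x in M. norm (f x ^ a * g x ^ b) \<le> norm (f x ^ (2 * a) + g x ^ (2 * b))"
    by (simp add: power_even_eq)
qed

lemma all_moments_mult:
  assumes "all_moments M f" "all_moments M g"
  shows "all_moments M (\<lambda>x. f x * g x)"
  unfolding all_moments_def
  unfolding power_mult_distrib
  by (intro conjI allI borel_measurable_times all_moments_measurable
      all_moments_integrable_mult assms)

lemma all_moments_add:
  assumes "all_moments M f" "all_moments M g"
  shows "all_moments M (\<lambda>x. f x + g x)"
  unfolding all_moments_def
proof (intro conjI allI)
  show "(\<lambda>x. f x + g x) \<in> borel_measurable M"
    by (intro borel_measurable_add all_moments_measurable assms)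
  fix N
  show "integrable M (\<lambda>x. (f x + g x) ^ N)"
    unfolding binomial_ring mult.assoc
    by (intro Bochner_Integration.integrable_sum Bochner_Integration.integrable_mult_right
        all_moments_integrable_mult assms)
qed

lemma (in finite_measure) all_moments_const: "all_moments M (\<lambda>_. c)"
  by (simp add: all_moments_def)

lemma (in finite_measure) all_moments_sum:
  assumes "\<And>i. i \<in> S \<Longrightarrow> all_moments M (f i)"
  shows "all_moments M (\<lambda>x. \<Sum>i\<in>S. f i x)"
  using assms
  by (induction S rule: infinite_finite_induct) (simp_all add: all_moments_const all_moments_add)

lemma (in finite_measure) all_moments_power:
  assumes "all_moments M f"
  shows "all_moments M (\<lambda>x. f x ^ N)"
  by (induction N) (simp_all add: all_moments_const all_moments_mult assms)

text \<open>The binomial theorem makes the expectation a polynomial in \<open>s\<close> with moments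
  as coefficients. No differentiation under the integral is involved: the derivative at 0 is the
  linear coefficient.\<close>

lemma (in finite_measure) DERIV_expectation_power:
  assumes h: "all_moments M h" and a: "all_moments M a" and b: "all_moments M b"
  shows "((\<lambda>s. \<integral>x. h x * (a x + s * b x) ^ N \<partial>M) has_real_derivative
      (real N * (\<integral>x. h x * a x ^ (N - 1) * b x \<partial>M))) (at 0)"
proof -
  define c where "c j = real (N choose j) * (\<integral>x. h x * (b x ^ j * a x ^ (N - j)) \<partial>M)" for j
  have int: "integrable M (\<lambda>x. h x * (b x ^ j * a x ^ i))" for i j
    by (intro all_moments_integrable all_moments_mult all_moments_power assms)
  have "(\<lambda>s. \<integral>x. h x * (a x + s * b x) ^ N \<partial>M) = (\<lambda>s. \<Sum>j\<le>N. c j * s ^ j)"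
  proof
    fix s
    have "h x * (a x + s * b x) ^ N
        = (\<Sum>j\<le>N. (real (N choose j) * s ^ j) * (h x * (b x ^ j * a x ^ (N - j))))" for x
      using binomial_ring[of "s * b x" "a x" N]
      by (simp add: add.commute sum_distrib_left power_mult_distrib mult_ac)
    then have "(\<integral>x. h x * (a x + s * b x) ^ N \<partial>M)
        = (\<Sum>j\<le>N. (real (N choose j) * s ^ j) * (\<integral>x. h x * (b x ^ j * a x ^ (N - j)) \<partial>M))"
      using int by (simp add: Bochner_Integration.integral_sum)
    then show "(\<integral>x. h x * (a x + s * b x) ^ N \<partial>M) = (\<Sum>j\<le>N. c j * s ^ j)"
      by (simp add: c_def mult_ac)
  qed
  moreover have "((\<lambda>s. \<Sum>j\<le>N. c j * s ^ j) has_real_derivative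
      (\<Sum>j\<le>N. c j * (real j * 0 ^ (j - 1)))) (at 0)"
    by (auto intro!: derivative_eq_intros sum.cong simp: mult_ac)
  moreover have "(\<Sum>j\<le>N. c j * (real j * 0 ^ (j - 1)))
      = real N * (\<integral>x. h x * a x ^ (N - 1) * b x \<partial>M)"
  proof -
    \<comment> \<open>The term \<open>j = 0\<close> is killed by \<open>real j\<close>, the terms
      \<open>j > 1\<close> by the power of 0; at \<open>j = 1\<close> the power is
      \<open>0 ^ 0 = 1\<close>.\<close>
    have "(\<Sum>j\<le>N. c j * (real j * 0 ^ (j - 1))) = (\<Sum>j\<le>N. if j = 1 then c 1 else 0)"
      by (intro sum.cong) (auto simp: power_0_left)
    also have "\<dots> = real N * (\<integral>x. h x * a x ^ (N - 1) * b x \<partial>M)"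
      by (cases N) (auto simp: c_def mult_ac)
    finally show ?thesis .
  qed
  ultimately show ?thesis by simp
qed

section \<open>Polynomials in the coordinates of a Gaussian vector\<close>

definition lin_form :: "nat \<Rightarrow> (nat \<Rightarrow> real) \<Rightarrow> (nat \<Rightarrow> real) \<Rightarrow> real" where
  "lin_form n y x = (\<Sum>j=1..n. y j * x j)"

lemma lin_form_perturb:
  assumes "k \<in> {1..n}"
  shows "lin_form n (\<lambda>j. y j + s * (if j = k then 1 else 0)) x = lin_form n y x + s * x k"
proof -
  have "lin_form n (\<lambda>j. y j + s * (if j = k then 1 else 0)) x
      = lin_form n y x + (\<Sum>j=1..n. if j = k then s * x k else 0)"
    unfolding lin_form_def sum.distrib[symmetric]
    by (intro sum.cong) (auto simp: algebra_simps)
  then show ?thesis using assms by simp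
qed

text \<open>A list of coordinates with repetitions: prepending an element multiplies by a
  coordinate, which fits both the product rule and the rule \<open>coord\<close> of
  \<open>poly_diff\<close>.\<close>

definition monomial :: "nat list \<Rightarrow> (nat \<Rightarrow> real) \<Rightarrow> real" where
  "monomial ks x = prod_list (map x ks)"

primrec diff_monomial :: "nat \<Rightarrow> nat list \<Rightarrow> (nat \<Rightarrow> real) \<Rightarrow> real" where
  "diff_monomial l [] x = 0"
| "diff_monomial l (k # ks) x = (if l = k then monomial ks x else 0) + x k * diff_monomial l ks x"

text \<open>\<open>poly_diff n f f'\<close>: \<open>f\<close> is a polynomial in the coordinates \<open>1, \<dots>, n\<close> and \<open>f' l\<close> is its formal
  partial derivative in direction \<open>l\<close>.\<close>

inductive poly_diff ::
    "nat \<Rightarrow> ((nat \<Rightarrow> real) \<Rightarrow> real) \<Rightarrow> (nat \<Rightarrow> (nat \<Rightarrow> real) \<Rightarrow> real) \<Rightarrow> bool" for n where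
  const: "poly_diff n (\<lambda>x. c) (\<lambda>l x. 0)"
| add: "poly_diff n f f' \<Longrightarrow> poly_diff n h h' \<Longrightarrow>
    poly_diff n (\<lambda>x. f x + h x) (\<lambda>l x. f' l x + h' l x)"
| scale: "poly_diff n f f' \<Longrightarrow> poly_diff n (\<lambda>x. c * f x) (\<lambda>l x. c * f' l x)"
| coord: "k \<in> {1..n} \<Longrightarrow> poly_diff n f f' \<Longrightarrow>
    poly_diff n (\<lambda>x. x k * f x) (\<lambda>l x. (if l = k then f x else 0) + x k * f' l x)"
| cong: "poly_diff n f f' \<Longrightarrow> (\<And>l. l \<in> {1..n} \<Longrightarrow> f' l = f'' l) \<Longrightarrow> poly_diff n f f''"

lemma poly_diff_sum:
  assumes "\<And>i. i \<in> S \<Longrightarrow> poly_diff n (f i) (f' i)"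
  shows "poly_diff n (\<lambda>x. \<Sum>i\<in>S. f i x) (\<lambda>l x. \<Sum>i\<in>S. f' i l x)"
  using assms
proof (induction S rule: infinite_finite_induct)
  case (insert i S)
  then show ?case
    using poly_diff.add[of n "f i" "f' i" "\<lambda>x. \<Sum>i\<in>S. f i x" "\<lambda>l x. \<Sum>i\<in>S. f' i l x"] by simp
qed (use poly_diff.const[of n 0] in auto)

context prob_space
begin

context
  fixes n :: nat and g :: "'a \<Rightarrow> nat \<Rightarrow> real" and C :: "nat \<Rightarrow> nat \<Rightarrow> real"
  assumes gauss: "gaussian_vector M n g C" and C: "psd n C"
begin

text \<open>Apart from measurability, these moments are all that later arguments use about the law
  of \<open>g\<close>.\<close>

lemma gaussian_moment:
  "has_bochner_integral M (\<lambda>\<omega>. lin_form n u (g \<omega>) ^ N)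
    (gauss_moment N * (\<Sum>i=1..n. \<Sum>j=1..n. u i * C i j * u j) ^ (N div 2))"
proof -
  let ?v = "\<Sum>i=1..n. \<Sum>j=1..n. u i * C i j * u j"
  have meas: "(\<lambda>\<omega>. \<Sum>j=1..n. u j * g \<omega> j) \<in> borel_measurable M"
    using gauss unfolding gaussian_vector_def by (auto intro!: borel_measurable_sum)
  have "has_bochner_integral (distr M borel (\<lambda>\<omega>. \<Sum>j=1..n. u j * g \<omega> j)) (\<lambda>x. x ^ N)
      (gauss_moment N * ?v ^ (N div 2))"
    using normal_measure_moment[of ?v N] gauss C unfolding gaussian_vector_def psd_def by metis
  then show ?thesis
    using meas
    by (simp add: has_bochner_integral_iff integrable_distr_eq integral_distr lin_form_def)
qed

lemma gaussian_lin_form_moments: "all_moments M (\<lambda>\<omega>. lin_form n u (g \<omega>))"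
  unfolding all_moments_def
proof (intro conjI allI)
  show "(\<lambda>\<omega>. lin_form n u (g \<omega>)) \<in> borel_measurable M"
    using gauss unfolding gaussian_vector_def lin_form_def by (auto intro!: borel_measurable_sum)
  show "integrable M (\<lambda>\<omega>. lin_form n u (g \<omega>) ^ N)" for N
    using gaussian_moment[of u N] by (simp add: has_bochner_integral_iff)
qed

lemma gaussian_coord_moments:
  assumes "k \<in> {1..n}"
  shows "all_moments M (\<lambda>\<omega>. g \<omega> k)"
  \<comment> \<open>The unit vector is written as a perturbation of 0 so that
    \<open>lin_form_perturb\<close> rewrites the form to the coordinate.\<close>
  using gaussian_lin_form_moments[of "\<lambda>j. 0 + 1 * (if j = k then 1 else 0)"]
  unfolding lin_form_perturb[OF assms] by (simp add: lin_form_def)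

lemma monomial_moments: "set ks \<subseteq> {1..n} \<Longrightarrow> all_moments M (\<lambda>\<omega>. monomial ks (g \<omega>))"
  unfolding monomial_def
proof (induction ks)
  case (Cons k ks)
  then have "all_moments M (\<lambda>\<omega>. g \<omega> k * prod_list (map (g \<omega>) ks))"
    by (intro all_moments_mult gaussian_coord_moments) simp_all
  then show ?case by simp
qed (simp add: all_moments_const)

lemma diff_monomial_moments:
  "set ks \<subseteq> {1..n} \<Longrightarrow> all_moments M (\<lambda>\<omega>. diff_monomial l ks (g \<omega>))"
proof (induction ks)
  case (Cons k ks)
  have "all_moments M (\<lambda>\<omega>. if l = k then monomial ks (g \<omega>) else 0)"
    using monomial_moments[of ks] Cons.prems by (cases "l = k") (simp_all add: all_moments_const)
  moreover have "all_moments M (\<lambda>\<omega>. g \<omega> k * diff_monomial l ks (g \<omega>))"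
    using Cons by (intro all_moments_mult gaussian_coord_moments) simp_all
  ultimately show ?case
    unfolding diff_monomial.simps by (rule all_moments_add)
qed (simp add: all_moments_const)

lemma poly_diff_moments:
  assumes "poly_diff n f f'"
  shows "all_moments M (\<lambda>\<omega>. f (g \<omega>))" "l \<in> {1..n} \<Longrightarrow> all_moments M (\<lambda>\<omega>. f' l (g \<omega>))"
proof -
  have "all_moments M (\<lambda>\<omega>. f (g \<omega>)) \<and> (\<forall>l\<in>{1..n}. all_moments M (\<lambda>\<omega>. f' l (g \<omega>)))"
    using assms
  proof induction
    case (coord k f f')
    have "all_moments M (\<lambda>\<omega>. if l = k then f (g \<omega>) else 0)" for l
      using coord.IH by (cases "l = k") (auto intro: all_moments_const)
    then show ?case
      using coord by (auto intro!: all_moments_add all_moments_mult gaussian_coord_moments)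
  qed (auto intro: all_moments_const all_moments_add all_moments_mult)
  then show "all_moments M (\<lambda>\<omega>. f (g \<omega>))"
    "l \<in> {1..n} \<Longrightarrow> all_moments M (\<lambda>\<omega>. f' l (g \<omega>))" by auto
qed

text \<open>Replace \<open>y\<close> by \<open>y\<close> plus \<open>s\<close> times the
  \<open>w\<close>-th unit vector in the moment formula of order \<open>Suc N\<close> and
  differentiate at \<open>s = 0\<close>. The variance changes to first order by
  \<open>2 * s * c\<close>, the factor 2 coming from the symmetry of \<open>C\<close>.\<close>

lemma gaussian_ibp_power:
  assumes w: "w \<in> {1..n}"
  shows "(\<integral>\<omega>. g \<omega> w * lin_form n y (g \<omega>) ^ N \<partial>M)
    = real N * (\<Sum>l=1..n. C w l * y l) * (\<integral>\<omega>. lin_form n y (g \<omega>) ^ (N - 1) \<partial>M)"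
proof -
  define Q where "Q = (\<Sum>i=1..n. \<Sum>j=1..n. y i * C i j * y j)"
  define c where "c = (\<Sum>l=1..n. C w l * y l)"
  define e where "e j = (if j = w then 1 else 0 :: real)" for j
  have quad: "(\<Sum>i=1..n. \<Sum>j=1..n. (y i + s * e i) * C i j * (y j + s * e j))
      = Q + 2 * s * c + s\<^sup>2 * C w w" for s
  proof -
    have "(\<Sum>i=1..n. \<Sum>j=1..n. (y i + s * e i) * C i j * (y j + s * e j))
        = (\<Sum>i=1..n. \<Sum>j=1..n. y i * C i j * y j) + s * (\<Sum>i=1..n. \<Sum>j=1..n. y i * C i j * e j)
          + s * (\<Sum>i=1..n. \<Sum>j=1..n. e i * C i j * y j)
          + s\<^sup>2 * (\<Sum>i=1..n. \<Sum>j=1..n. e i * C i j * e j)"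
      by (simp add: algebra_simps sum.distrib sum_distrib_left power2_eq_square)
    also have "(\<Sum>i=1..n. \<Sum>j=1..n. y i * C i j * e j) = c"
    proof -
      have "(\<Sum>j=1..n. y i * C i j * e j) = C w i * y i" if "i \<in> {1..n}" for i
      proof -
        have "(\<Sum>j=1..n. y i * C i j * e j) = (\<Sum>j=1..n. if j = w then y i * C i w else 0)"
          by (intro sum.cong) (auto simp: e_def)
        also have "\<dots> = y i * C i w" using w by simp
        also have "C i w = C w i" using C w that by (auto simp: psd_def)
        finally show ?thesis by simp
      qed
      then show ?thesis by (simp add: c_def)
    qed
    also have "(\<Sum>i=1..n. \<Sum>j=1..n. e i * C i j * y j) = c"
    proof -
      have "(\<Sum>i=1..n. \<Sum>j=1..n. e i * C i j * y j) = (\<Sum>i=1..n. if i = w then c else 0)"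
        by (intro sum.cong) (auto simp: e_def c_def)
      then show ?thesis using w by simp
    qed
    also have "(\<Sum>i=1..n. \<Sum>j=1..n. e i * C i j * e j) = C w w"
    proof -
      have "(\<Sum>i=1..n. \<Sum>j=1..n. e i * C i j * e j)
          = (\<Sum>i=1..n. if i = w then (\<Sum>j=1..n. if j = w then C w w else 0) else 0)"
        by (intro sum.cong refl) (simp add: e_def if_distrib cong: if_cong)
      then show ?thesis using w by simp
    qed
    finally show ?thesis by (simp add: Q_def)
  qed
  have lin: "lin_form n (\<lambda>j. y j + s * e j) x = lin_form n y x + s * x w" for s x
    unfolding e_def by (rule lin_form_perturb[OF w])
  have "(\<integral>\<omega>. 1 * (lin_form n y (g \<omega>) + s * g \<omega> w) ^ Suc N \<partial>M)
      = gauss_moment (Suc N) * (Q + 2 * s * c + s\<^sup>2 * C w w) ^ (Suc N div 2)" for s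
    using has_bochner_integral_integral_eq[OF gaussian_moment[of "\<lambda>j. y j + s * e j" "Suc N"]]
    unfolding quad lin mult_1_left .
  then have "((\<lambda>s. gauss_moment (Suc N) * (Q + 2 * s * c + s\<^sup>2 * C w w) ^ (Suc N div 2))
      has_real_derivative
      (real (Suc N) * (\<integral>\<omega>. 1 * lin_form n y (g \<omega>) ^ (Suc N - 1) * g \<omega> w \<partial>M))) (at 0)"
    using DERIV_expectation_power[OF all_moments_const[of 1] gaussian_lin_form_moments[of y]
        gaussian_coord_moments[OF w], of "Suc N"] by presburger
  moreover have "((\<lambda>s. gauss_moment (Suc N) * (Q + 2 * s * c + s\<^sup>2 * C w w) ^ (Suc N div 2))
      has_real_derivative
      (gauss_moment (Suc N) * (real (Suc N div 2) * Q ^ (Suc N div 2 - 1) * (2 * c)))) (at 0)"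
    by (auto intro!: derivative_eq_intros)
  ultimately have "real (Suc N) * (\<integral>\<omega>. 1 * lin_form n y (g \<omega>) ^ (Suc N - 1) * g \<omega> w \<partial>M)
      = gauss_moment (Suc N) * (real (Suc N div 2) * Q ^ (Suc N div 2 - 1) * (2 * c))"
    by (rule DERIV_unique)
  then have eq: "real (Suc N) * (\<integral>\<omega>. g \<omega> w * lin_form n y (g \<omega>) ^ N \<partial>M)
      = gauss_moment (Suc N) * (real (Suc N div 2) * Q ^ (Suc N div 2 - 1) * (2 * c))"
    by (simp add: mult.commute)
  have m: "(\<integral>\<omega>. lin_form n y (g \<omega>) ^ (N - 1) \<partial>M) = gauss_moment (N - 1) * Q ^ ((N - 1) div 2)"
    using has_bochner_integral_integral_eq[OF gaussian_moment[of y "N - 1"]] by (simp add: Q_def)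
  \<comment> \<open>For even \<open>N\<close> both sides vanish, by an odd moment or by the factor
    \<open>N = 0\<close>. For odd \<open>N\<close>, halving the exponent \<open>Suc N\<close>
    cancels the 2 of the cross term, and the recurrence for \<open>gauss_moment\<close> supplies the
    factor \<open>N\<close>.\<close>
  show ?thesis
  proof (cases "even N")
    case True
    have "gauss_moment (Suc N) = 0" using True by (simp add: gauss_moment_def)
    then have "(\<integral>\<omega>. g \<omega> w * lin_form n y (g \<omega>) ^ N \<partial>M) = 0" using eq by simp
    moreover have "real N * c * (gauss_moment (N - 1) * Q ^ ((N - 1) div 2)) = 0"
      using True by (cases "N = 0") (simp_all add: gauss_moment_def)
    ultimately show ?thesis unfolding m c_def by (rule trans[OF _ sym])
  next
    case False
    then obtain k where k: "N = 2 * k + 1" using oddE by blast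
    have "real (Suc N) * (\<integral>\<omega>. g \<omega> w * lin_form n y (g \<omega>) ^ N \<partial>M)
        = real (Suc N) * (real N * c * (gauss_moment (N - 1) * Q ^ ((N - 1) div 2)))"
    proof -
      have gm: "gauss_moment (Suc N) = real N * gauss_moment (N - 1)"
        using gauss_moment_Suc_Suc[of "2 * k"] unfolding k by simp
      have half: "real (Suc N div 2) * (2 * c) = real (Suc N) * c" "Suc N div 2 - 1 = (N - 1) div 2"
        unfolding k by simp_all
      have "real (Suc N) * (\<integral>\<omega>. g \<omega> w * lin_form n y (g \<omega>) ^ N \<partial>M)
          = gauss_moment (Suc N) * Q ^ (Suc N div 2 - 1) * (real (Suc N div 2) * (2 * c))"
        unfolding eq by (simp only: mult_ac)
      also have "\<dots> = real (Suc N) * (real N * c * (gauss_moment (N - 1) * Q ^ ((N - 1) div 2)))"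
        unfolding gm half by (simp only: mult_ac)
      finally show ?thesis .
    qed
    then show ?thesis unfolding m c_def[symmetric] by (subst (asm) mult_cancel_left) auto
  qed
qed

text \<open>Polarization: the identity for one more linear factor is the derivative at \<open>s = 0\<close> of the
  identity in which \<open>y\<close> is replaced by \<open>y + s e\<^sub>k\<close> and the power is raised by one.\<close>

lemma gaussian_ibp_monomial:
  assumes w: "w \<in> {1..n}" and "set ks \<subseteq> {1..n}"
  shows "(\<integral>\<omega>. g \<omega> w * monomial ks (g \<omega>) * lin_form n y (g \<omega>) ^ N \<partial>M)
    = (\<Sum>l=1..n. C w l * (\<integral>\<omega>. diff_monomial l ks (g \<omega>) * lin_form n y (g \<omega>) ^ N \<partial>M))
      + real N * (\<Sum>l=1..n. C w l * y l)
        * (\<integral>\<omega>. monomial ks (g \<omega>) * lin_form n y (g \<omega>) ^ (N - 1) \<partial>M)"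
  using assms(2)
proof (induction ks arbitrary: y N)
  case Nil
  show ?case using gaussian_ibp_power[OF w, of y N] by (simp add: monomial_def)
next
  case (Cons k ks)
  then have k: "k \<in> {1..n}" and ks: "set ks \<subseteq> {1..n}" by auto
  define L where "L = (\<lambda>\<omega>. lin_form n y (g \<omega>))"
  define c where "c = (\<Sum>l=1..n. C w l * y l)"
  note mom = monomial_moments[OF ks] diff_monomial_moments[OF ks] gaussian_coord_moments[OF w]
    gaussian_coord_moments[OF k] gaussian_lin_form_moments[of y, folded L_def]
  have lin: "lin_form n (\<lambda>j. y j + s * (if j = k then 1 else 0)) (g \<omega>) = L \<omega> + s * g \<omega> k" for s \<omega>
    unfolding L_def by (rule lin_form_perturb[OF k])
  have cs: "(\<Sum>l=1..n. C w l * (y l + s * (if l = k then 1 else 0))) = c + s * C w k" for s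
  proof -
    have "(\<Sum>l=1..n. C w l * (y l + s * (if l = k then 1 else 0)))
        = c + (\<Sum>l=1..n. if l = k then s * C w k else 0)"
      unfolding c_def sum.distrib[symmetric] by (intro sum.cong) (auto simp: algebra_simps)
    then show ?thesis using k by simp
  qed
  have IH: "(\<integral>\<omega>. g \<omega> w * monomial ks (g \<omega>) * (L \<omega> + s * g \<omega> k) ^ Suc N \<partial>M)
    = (\<Sum>l=1..n. C w l * (\<integral>\<omega>. diff_monomial l ks (g \<omega>) * (L \<omega> + s * g \<omega> k) ^ Suc N \<partial>M))
      + real (Suc N) * (c + s * C w k) * (\<integral>\<omega>. monomial ks (g \<omega>) * (L \<omega> + s * g \<omega> k) ^ N \<partial>M)" for s
    using Cons.IH[OF ks, of "\<lambda>j. y j + s * (if j = k then 1 else 0)" "Suc N"]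
    unfolding lin cs by simp
  have D: "((\<lambda>s. \<integral>\<omega>. h \<omega> * (L \<omega> + s * g \<omega> k) ^ N \<partial>M) has_real_derivative
      (real N * (\<integral>\<omega>. h \<omega> * L \<omega> ^ (N - 1) * g \<omega> k \<partial>M))) (at 0)"
    if "all_moments M h" for h N
    using that mom by (intro DERIV_expectation_power) auto
  have "((\<lambda>s. (\<integral>\<omega>. g \<omega> w * monomial ks (g \<omega>) * (L \<omega> + s * g \<omega> k) ^ Suc N \<partial>M))
      has_real_derivative (real (Suc N) *
      (\<integral>\<omega>. g \<omega> w * monomial ks (g \<omega>) * L \<omega> ^ (Suc N - 1) * g \<omega> k \<partial>M))) (at 0)"
    using mom by (intro D all_moments_mult) auto
  moreover have "((\<lambda>s. (\<Sum>l=1..n. C w l * (\<integral>\<omega>. diff_monomial l ks (g \<omega>) * (L \<omega> + s * g \<omega> k) ^ Suc N \<partial>M))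
      + real (Suc N) * (c + s * C w k) * (\<integral>\<omega>. monomial ks (g \<omega>) * (L \<omega> + s * g \<omega> k) ^ N \<partial>M))
      has_real_derivative
      ((\<Sum>l=1..n. C w l * (real (Suc N) * (\<integral>\<omega>. diff_monomial l ks (g \<omega>) * L \<omega> ^ (Suc N - 1) * g \<omega> k \<partial>M)))
      + (real (Suc N) * c * (real N * (\<integral>\<omega>. monomial ks (g \<omega>) * L \<omega> ^ (N - 1) * g \<omega> k \<partial>M))
        + real (Suc N) * C w k * (\<integral>\<omega>. monomial ks (g \<omega>) * L \<omega> ^ N \<partial>M)))) (at 0)"
  proof (intro DERIV_add DERIV_sum DERIV_cmult D mom)
    have "((\<lambda>s. real (Suc N) * (c + s * C w k)) has_real_derivative real (Suc N) * C w k) (at 0)"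
      by (auto intro!: derivative_eq_intros)
    from DERIV_mult[OF this D[OF mom(1), of N]]
    show "((\<lambda>s. real (Suc N) * (c + s * C w k) * (\<integral>\<omega>. monomial ks (g \<omega>) * (L \<omega> + s * g \<omega> k) ^ N \<partial>M))
      has_real_derivative
      (real (Suc N) * c * (real N * (\<integral>\<omega>. monomial ks (g \<omega>) * L \<omega> ^ (N - 1) * g \<omega> k \<partial>M))
        + real (Suc N) * C w k * (\<integral>\<omega>. monomial ks (g \<omega>) * L \<omega> ^ N \<partial>M))) (at 0)"
      by (simp add: mult_ac add.commute)
  qed
  ultimately have "real (Suc N) *
      (\<integral>\<omega>. g \<omega> w * monomial ks (g \<omega>) * L \<omega> ^ (Suc N - 1) * g \<omega> k \<partial>M)
    = (\<Sum>l=1..n. C w l * (real (Suc N) * (\<integral>\<omega>. diff_monomial l ks (g \<omega>) * L \<omega> ^ (Suc N - 1) * g \<omega> k \<partial>M)))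
      + (real (Suc N) * c * (real N * (\<integral>\<omega>. monomial ks (g \<omega>) * L \<omega> ^ (N - 1) * g \<omega> k \<partial>M))
        + real (Suc N) * C w k * (\<integral>\<omega>. monomial ks (g \<omega>) * L \<omega> ^ N \<partial>M))"
    unfolding IH by (rule DERIV_unique)
  also have "\<dots> = real (Suc N) *
      ((\<Sum>l=1..n. C w l * (\<integral>\<omega>. diff_monomial l ks (g \<omega>) * L \<omega> ^ N * g \<omega> k \<partial>M))
      + real N * c * (\<integral>\<omega>. monomial ks (g \<omega>) * L \<omega> ^ (N - 1) * g \<omega> k \<partial>M)
        + C w k * (\<integral>\<omega>. monomial ks (g \<omega>) * L \<omega> ^ N \<partial>M))"
    by (simp only: sum_distrib_left distrib_left mult_ac diff_Suc_1 add.assoc)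
  finally have main: "(\<integral>\<omega>. g \<omega> w * monomial ks (g \<omega>) * L \<omega> ^ N * g \<omega> k \<partial>M)
    = (\<Sum>l=1..n. C w l * (\<integral>\<omega>. diff_monomial l ks (g \<omega>) * L \<omega> ^ N * g \<omega> k \<partial>M))
      + real N * c * (\<integral>\<omega>. monomial ks (g \<omega>) * L \<omega> ^ (N - 1) * g \<omega> k \<partial>M)
        + C w k * (\<integral>\<omega>. monomial ks (g \<omega>) * L \<omega> ^ N \<partial>M)"
    by (subst (asm) mult_cancel_left) auto
  have diff: "(\<integral>\<omega>. diff_monomial l (k # ks) (g \<omega>) * L \<omega> ^ N \<partial>M)
      = (if l = k then (\<integral>\<omega>. monomial ks (g \<omega>) * L \<omega> ^ N \<partial>M) else 0)
        + (\<integral>\<omega>. diff_monomial l ks (g \<omega>) * L \<omega> ^ N * g \<omega> k \<partial>M)" for l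
  proof -
    have i: "integrable M (\<lambda>\<omega>. (if l = k then monomial ks (g \<omega>) else 0) * L \<omega> ^ N)"
      using mom by (cases "l = k") (auto intro!: all_moments_integrable all_moments_mult all_moments_power)
    have i': "integrable M (\<lambda>\<omega>. diff_monomial l ks (g \<omega>) * L \<omega> ^ N * g \<omega> k)"
      using mom by (auto intro!: all_moments_integrable all_moments_mult all_moments_power)
    have "(\<integral>\<omega>. diff_monomial l (k # ks) (g \<omega>) * L \<omega> ^ N \<partial>M)
        = (\<integral>\<omega>. (if l = k then monomial ks (g \<omega>) else 0) * L \<omega> ^ N
            + diff_monomial l ks (g \<omega>) * L \<omega> ^ N * g \<omega> k \<partial>M)"
      by (intro Bochner_Integration.integral_cong refl) (simp add: algebra_simps)
    also have "\<dots> = (\<integral>\<omega>. (if l = k then monomial ks (g \<omega>) else 0) * L \<omega> ^ N \<partial>M)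
        + (\<integral>\<omega>. diff_monomial l ks (g \<omega>) * L \<omega> ^ N * g \<omega> k \<partial>M)"
      by (rule Bochner_Integration.integral_add[OF i i'])
    finally show ?thesis by auto
  qed
  \<comment> \<open>Differentiating the factor \<open>c + s * C w k\<close> produced a term with
    \<open>C w k\<close>; it is exactly the summand that the product rule contributes when
    \<open>l\<close> hits the new coordinate \<open>k\<close>.\<close>
  have "(\<Sum>l=1..n. C w l * (\<integral>\<omega>. diff_monomial l (k # ks) (g \<omega>) * L \<omega> ^ N \<partial>M))
      = (\<Sum>l=1..n. if l = k then C w k * (\<integral>\<omega>. monomial ks (g \<omega>) * L \<omega> ^ N \<partial>M) else 0)
        + (\<Sum>l=1..n. C w l * (\<integral>\<omega>. diff_monomial l ks (g \<omega>) * L \<omega> ^ N * g \<omega> k \<partial>M))"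
    unfolding sum.distrib[symmetric] diff by (intro sum.cong) (auto simp: algebra_simps)
  also have "(\<Sum>l=1..n. if l = k then C w k * (\<integral>\<omega>. monomial ks (g \<omega>) * L \<omega> ^ N \<partial>M) else 0)
      = C w k * (\<integral>\<omega>. monomial ks (g \<omega>) * L \<omega> ^ N \<partial>M)" using k by simp
  finally have "(\<Sum>l=1..n. C w l * (\<integral>\<omega>. diff_monomial l (k # ks) (g \<omega>) * L \<omega> ^ N \<partial>M))
      = C w k * (\<integral>\<omega>. monomial ks (g \<omega>) * L \<omega> ^ N \<partial>M)
        + (\<Sum>l=1..n. C w l * (\<integral>\<omega>. diff_monomial l ks (g \<omega>) * L \<omega> ^ N * g \<omega> k \<partial>M))" .
  moreover have "(\<integral>\<omega>. g \<omega> w * monomial (k # ks) (g \<omega>) * L \<omega> ^ N \<partial>M)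
      = (\<integral>\<omega>. g \<omega> w * monomial ks (g \<omega>) * L \<omega> ^ N * g \<omega> k \<partial>M)"
    by (simp add: monomial_def mult_ac)
  moreover have "(\<integral>\<omega>. monomial (k # ks) (g \<omega>) * L \<omega> ^ (N - 1) \<partial>M)
      = (\<integral>\<omega>. monomial ks (g \<omega>) * L \<omega> ^ (N - 1) * g \<omega> k \<partial>M)"
    by (simp add: monomial_def mult_ac)
  ultimately have "(\<integral>\<omega>. g \<omega> w * monomial (k # ks) (g \<omega>) * L \<omega> ^ N \<partial>M)
    = (\<Sum>l=1..n. C w l * (\<integral>\<omega>. diff_monomial l (k # ks) (g \<omega>) * L \<omega> ^ N \<partial>M))
      + real N * c * (\<integral>\<omega>. monomial (k # ks) (g \<omega>) * L \<omega> ^ (N - 1) \<partial>M)"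
    using main by (simp only: add_ac)
  then show ?case
    unfolding L_def c_def .
qed

text \<open>The monomial in front generalizes the claim for the induction over
  \<open>poly_diff\<close>: in the case \<open>coord\<close> the coordinate is pushed onto the list,
  and the case \<open>const\<close> is \<open>gaussian_ibp_monomial\<close> with
  \<open>y = 0\<close> and \<open>N = 0\<close>.\<close>

lemma gaussian_ibp_aux:
  assumes w: "w \<in> {1..n}" and "poly_diff n f f'" and "set ks \<subseteq> {1..n}"
  shows "(\<integral>\<omega>. g \<omega> w * (monomial ks (g \<omega>) * f (g \<omega>)) \<partial>M)
    = (\<Sum>l=1..n. C w l * (\<integral>\<omega>. diff_monomial l ks (g \<omega>) * f (g \<omega>) + monomial ks (g \<omega>) * f' l (g \<omega>) \<partial>M))"
  using assms(2,3)
proof (induction arbitrary: ks)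
  case (const c)
  have "(\<integral>\<omega>. g \<omega> w * (monomial ks (g \<omega>) * c) \<partial>M) = c * (\<integral>\<omega>. g \<omega> w * monomial ks (g \<omega>) \<partial>M)"
    by (simp add: mult_ac)
  also have "(\<integral>\<omega>. g \<omega> w * monomial ks (g \<omega>) \<partial>M)
      = (\<Sum>l=1..n. C w l * (\<integral>\<omega>. diff_monomial l ks (g \<omega>) \<partial>M))"
    using gaussian_ibp_monomial[OF w const.prems, of "\<lambda>_. 0" 0] by simp
  finally show ?case by (simp add: sum_distrib_left mult_ac)
next
  case (add f f' h h')
  note m = monomial_moments[OF add.prems] diff_monomial_moments[OF add.prems]
    gaussian_coord_moments[OF w] poly_diff_moments[OF add.hyps(1)] poly_diff_moments[OF add.hyps(2)]
  have "(\<integral>\<omega>. g \<omega> w * (monomial ks (g \<omega>) * (f (g \<omega>) + h (g \<omega>))) \<partial>M)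
      = (\<integral>\<omega>. g \<omega> w * (monomial ks (g \<omega>) * f (g \<omega>)) + g \<omega> w * (monomial ks (g \<omega>) * h (g \<omega>)) \<partial>M)"
    by (simp add: algebra_simps)
  also have "\<dots> = (\<integral>\<omega>. g \<omega> w * (monomial ks (g \<omega>) * f (g \<omega>)) \<partial>M)
      + (\<integral>\<omega>. g \<omega> w * (monomial ks (g \<omega>) * h (g \<omega>)) \<partial>M)"
    using m by (intro Bochner_Integration.integral_add all_moments_integrable all_moments_mult) auto
  also have "\<dots> = (\<Sum>l=1..n. C w l *
      ((\<integral>\<omega>. diff_monomial l ks (g \<omega>) * f (g \<omega>) + monomial ks (g \<omega>) * f' l (g \<omega>) \<partial>M)
      + (\<integral>\<omega>. diff_monomial l ks (g \<omega>) * h (g \<omega>) + monomial ks (g \<omega>) * h' l (g \<omega>) \<partial>M)))"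
    using add.IH[OF add.prems] by (simp add: sum.distrib distrib_left)
  also have "\<dots> = (\<Sum>l=1..n. C w l * (\<integral>\<omega>. diff_monomial l ks (g \<omega>) * (f (g \<omega>) + h (g \<omega>))
      + monomial ks (g \<omega>) * (f' l (g \<omega>) + h' l (g \<omega>)) \<partial>M))"
  proof (intro sum.cong refl arg_cong2[where f = "(*)"])
    fix l assume l: "l \<in> {1..n}"
    have "(\<integral>\<omega>. diff_monomial l ks (g \<omega>) * f (g \<omega>) + monomial ks (g \<omega>) * f' l (g \<omega>) \<partial>M)
        + (\<integral>\<omega>. diff_monomial l ks (g \<omega>) * h (g \<omega>) + monomial ks (g \<omega>) * h' l (g \<omega>) \<partial>M)
      = (\<integral>\<omega>. (diff_monomial l ks (g \<omega>) * f (g \<omega>) + monomial ks (g \<omega>) * f' l (g \<omega>))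
        + (diff_monomial l ks (g \<omega>) * h (g \<omega>) + monomial ks (g \<omega>) * h' l (g \<omega>)) \<partial>M)"
      using m l
      by (intro Bochner_Integration.integral_add[symmetric] all_moments_integrable all_moments_mult
          all_moments_add) auto
    then show "(\<integral>\<omega>. diff_monomial l ks (g \<omega>) * f (g \<omega>) + monomial ks (g \<omega>) * f' l (g \<omega>) \<partial>M)
        + (\<integral>\<omega>. diff_monomial l ks (g \<omega>) * h (g \<omega>) + monomial ks (g \<omega>) * h' l (g \<omega>) \<partial>M)
      = (\<integral>\<omega>. diff_monomial l ks (g \<omega>) * (f (g \<omega>) + h (g \<omega>))
          + monomial ks (g \<omega>) * (f' l (g \<omega>) + h' l (g \<omega>)) \<partial>M)"
      by (simp add: algebra_simps)
  qed
  finally show ?case .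
next
  case (scale f f' c)
  have "(\<integral>\<omega>. g \<omega> w * (monomial ks (g \<omega>) * (c * f (g \<omega>))) \<partial>M)
      = c * (\<integral>\<omega>. g \<omega> w * (monomial ks (g \<omega>) * f (g \<omega>)) \<partial>M)"
    by (simp add: mult_ac flip: integral_mult_right_zero)
  also have "\<dots> = (\<Sum>l=1..n. C w l *
      (c * (\<integral>\<omega>. diff_monomial l ks (g \<omega>) * f (g \<omega>) + monomial ks (g \<omega>) * f' l (g \<omega>) \<partial>M)))"
    unfolding scale.IH[OF scale.prems] by (simp add: sum_distrib_left mult_ac)
  finally show ?case by (simp add: algebra_simps flip: integral_mult_right_zero)
next
  case (coord k f f')
  then have "set (k # ks) \<subseteq> {1..n}" by simp
  note IH = coord.IH[OF this]
  have "monomial (k # ks) x * f x = monomial ks x * (x k * f x)" for x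
    by (simp add: monomial_def)
  moreover have "diff_monomial l (k # ks) x * f x + monomial (k # ks) x * f' l x
      = diff_monomial l ks x * (x k * f x)
        + monomial ks x * ((if l = k then f x else 0) + x k * f' l x)" for l x
    by (cases "l = k") (simp_all add: monomial_def algebra_simps)
  ultimately show ?case using IH by (simp only:)
next
  case (cong f f' f'')
  show ?case unfolding cong.IH[OF cong.prems] using cong.hyps(2) by (intro sum.cong) auto
qed

lemma gaussian_ibp:
  assumes "w \<in> {1..n}" and "poly_diff n f f'"
  shows "(\<integral>\<omega>. g \<omega> w * f (g \<omega>) \<partial>M) = (\<Sum>l=1..n. C w l * (\<integral>\<omega>. f' l (g \<omega>) \<partial>M))"
  using gaussian_ibp_aux[OF assms, of "[]"] unfolding monomial_def by simp

end

end

section \<open>Spectral norms and trace moments of Gaussian matrix series\<close>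

lemma L2_set_sq: "(L2_set f S)\<^sup>2 = (\<Sum>i\<in>S. (f i)\<^sup>2)"
  by (simp add: L2_set_def sum_nonneg)

text \<open>A real supremum is informative only for bounded families; the sum of the absolute
  entries is a crude bound on the unit ball.\<close>

lemma spectral_norm_bdd:
  assumes "finite I" "finite J"
  shows "bdd_above ((\<lambda>x. L2_set (\<lambda>i. \<Sum>j\<in>J. A i j * x j) I) ` {x. L2_set x J \<le> 1})"
proof (rule bdd_aboveI2)
  fix x assume "x \<in> {x. L2_set x J \<le> 1}"
  then have x: "L2_set x J \<le> 1" by simp
  have xj: "\<bar>x j\<bar> \<le> 1" if "j \<in> J" for j
  proof -
    have "\<bar>x j\<bar> \<le> L2_set (\<lambda>j. \<bar>x j\<bar>) J" by (rule member_le_L2_set[OF assms(2) that])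
    also have "\<dots> = L2_set x J" by (simp add: L2_set_def)
    finally show ?thesis using x by simp
  qed
  have "L2_set (\<lambda>i. \<Sum>j\<in>J. A i j * x j) I \<le> (\<Sum>i\<in>I. \<bar>\<Sum>j\<in>J. A i j * x j\<bar>)"
    by (rule L2_set_le_sum_abs)
  also have "\<dots> \<le> (\<Sum>i\<in>I. \<Sum>j\<in>J. \<bar>A i j\<bar>)"
  proof (rule sum_mono)
    fix i
    have "\<bar>\<Sum>j\<in>J. A i j * x j\<bar> \<le> (\<Sum>j\<in>J. \<bar>A i j * x j\<bar>)" by (rule sum_abs)
    also have "\<dots> \<le> (\<Sum>j\<in>J. \<bar>A i j\<bar>)"
      using xj by (intro sum_mono) (simp add: abs_mult mult_left_le)
    finally show "\<bar>\<Sum>j\<in>J. A i j * x j\<bar> \<le> (\<Sum>j\<in>J. \<bar>A i j\<bar>)" .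
  qed
  finally show "L2_set (\<lambda>i. \<Sum>j\<in>J. A i j * x j) I \<le> (\<Sum>i\<in>I. \<Sum>j\<in>J. \<bar>A i j\<bar>)" .
qed

lemma spectral_norm_upper:
  assumes "finite I" "finite J" "L2_set x J \<le> 1"
  shows "L2_set (\<lambda>i. \<Sum>j\<in>J. A i j * x j) I \<le> spectral_norm I J A"
  unfolding spectral_norm_def
  by (rule cSUP_upper[OF _ spectral_norm_bdd[OF assms(1,2)]]) (simp add: assms)

lemma spectral_norm_least:
  assumes "\<And>x. L2_set x J \<le> 1 \<Longrightarrow> L2_set (\<lambda>i. \<Sum>j\<in>J. A i j * x j) I \<le> c"
  shows "spectral_norm I J A \<le> c"
  unfolding spectral_norm_def
proof (rule cSUP_least)
  have "L2_set (\<lambda>_. 0 :: real) J \<le> 1" by (simp add: L2_set_def)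
  then show "{x. L2_set x J \<le> 1} \<noteq> {}" by blast
qed (simp add: assms)

lemma spectral_norm_nonneg:
  assumes "finite I" "finite J"
  shows "0 \<le> spectral_norm I J A"
  using spectral_norm_upper[OF assms, of "\<lambda>_. 0" A] by (simp add: L2_set_def)

lemma spectral_norm_bound:
  assumes "finite I" "finite J"
  shows "L2_set (\<lambda>i. \<Sum>j\<in>J. A i j * x j) I \<le> spectral_norm I J A * L2_set x J"
proof (cases "L2_set x J = 0")
  case True
  then have "x j = 0" if "j \<in> J" for j
    using that assms by (simp add: L2_set_eq_0_iff)
  then have "L2_set (\<lambda>i. \<Sum>j\<in>J. A i j * x j) I = 0"
    by (simp add: L2_set_def)
  then show ?thesis using True by simp
next
  case False
  define c where "c = L2_set x J"
  have c: "c > 0" using False L2_set_nonneg[of x J] by (simp add: c_def less_le)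
  have "L2_set (\<lambda>j. (1 / c) * x j) J = (1 / c) * c"
    using c by (subst c_def) (simp only: L2_set_right_distrib less_imp_le zero_le_divide_1_iff)
  then have "L2_set (\<lambda>j. (1 / c) * x j) J \<le> 1" using c by simp
  from spectral_norm_upper[OF assms this, of A]
  have "L2_set (\<lambda>i. (1 / c) * (\<Sum>j\<in>J. A i j * x j)) I \<le> spectral_norm I J A"
    by (simp add: sum_distrib_left mult_ac)
  also have "L2_set (\<lambda>i. (1 / c) * (\<Sum>j\<in>J. A i j * x j)) I
      = (1 / c) * L2_set (\<lambda>i. \<Sum>j\<in>J. A i j * x j) I"
    using c by (simp only: L2_set_right_distrib less_imp_le zero_le_divide_1_iff)
  finally show ?thesis using c by (simp add: c_def field_simps)
qed

text \<open>The square of the norm of the transpose applied to \<open>u\<close> is the inner product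
  of \<open>u\<close> with \<open>A\<close> applied to that image; bound it by Cauchy-Schwarz and
  cancel one factor.\<close>

lemma spectral_norm_transpose_bound:
  assumes "finite I" "finite J"
  shows "L2_set (\<lambda>j. \<Sum>i\<in>I. A i j * u i) J \<le> spectral_norm I J A * L2_set u I"
proof -
  define v where "v = (\<lambda>j. \<Sum>i\<in>I. A i j * u i)"
  have "(L2_set v J)\<^sup>2 = (\<Sum>j\<in>J. \<Sum>i\<in>I. A i j * u i * v j)"
    unfolding L2_set_sq by (simp add: power2_eq_square v_def sum_distrib_right)
  also have "\<dots> = (\<Sum>i\<in>I. \<Sum>j\<in>J. A i j * u i * v j)" by (rule sum.swap)
  also have "\<dots> = (\<Sum>i\<in>I. u i * (\<Sum>j\<in>J. A i j * v j))"
    by (simp add: sum_distrib_left mult_ac)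
  also have "\<dots> \<le> (\<Sum>i\<in>I. \<bar>u i\<bar> * \<bar>\<Sum>j\<in>J. A i j * v j\<bar>)"
    by (intro sum_mono) (metis abs_ge_self abs_mult)
  also have "\<dots> \<le> L2_set u I * L2_set (\<lambda>i. \<Sum>j\<in>J. A i j * v j) I"
    by (rule L2_set_mult_ineq)
  also have "\<dots> \<le> L2_set u I * (spectral_norm I J A * L2_set v J)"
    by (intro mult_left_mono spectral_norm_bound assms L2_set_nonneg)
  finally have le: "L2_set v J * L2_set v J \<le> (spectral_norm I J A * L2_set u I) * L2_set v J"
    by (simp add: power2_eq_square mult_ac)
  show ?thesis
  proof (cases "L2_set v J = 0")
    case True
    then show ?thesis
      using spectral_norm_nonneg[OF assms, of A] by (simp add: v_def)
  next
    case False
    then have "L2_set v J > 0" using L2_set_nonneg[of v J] by (simp add: less_le)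
    then show ?thesis using le by (simp add: v_def)
  qed
qed

lemma spectral_norm_entry:
  assumes "finite I" "finite J" "i \<in> I" "j \<in> J"
  shows "\<bar>A i j\<bar> \<le> spectral_norm I J A"
proof -
  define x where "x j' = (if j' = j then 1 else 0 :: real)" for j'
  have "L2_set x J = 1"
    using assms by (simp add: L2_set_def x_def if_distrib[of "\<lambda>x. x\<^sup>2"] cong: if_cong)
  moreover have "(\<Sum>j\<in>J. A i j * x j) = A i j" for i
    using assms by (simp add: x_def if_distrib[of "\<lambda>x. _ * x"] cong: if_cong)
  ultimately have "L2_set (\<lambda>i. A i j) I \<le> spectral_norm I J A"
    using spectral_norm_upper[OF assms(1,2), of x A] by simp
  moreover have "\<bar>A i j\<bar> \<le> L2_set (\<lambda>i. \<bar>A i j\<bar>) I"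
    by (rule member_le_L2_set[OF assms(1,3)])
  ultimately show ?thesis by (simp add: L2_set_def)
qed

text \<open>Measurability requires countably many test vectors. Comparing with
  \<open>c * L2_set x J\<close> trades the unit ball for homogeneity, so rational approximants are
  free to leave the ball; extensionality keeps the family countable.\<close>

lemma spectral_norm_greater_iff_rational:
  assumes "finite I" "finite J" "c \<ge> 0"
  shows "spectral_norm I J A > c \<longleftrightarrow>
    (\<exists>x \<in> J \<rightarrow>\<^sub>E \<rat>. L2_set (\<lambda>i. \<Sum>j\<in>J. A i j * x j) I > c * L2_set x J)"
proof
  assume "\<exists>x \<in> J \<rightarrow>\<^sub>E \<rat>. L2_set (\<lambda>i. \<Sum>j\<in>J. A i j * x j) I > c * L2_set x J"
  then obtain x where "L2_set (\<lambda>i. \<Sum>j\<in>J. A i j * x j) I > c * L2_set x J" by blast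
  then have "c * L2_set x J < spectral_norm I J A * L2_set x J"
    using spectral_norm_bound[OF assms(1,2), of A x] by linarith
  then show "spectral_norm I J A > c"
    using L2_set_nonneg[of x J] by (simp add: mult_less_cancel_right)
next
  assume "spectral_norm I J A > c"
  then obtain x where x: "L2_set x J \<le> 1" "L2_set (\<lambda>i. \<Sum>j\<in>J. A i j * x j) I > c"
    using spectral_norm_least[of J A I c] by (meson not_le)
  \<comment> \<open>From \<open>c \<ge> 0\<close> and \<open>L2_set x J \<le> 1\<close>. The
    inequality is open, so it persists for rational vectors close to \<open>x\<close>.\<close>
  have pos: "0 < L2_set (\<lambda>i. \<Sum>j\<in>J. A i j * x j) I - c * L2_set x J"
    using x assms(3) by (smt (verit) mult_left_le)
  have "\<forall>m j. \<exists>q. q \<in> \<rat> \<and> x j < q \<and> q < x j + 1 / real (Suc m)"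
    by (intro allI) (metis Rats_dense_in_real less_add_same_cancel1 of_nat_0_less_iff zero_less_Suc
        zero_less_divide_1_iff)
  then obtain q where q: "\<And>m j. q m j \<in> \<rat>" "\<And>m j. x j < q m j" "\<And>m j. q m j < x j + 1 / real (Suc m)"
    by metis
  have lim: "(\<lambda>m. q m j) \<longlonglongrightarrow> x j" for j
  proof (rule tendsto_sandwich[of "\<lambda>_. x j" _ _ "\<lambda>m. x j + 1 / real (Suc m)"])
    show "(\<lambda>m. x j + 1 / real (Suc m)) \<longlonglongrightarrow> x j"
      using tendsto_add[OF tendsto_const[of "x j"] LIMSEQ_Suc[OF lim_1_over_n]] by simp
    show "(\<lambda>_. x j) \<longlonglongrightarrow> x j" by simp
    show "\<forall>\<^sub>F m in sequentially. x j \<le> q m j" "\<forall>\<^sub>F m in sequentially. q m j \<le> x j + 1 / real (Suc m)"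
      using q(2,3) by (simp_all add: less_imp_le)
  qed
  have "(\<lambda>m. L2_set (\<lambda>i. \<Sum>j\<in>J. A i j * q m j) I - c * L2_set (q m) J)
      \<longlonglongrightarrow> L2_set (\<lambda>i. \<Sum>j\<in>J. A i j * x j) I - c * L2_set x J"
    unfolding L2_set_def by (intro tendsto_intros lim)
  from order_tendstoD(1)[OF this pos]
  have "\<exists>m. 0 < L2_set (\<lambda>i. \<Sum>j\<in>J. A i j * q m j) I - c * L2_set (q m) J"
    by (rule eventually_happens'[OF sequentially_bot])
  then obtain m where m: "0 < L2_set (\<lambda>i. \<Sum>j\<in>J. A i j * q m j) I - c * L2_set (q m) J" by blast
  have "restrict (q m) J \<in> J \<rightarrow>\<^sub>E \<rat>" using q(1) by simp
  moreover have "L2_set (restrict (q m) J) J = L2_set (q m) J" by (rule L2_set_cong) simp_all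
  moreover have "(\<Sum>j\<in>J. A i j * restrict (q m) J j) = (\<Sum>j\<in>J. A i j * q m j)" for i
    by (rule sum.cong) simp_all
  ultimately show "\<exists>x \<in> J \<rightarrow>\<^sub>E \<rat>. L2_set (\<lambda>i. \<Sum>j\<in>J. A i j * x j) I > c * L2_set x J"
    using m by (intro bexI[of _ "restrict (q m) J"]) simp_all
qed

lemma borel_measurable_spectral_norm:
  assumes "finite I" "finite J"
    and A: "\<And>i j. i \<in> I \<Longrightarrow> j \<in> J \<Longrightarrow> (\<lambda>\<omega>. A \<omega> i j) \<in> borel_measurable M"
  shows "(\<lambda>\<omega>. spectral_norm I J (A \<omega>)) \<in> borel_measurable M"
  unfolding borel_measurable_iff_greater
proof
  fix c :: real
  show "{\<omega> \<in> space M. c < spectral_norm I J (A \<omega>)} \<in> sets M"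
  proof (cases "c \<ge> 0")
    case True
    have "countable (J \<rightarrow>\<^sub>E (\<rat> :: real set))"
      using assms(2) countable_rat by (intro countable_PiE) simp_all
    moreover have "{\<omega> \<in> space M. L2_set (\<lambda>i. \<Sum>j\<in>J. A \<omega> i j * x j) I > c * L2_set x J} \<in> sets M" for x
    proof -
      have "(\<lambda>\<omega>. L2_set (\<lambda>i. \<Sum>j\<in>J. A \<omega> i j * x j) I) \<in> borel_measurable M"
        unfolding L2_set_def
        by (intro borel_measurable_sqrt[THEN measurable_compose[rotated]] borel_measurable_sum borel_measurable_power borel_measurable_times
            borel_measurable_const A)
      then show ?thesis by measurable
    qed
    ultimately have "(\<Union>x \<in> J \<rightarrow>\<^sub>E \<rat>.
        {\<omega> \<in> space M. L2_set (\<lambda>i. \<Sum>j\<in>J. A \<omega> i j * x j) I > c * L2_set x J}) \<in> sets M"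
      by (intro sets.countable_UN') auto
    moreover have "{\<omega> \<in> space M. c < spectral_norm I J (A \<omega>)} = (\<Union>x \<in> J \<rightarrow>\<^sub>E \<rat>.
        {\<omega> \<in> space M. L2_set (\<lambda>i. \<Sum>j\<in>J. A \<omega> i j * x j) I > c * L2_set x J})"
      unfolding spectral_norm_greater_iff_rational[OF assms(1,2) True] by blast
    ultimately show ?thesis by simp
  next
    case False
    then have "c < spectral_norm I J (A \<omega>)" for \<omega>
      using spectral_norm_nonneg[OF assms(1,2), of "A \<omega>"] by linarith
    then show ?thesis by simp
  qed
qed

text \<open>The Hermitian dilation: the symmetric block matrix with zero diagonal blocks,
  \<open>B\<close> in one corner and its transpose in the other. Entries outside the index sets are
  set to 0 to obtain a \<open>sym_mat\<close>.\<close>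

definition dilation :: "'i set \<Rightarrow> 'j set \<Rightarrow> ('i \<Rightarrow> 'j \<Rightarrow> real) \<Rightarrow> 'i + 'j \<Rightarrow> 'i + 'j \<Rightarrow> real" where
  "dilation I J B a b = (case a of
      Inl i \<Rightarrow> (case b of Inl _ \<Rightarrow> 0 | Inr j \<Rightarrow> if i \<in> I \<and> j \<in> J then B i j else 0)
    | Inr j \<Rightarrow> (case b of Inl i \<Rightarrow> if i \<in> I \<and> j \<in> J then B i j else 0 | Inr _ \<Rightarrow> 0))"

lemma dilation_simps [simp]:
  "dilation I J B (Inl i) (Inl i') = 0" "dilation I J B (Inr j) (Inr j') = 0"
  "dilation I J B (Inl i) (Inr j) = (if i \<in> I \<and> j \<in> J then B i j else 0)"
  "dilation I J B (Inr j) (Inl i) = (if i \<in> I \<and> j \<in> J then B i j else 0)"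
  by (simp_all add: dilation_def)

lemma sym_mat_dilation: "sym_mat (I <+> J) (dilation I J B)"
  unfolding sym_mat_def
proof (intro conjI allI impI)
  show "dilation I J B a b = dilation I J B b a" for a b
    by (cases a; cases b) simp_all
  show "dilation I J B a b = 0" if "a \<notin> I <+> J" for a b
    using that by (cases a; cases b) auto
qed

lemma dilation_apply:
  assumes "finite I" "finite J"
  shows "i \<in> I \<Longrightarrow> (\<Sum>b\<in>I <+> J. dilation I J B (Inl i) b * y b) = (\<Sum>j\<in>J. B i j * y (Inr j))"
    and "j \<in> J \<Longrightarrow> (\<Sum>b\<in>I <+> J. dilation I J B (Inr j) b * y b) = (\<Sum>i\<in>I. B i j * y (Inl i))"
  using assms by (simp_all add: sum.Plus)

lemma spectral_norm_power_le_trace: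
  assumes "finite I" "finite J" "I <+> J \<noteq> {}"
  shows "spectral_norm I J B ^ (2 * N) \<le> mat_tr (I <+> J) (mat_pow (I <+> J) (dilation I J B) (2 * N))"
    (is "_ \<le> ?t")
proof (cases "N = 0")
  case True
  have "1 \<le> card (I <+> J)"
    using assms by (metis One_nat_def Suc_leI card_gt_0_iff finite_Plus)
  then have "1 \<le> real (card (I <+> J))" by linarith
  then show ?thesis using True by (simp add: mat_tr_def mat_one_def)
next
  case False
  have fin: "finite (I <+> J)" using assms by simp
  have le: "L2_set (\<lambda>i. \<Sum>j\<in>J. B i j * x j) I ^ (2 * N) \<le> ?t" if x: "L2_set x J \<le> 1" for x
  proof -
    \<comment> \<open>The vector (0, x), which the dilation sends to (B x, 0).\<close>
    define y where "y = case_sum (\<lambda>_ :: 'a. 0 :: real) x"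
    have "L2_set y (I <+> J) = L2_set x J"
      using assms by (simp add: L2_set_def sum.Plus y_def)
    then have "L2_set y (I <+> J) \<le> 1" using x by simp
    from norm_power_le_trace[OF fin sym_mat_dilation[of I J B] this assms(3), of N]
    have "L2_set (\<lambda>a. \<Sum>b\<in>I <+> J. dilation I J B a b * y b) (I <+> J) ^ (2 * N) \<le> ?t" .
    also have "L2_set (\<lambda>a. \<Sum>b\<in>I <+> J. dilation I J B a b * y b) (I <+> J)
        = L2_set (\<lambda>i. \<Sum>j\<in>J. B i j * x j) I"
    proof -
      have "(\<Sum>a\<in>I <+> J. (\<Sum>b\<in>I <+> J. dilation I J B a b * y b)\<^sup>2)
          = (\<Sum>i\<in>I. (\<Sum>b\<in>I <+> J. dilation I J B (Inl i) b * y b)\<^sup>2)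
            + (\<Sum>j\<in>J. (\<Sum>b\<in>I <+> J. dilation I J B (Inr j) b * y b)\<^sup>2)"
        by (rule trans[OF sum.Plus[OF assms(1,2)]]) (simp only: o_def)
      also have "\<dots> = (\<Sum>i\<in>I. (\<Sum>j\<in>J. B i j * x j)\<^sup>2)"
        by (simp add: dilation_apply[OF assms(1,2)] y_def)
      finally show ?thesis by (simp add: L2_set_def)
    qed
    finally show ?thesis .
  qed
  have "0 \<le> ?t"
    by (rule order_trans[OF _ le[of "\<lambda>_. 0"]]) (simp_all add: L2_set_def)
  \<comment> \<open>Taking the root first avoids moving a supremum through a power.\<close>
  have "spectral_norm I J B \<le> root (2 * N) ?t"
  proof (rule spectral_norm_least)
    fix x assume "L2_set x J \<le> 1"
    from le[OF this] have "root (2 * N) (L2_set (\<lambda>i. \<Sum>j\<in>J. B i j * x j) I ^ (2 * N)) \<le> root (2 * N) ?t"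
      using False by (intro real_root_le_mono) simp_all
    then show "L2_set (\<lambda>i. \<Sum>j\<in>J. B i j * x j) I \<le> root (2 * N) ?t"
      using False by (simp add: real_root_power_cancel)
  qed
  then have "spectral_norm I J B ^ (2 * N) \<le> root (2 * N) ?t ^ (2 * N)"
    by (intro power_mono spectral_norm_nonneg assms)
  also have "\<dots> = ?t" using False \<open>0 \<le> ?t\<close> by simp
  finally show ?thesis .
qed

text \<open>The noncommutative product rule. Peeling off the leftmost factor, its own derivative
  gives the term \<open>a = 0\<close>, and the induction hypothesis gives the others with
  \<open>a\<close> shifted by one.\<close>

lemma poly_diff_mat_pow:
  fixes A :: "nat \<Rightarrow> 'i \<Rightarrow> 'i \<Rightarrow> real" and n :: nat
  assumes "finite I" and A: "\<And>k. sym_mat I (A k)"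
  defines "X \<equiv> \<lambda>x i j. \<Sum>k=1..n. x k * A k i j"
  shows "poly_diff n (\<lambda>x. mat_pow I (X x) N i j)
    (\<lambda>l x. \<Sum>a<N. mat_mul I (mat_pow I (X x) a) (mat_mul I (A l) (mat_pow I (X x) (N - 1 - a))) i j)"
proof (induction N arbitrary: i j)
  case 0
  show ?case using poly_diff.const[of n "mat_one I i j"] by simp
next
  case (Suc N)
  let ?D = "\<lambda>l x h j. \<Sum>a<N. mat_mul I (mat_pow I (X x) a) (mat_mul I (A l) (mat_pow I (X x) (N - 1 - a))) h j"
  have "poly_diff n (\<lambda>x. \<Sum>h\<in>I. \<Sum>k=1..n. A k i h * (x k * mat_pow I (X x) N h j))
      (\<lambda>l x. \<Sum>h\<in>I. \<Sum>k=1..n. A k i h * ((if l = k then mat_pow I (X x) N h j else 0) + x k * ?D l x h j))"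
    by (intro poly_diff_sum poly_diff.scale poly_diff.coord Suc.IH)
  moreover have "(\<lambda>x. \<Sum>h\<in>I. \<Sum>k=1..n. A k i h * (x k * mat_pow I (X x) N h j))
      = (\<lambda>x. mat_pow I (X x) (Suc N) i j)"
    by (simp add: mat_mul_def X_def sum_distrib_right mult_ac)
  ultimately have *: "poly_diff n (\<lambda>x. mat_pow I (X x) (Suc N) i j)
      (\<lambda>l x. \<Sum>h\<in>I. \<Sum>k=1..n. A k i h * ((if l = k then mat_pow I (X x) N h j else 0) + x k * ?D l x h j))"
    by simp
  show ?case
  \<comment> \<open>The derivatives agree only in the directions \<open>l \<in> {1..n}\<close>,
    where the sum over \<open>k\<close> really contains \<open>k = l\<close>.\<close>
  proof (rule poly_diff.cong[OF *], rule ext)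
    fix l x assume l: "l \<in> {1..n}"
    have "(\<Sum>k=1..n. A k i h * ((if l = k then mat_pow I (X x) N h j else 0) + x k * ?D l x h j))
        = A l i h * mat_pow I (X x) N h j + X x i h * ?D l x h j" for h
    proof -
      have "(\<Sum>k=1..n. A k i h * ((if l = k then mat_pow I (X x) N h j else 0) + x k * ?D l x h j))
          = (\<Sum>k=1..n. (if k = l then A l i h * mat_pow I (X x) N h j else 0))
            + (\<Sum>k=1..n. x k * A k i h * ?D l x h j)"
        unfolding sum.distrib[symmetric] by (intro sum.cong refl) (simp add: distrib_left mult_ac)
      also have "(\<Sum>k=1..n. (if k = l then A l i h * mat_pow I (X x) N h j else 0))
          = A l i h * mat_pow I (X x) N h j" using l by simp
      also have "(\<Sum>k=1..n. x k * A k i h * ?D l x h j) = X x i h * ?D l x h j"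
        unfolding X_def by (rule sum_distrib_right[symmetric])
      finally show ?thesis .
    qed
    then have "(\<Sum>h\<in>I. \<Sum>k=1..n. A k i h * ((if l = k then mat_pow I (X x) N h j else 0) + x k * ?D l x h j))
        = mat_mul I (A l) (mat_pow I (X x) N) i j + (\<Sum>h\<in>I. X x i h * ?D l x h j)"
      by (simp add: sum.distrib mat_mul_def)
    also have "(\<Sum>h\<in>I. X x i h * ?D l x h j)
        = (\<Sum>a<N. mat_mul I (X x) (mat_mul I (mat_pow I (X x) a) (mat_mul I (A l) (mat_pow I (X x) (N - 1 - a)))) i j)"
      unfolding sum_distrib_left mat_mul_def[of I "X x"] by (rule sum.swap)
    also have "\<dots> = (\<Sum>a<N. mat_mul I (mat_pow I (X x) (Suc a)) (mat_mul I (A l) (mat_pow I (X x) (Suc N - 1 - Suc a))) i j)"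
      by (simp add: mat_mul_assoc)
    also have "mat_mul I (A l) (mat_pow I (X x) N) = mat_mul I (mat_pow I (X x) 0) (mat_mul I (A l) (mat_pow I (X x) (Suc N - 1 - 0)))"
    proof -
      have "mat_mul I (A l) (mat_pow I (X x) N) i j = 0" if "i \<notin> I" for i j
      proof -
        have "A l i k = 0" for k using A[of l] that unfolding sym_mat_def by blast
        then show ?thesis by (simp add: mat_mul_def)
      qed
      then show ?thesis by (simp add: mat_one_mul[OF assms(1)])
    qed
    finally show "(\<Sum>h\<in>I. \<Sum>k=1..n. A k i h * ((if l = k then mat_pow I (X x) N h j else 0) + x k * ?D l x h j))
        = (\<Sum>a<Suc N. mat_mul I (mat_pow I (X x) a) (mat_mul I (A l) (mat_pow I (X x) (Suc N - 1 - a))) i j)"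
      unfolding sum.lessThan_Suc_shift .
  qed
qed


lemma sym_mat_lin_comb:
  assumes "\<And>k. sym_mat I (A k)"
  shows "sym_mat I (\<lambda>i j. \<Sum>k\<in>S. x k * A k i j)"
  using assms unfolding sym_mat_def
proof (intro conjI allI impI)
  assume *: "\<And>k. (\<forall>i j. A k i j = A k j i) \<and> (\<forall>i j. i \<notin> I \<longrightarrow> A k i j = 0)"
  show "(\<Sum>k\<in>S. x k * A k i j) = (\<Sum>k\<in>S. x k * A k j i)" for i j
    using * by (intro sum.cong refl arg_cong2[where f = "(*)"]) blast
  show "(\<Sum>k\<in>S. x k * A k i j) = 0" if "i \<notin> I" for i j
    using * that by (simp add: sum.neutral)
qed

section \<open>Trace moments of a symmetric Gaussian series\<close>

context prob_space
begin

context
  fixes n :: nat and g :: "'a \<Rightarrow> nat \<Rightarrow> real" and C :: "nat \<Rightarrow> nat \<Rightarrow> real"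
    and I :: "'i set" and A :: "nat \<Rightarrow> 'i \<Rightarrow> 'i \<Rightarrow> real" and \<sigma> :: real
  assumes gauss: "gaussian_vector M n g C" and C: "psd n C" and C_le: "loewner_le n C id_matrix"
    and finI: "finite I" and A: "\<And>k. sym_mat I (A k)"
    and \<sigma>: "\<And>y. (\<Sum>k=1..n. \<Sum>i\<in>I. (\<Sum>j\<in>I. A k i j * y j)\<^sup>2) \<le> \<sigma>\<^sup>2 * (\<Sum>j\<in>I. (y j)\<^sup>2)"
begin

definition series :: "(nat \<Rightarrow> real) \<Rightarrow> 'i \<Rightarrow> 'i \<Rightarrow> real" where
  "series x = (\<lambda>i j. \<Sum>k=1..n. x k * A k i j)"

lemma sym_mat_series: "sym_mat I (series x)"
  unfolding series_def by (rule sym_mat_lin_comb[OF A])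

lemma poly_diff_series_pow:
  "poly_diff n (\<lambda>x. mat_pow I (series x) N i j) (\<lambda>l x. \<Sum>a<N. mat_mul I (mat_pow I (series x) a)
    (mat_mul I (A l) (mat_pow I (series x) (N - 1 - a))) i j)"
  unfolding series_def[abs_def] by (rule poly_diff_mat_pow[OF finI A])

lemma trace_moments: "all_moments M (\<lambda>\<omega>. mat_tr I (mat_pow I (series (g \<omega>)) N))"
  unfolding mat_tr_def
  by (intro all_moments_sum poly_diff_moments(1)[OF gauss C poly_diff_series_pow])

text \<open>Expectation is needed only to trade the factor \<open>g \<omega> k\<close> for a
  derivative. The bound on the resulting double sum holds for every \<open>x\<close>, and
  \<open>2 * N + 1\<close> counts the positions of the differentiated factor.\<close>

lemma trace_moment_step:
  "(\<integral>\<omega>. mat_tr I (mat_pow I (series (g \<omega>)) (2 * N + 2)) \<partial>M)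
    \<le> (2 * real N + 1) * \<sigma>\<^sup>2 * (\<integral>\<omega>. mat_tr I (mat_pow I (series (g \<omega>)) (2 * N)) \<partial>M)"
proof -
  \<comment> \<open>Both the number of factors left after one is split off and the number of terms
    in the product rule.\<close>
  define m where "m = 2 * N + 1"
  define f where "f k x = mat_tr I (mat_mul I (A k) (mat_pow I (series x) m))" for k x
  define f' where "f' k l x = (\<Sum>a<m. mat_tr I (mat_mul I (mat_mul I (mat_mul I (A k)
      (mat_pow I (series x) a)) (A l)) (mat_pow I (series x) (m - 1 - a))))" for k l x
  have pd: "poly_diff n (f k) (f' k)" for k
  proof -
    have "poly_diff n (\<lambda>x. \<Sum>i\<in>I. \<Sum>h\<in>I. A k i h * mat_pow I (series x) m h i)
      (\<lambda>l x. \<Sum>i\<in>I. \<Sum>h\<in>I. A k i h * (\<Sum>a<m. mat_mul I (mat_pow I (series x) a)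
        (mat_mul I (A l) (mat_pow I (series x) (m - 1 - a))) h i))"
      by (intro poly_diff_sum poly_diff.scale poly_diff_series_pow)
    moreover have "f k = (\<lambda>x. \<Sum>i\<in>I. \<Sum>h\<in>I. A k i h * mat_pow I (series x) m h i)"
      by (simp add: f_def mat_tr_def mat_mul_def fun_eq_iff)
    moreover have "f' k = (\<lambda>l x. \<Sum>i\<in>I. \<Sum>h\<in>I. A k i h * (\<Sum>a<m. mat_mul I (mat_pow I (series x) a)
        (mat_mul I (A l) (mat_pow I (series x) (m - 1 - a))) h i))"
    proof (intro ext)
      fix l x
      let ?Y = "\<lambda>a. mat_mul I (mat_pow I (series x) a) (mat_mul I (A l) (mat_pow I (series x) (m - 1 - a)))"
      have "f' k l x = (\<Sum>a<m. \<Sum>i\<in>I. \<Sum>h\<in>I. A k i h * ?Y a h i)"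
        unfolding f'_def mat_mul_assoc unfolding mat_tr_def mat_mul_def[of I "A k"] ..
      also have "\<dots> = (\<Sum>i\<in>I. \<Sum>a<m. \<Sum>h\<in>I. A k i h * ?Y a h i)"
        by (rule sum.swap)
      also have "\<dots> = (\<Sum>i\<in>I. \<Sum>h\<in>I. \<Sum>a<m. A k i h * ?Y a h i)"
        by (rule sum.cong[OF refl sum.swap])
      finally show "f' k l x = (\<Sum>i\<in>I. \<Sum>h\<in>I. A k i h * (\<Sum>a<m. ?Y a h i))"
        unfolding sum_distrib_left .
    qed
    ultimately show ?thesis by simp
  qed
  have tr: "mat_tr I (mat_pow I (series x) (2 * N + 2)) = (\<Sum>k=1..n. x k * f k x)" for x
  proof -
    have "mat_tr I (mat_pow I (series x) (2 * N + 2)) = mat_tr I (mat_mul I (series x) (mat_pow I (series x) m))"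
      by (simp add: m_def)
    also have "\<dots> = (\<Sum>i\<in>I. \<Sum>h\<in>I. \<Sum>k=1..n. x k * (A k i h * mat_pow I (series x) m h i))"
      unfolding mat_tr_def mat_mul_def
      by (intro sum.cong refl) (simp only: series_def sum_distrib_right mult.assoc)
    also have "\<dots> = (\<Sum>i\<in>I. \<Sum>k=1..n. \<Sum>h\<in>I. x k * (A k i h * mat_pow I (series x) m h i))"
      by (rule sum.cong[OF refl sum.swap])
    also have "\<dots> = (\<Sum>k=1..n. \<Sum>i\<in>I. \<Sum>h\<in>I. x k * (A k i h * mat_pow I (series x) m h i))"
      by (rule sum.swap)
    finally show ?thesis
      by (simp add: f_def mat_tr_def mat_mul_def sum_distrib_left)
  qed
  have mom: "all_moments M (\<lambda>\<omega>. g \<omega> k * f k (g \<omega>))" "all_moments M (\<lambda>\<omega>. f' k l (g \<omega>))"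
    if "k \<in> {1..n}" "l \<in> {1..n}" for k l
    by (intro all_moments_mult gaussian_coord_moments[OF gauss C that(1)]
        poly_diff_moments[OF gauss C pd] that)+
  have point: "(\<Sum>k=1..n. \<Sum>l=1..n. C k l * f' k l x) \<le> (2 * real N + 1) * \<sigma>\<^sup>2 * mat_tr I (mat_pow I (series x) (2 * N))" for x
  proof -
    let ?t = "\<lambda>k l a. mat_tr I (mat_mul I (mat_mul I (mat_mul I (A k)
      (mat_pow I (series x) a)) (A l)) (mat_pow I (series x) (m - 1 - a)))"
    have "(\<Sum>k=1..n. \<Sum>l=1..n. C k l * f' k l x) = (\<Sum>k=1..n. \<Sum>l=1..n. \<Sum>a<m. C k l * ?t k l a)"
      by (simp add: f'_def sum_distrib_left)
    also have "\<dots> = (\<Sum>k=1..n. \<Sum>a<m. \<Sum>l=1..n. C k l * ?t k l a)"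
      by (rule sum.cong[OF refl sum.swap])
    also have "\<dots> = (\<Sum>a<m. \<Sum>k=1..n. \<Sum>l=1..n. C k l * ?t k l a)"
      by (rule sum.swap)
    also have "\<dots> = (\<Sum>a<m. sandwich I n C A (series x) a (m - 1 - a))"
      by (simp only: sandwich_def[OF finI C A sym_mat_series])
    also have "\<dots> \<le> (\<Sum>a<m. \<sigma>\<^sup>2 * mat_tr I (mat_pow I (series x) (2 * N)))"
    proof (rule sum_mono)
      fix a assume "a \<in> {..<m}"
      then have "a + (m - 1 - a) = 2 * N" by (simp add: m_def)
      from sandwich_le[OF finI C A sym_mat_series this]
      show "sandwich I n C A (series x) a (m - 1 - a) \<le> \<sigma>\<^sup>2 * mat_tr I (mat_pow I (series x) (2 * N))"
        using sandwich_0_le[OF finI C A sym_mat_series C_le \<sigma>] by (rule order_trans)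
    qed
    also have "\<dots> = real m * (\<sigma>\<^sup>2 * mat_tr I (mat_pow I (series x) (2 * N)))" by simp
    finally show ?thesis by (simp add: m_def mult_ac add.commute)
  qed
  have "(\<integral>\<omega>. mat_tr I (mat_pow I (series (g \<omega>)) (2 * N + 2)) \<partial>M)
      = (\<Sum>k=1..n. \<integral>\<omega>. g \<omega> k * f k (g \<omega>) \<partial>M)"
    unfolding tr
    by (rule Bochner_Integration.integral_sum) (rule all_moments_integrable, rule mom)
  also have "\<dots> = (\<Sum>k=1..n. \<Sum>l=1..n. C k l * (\<integral>\<omega>. f' k l (g \<omega>) \<partial>M))"
    by (intro sum.cong refl gaussian_ibp[OF gauss C _ pd])
  also have "\<dots> = (\<integral>\<omega>. (\<Sum>k=1..n. \<Sum>l=1..n. C k l * f' k l (g \<omega>)) \<partial>M)"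
  proof -
    have "(\<integral>\<omega>. (\<Sum>k=1..n. \<Sum>l=1..n. C k l * f' k l (g \<omega>)) \<partial>M)
        = (\<Sum>k=1..n. \<integral>\<omega>. (\<Sum>l=1..n. C k l * f' k l (g \<omega>)) \<partial>M)"
      using mom(2) by (intro Bochner_Integration.integral_sum Bochner_Integration.integrable_sum
          integrable_mult_right all_moments_integrable)
    also have "\<dots> = (\<Sum>k=1..n. \<Sum>l=1..n. \<integral>\<omega>. C k l * f' k l (g \<omega>) \<partial>M)"
      using mom(2) by (intro sum.cong refl Bochner_Integration.integral_sum
          integrable_mult_right all_moments_integrable)
    finally show ?thesis by simp
  qed
  also have "\<dots> \<le> (\<integral>\<omega>. (2 * real N + 1) * \<sigma>\<^sup>2 * mat_tr I (mat_pow I (series (g \<omega>)) (2 * N)) \<partial>M)"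
    using mom(2)
    by (intro integral_mono point Bochner_Integration.integrable_sum integrable_mult_right
        all_moments_integrable trace_moments)
  finally show ?thesis by simp
qed

text \<open>The step is the recurrence of \<open>gauss_moment\<close> scaled by the square of
  \<sigma>; the dimension \<open>card I\<close> enters only as the trace of the identity at
  \<open>N = 0\<close>.\<close>

lemma trace_moment_bound:
  "(\<integral>\<omega>. mat_tr I (mat_pow I (series (g \<omega>)) (2 * N)) \<partial>M)
    \<le> real (card I) * gauss_moment (2 * N) * \<sigma> ^ (2 * N)"
proof (induction N)
  case 0
  show ?case by (simp add: mat_tr_def mat_one_def gauss_moment_def prob_space)
next
  case (Suc N)
  have "(\<integral>\<omega>. mat_tr I (mat_pow I (series (g \<omega>)) (2 * Suc N)) \<partial>M)
      \<le> (2 * real N + 1) * \<sigma>\<^sup>2 * (\<integral>\<omega>. mat_tr I (mat_pow I (series (g \<omega>)) (2 * N)) \<partial>M)"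
    using trace_moment_step[of N] by simp
  also have "\<dots> \<le> (2 * real N + 1) * \<sigma>\<^sup>2 * (real (card I) * gauss_moment (2 * N) * \<sigma> ^ (2 * N))"
    using Suc.IH by (intro mult_left_mono) simp_all
  also have "\<dots> = real (card I) * gauss_moment (2 * Suc N) * \<sigma> ^ (2 * Suc N)"
    using gauss_moment_Suc_Suc[of "2 * N"] by (simp add: power2_eq_square algebra_simps)
  finally show ?case .
qed

end

end

section \<open>Tail bound for Gaussian matrix series\<close>

lemma cosh_even_series: "(\<lambda>N. x ^ (2 * N) / fact (2 * N)) sums cosh (x :: real)"
proof -
  have "(\<lambda>N. if even (2 * N) then x ^ (2 * N) /\<^sub>R fact (2 * N) else 0) sums cosh x"
    by (rule sums_mono_reindex[THEN iffD2, OF _ _ cosh_converges])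
      (auto simp: strict_mono_def elim!: evenE)
  then show ?thesis by (simp add: divide_inverse mult.commute)
qed

text \<open>Markov's inequality for cosh, whose series involves even moments only. With nonnegative
  integrals, expectation and series can be exchanged before integrability of the cosh is
  known.\<close>

lemma (in prob_space) subgaussian_tail_of_moments:
  assumes Y: "Y \<in> borel_measurable M" "\<And>\<omega>. 0 \<le> Y \<omega>" and "0 < \<sigma>" "0 \<le> t" "0 \<le> D"
    and int: "\<And>N. integrable M (\<lambda>\<omega>. Y \<omega> ^ (2 * N))"
    and mom: "\<And>N. (\<integral>\<omega>. Y \<omega> ^ (2 * N) \<partial>M) \<le> D * gauss_moment (2 * N) * \<sigma> ^ (2 * N)"
  shows "prob {\<omega> \<in> space M. Y \<omega> > t * \<sigma>} \<le> 2 * D * exp (- (t\<^sup>2) / 2)"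
proof -
  \<comment> \<open>The optimal Gaussian exponent: the threshold \<open>t * \<sigma>\<close> becomes
    the square of \<open>t\<close>, and the bound on the mean of the cosh becomes
    \<open>D * exp (t\<^sup>2 / 2)\<close>.\<close>
  define \<theta> where "\<theta> = t / \<sigma>"
  have \<theta>: "\<theta> \<ge> 0" "\<theta> * \<sigma> = t" using assms by (simp_all add: \<theta>_def)
  define S where "S = {\<omega> \<in> space M. Y \<omega> > t * \<sigma>}"
  have S: "S \<in> sets M" using Y(1) unfolding S_def by measurable
  have term_le: "(\<integral>\<^sup>+\<omega>. ennreal ((\<theta> * Y \<omega>) ^ (2 * N) / fact (2 * N)) \<partial>M)
      \<le> ennreal (D * ((t\<^sup>2 / 2) ^ N / fact N))" for N
  proof -
    have "(\<integral>\<^sup>+\<omega>. ennreal ((\<theta> * Y \<omega>) ^ (2 * N) / fact (2 * N)) \<partial>M)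
        = (\<integral>\<^sup>+\<omega>. ennreal (\<theta> ^ (2 * N) / fact (2 * N) * Y \<omega> ^ (2 * N)) \<partial>M)"
      by (simp add: power_mult_distrib mult_ac)
    also have "\<dots> = ennreal (\<integral>\<omega>. \<theta> ^ (2 * N) / fact (2 * N) * Y \<omega> ^ (2 * N) \<partial>M)"
      using int[of N] by (intro nn_integral_eq_integral integrable_mult_right) simp_all
    also have "\<dots> \<le> ennreal (D * ((t\<^sup>2 / 2) ^ N / fact N))"
    proof (rule ennreal_leI)
      have "(\<integral>\<omega>. \<theta> ^ (2 * N) / fact (2 * N) * Y \<omega> ^ (2 * N) \<partial>M)
          = \<theta> ^ (2 * N) / fact (2 * N) * (\<integral>\<omega>. Y \<omega> ^ (2 * N) \<partial>M)" by simp
      also have "\<dots> \<le> \<theta> ^ (2 * N) / fact (2 * N) * (D * gauss_moment (2 * N) * \<sigma> ^ (2 * N))"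
        using mom[of N] \<theta> by (intro mult_left_mono) simp_all
      also have "\<dots> = D * ((\<theta> * \<sigma>) ^ (2 * N) * (gauss_moment (2 * N) / fact (2 * N)))"
        by (simp add: power_mult_distrib mult_ac)
      \<comment> \<open>Dividing \<open>gauss_moment (2 * N)\<close> by \<open>fact (2 * N)\<close>
        leaves the reciprocal of 2^N N!, so the cosh series turns into an exponential
        series.\<close>
      also have "\<dots> = D * ((t\<^sup>2 / 2) ^ N / fact N)"
        by (simp add: \<theta> gauss_moment_def power_divide power_mult)
      finally show "(\<integral>\<omega>. \<theta> ^ (2 * N) / fact (2 * N) * Y \<omega> ^ (2 * N) \<partial>M) \<le> D * ((t\<^sup>2 / 2) ^ N / fact N)" .
    qed
    finally show ?thesis .
  qed
  have ser: "(\<lambda>N. D * ((t\<^sup>2 / 2) ^ N / fact N)) sums (D * exp (t\<^sup>2 / 2))"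
  proof (rule sums_mult)
    show "(\<lambda>N. (t\<^sup>2 / 2) ^ N / fact N) sums exp (t\<^sup>2 / 2)"
      using exp_converges[of "t\<^sup>2 / 2"] by (simp only: real_scaleR_def divide_inverse_commute)
  qed
  have "ennreal (cosh (t\<^sup>2)) * emeasure M S = (\<integral>\<^sup>+\<omega>. ennreal (cosh (t\<^sup>2)) * indicator S \<omega> \<partial>M)"
    using S by (simp add: nn_integral_cmult_indicator)
  also have "\<dots> \<le> (\<integral>\<^sup>+\<omega>. ennreal (cosh (\<theta> * Y \<omega>)) \<partial>M)"
  proof (rule nn_integral_mono)
    fix \<omega>
    show "ennreal (cosh (t\<^sup>2)) * indicator S \<omega> \<le> ennreal (cosh (\<theta> * Y \<omega>))"
    proof (cases "\<omega> \<in> S")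
      case True
      then have "\<theta> * (t * \<sigma>) \<le> \<theta> * Y \<omega>" using \<theta>(1) by (intro mult_left_mono) (simp_all add: S_def)
      moreover have "\<theta> * (t * \<sigma>) = (\<theta> * \<sigma>) * t" by (simp only: mult_ac)
      ultimately have "t\<^sup>2 \<le> \<theta> * Y \<omega>" unfolding \<theta>(2) by (simp add: power2_eq_square)
      then have "cosh (t\<^sup>2) \<le> cosh (\<theta> * Y \<omega>)" by (intro cosh_real_nonneg_le_iff[THEN iffD2]) (simp_all add: \<theta> Y(2))
      then show ?thesis using True by (simp add: ennreal_leI)
    qed simp
  qed
  also have "\<dots> = (\<integral>\<^sup>+\<omega>. (\<Sum>N. ennreal ((\<theta> * Y \<omega>) ^ (2 * N) / fact (2 * N))) \<partial>M)"
  proof (rule nn_integral_cong)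
    fix \<omega>
    show "ennreal (cosh (\<theta> * Y \<omega>)) = (\<Sum>N. ennreal ((\<theta> * Y \<omega>) ^ (2 * N) / fact (2 * N)))"
      by (rule suminf_ennreal_eq[symmetric]) (simp_all add: cosh_even_series)
  qed
  also have "\<dots> = (\<Sum>N. \<integral>\<^sup>+\<omega>. ennreal ((\<theta> * Y \<omega>) ^ (2 * N) / fact (2 * N)) \<partial>M)"
    by (intro nn_integral_suminf measurable_compose[OF _ measurable_ennreal] borel_measurable_divide
        borel_measurable_power borel_measurable_times borel_measurable_const Y(1))
  also have "\<dots> \<le> (\<Sum>N. ennreal (D * ((t\<^sup>2 / 2) ^ N / fact N)))"
    by (intro suminf_le term_le) simp_all
  also have "\<dots> = ennreal (D * exp (t\<^sup>2 / 2))"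
    using ser assms(5) by (intro suminf_ennreal_eq) simp_all
  finally have "ennreal (cosh (t\<^sup>2) * prob S) \<le> ennreal (D * exp (t\<^sup>2 / 2))"
    by (simp add: emeasure_eq_measure ennreal_mult)
  then have "cosh (t\<^sup>2) * prob S \<le> D * exp (t\<^sup>2 / 2)"
    using assms(5) by (subst (asm) ennreal_le_iff) simp_all
  \<comment> \<open>Dropping the decaying half of the cosh is the origin of the factor 2 in front of
    \<open>D\<close>.\<close>
  moreover have "exp (t\<^sup>2) / 2 * prob S \<le> cosh (t\<^sup>2) * prob S"
    by (intro mult_right_mono) (simp_all add: cosh_field_def)
  ultimately have "exp (t\<^sup>2) * prob S \<le> 2 * D * exp (t\<^sup>2 / 2)" by simp
  then have "exp (- (t\<^sup>2)) * (exp (t\<^sup>2) * prob S) \<le> exp (- (t\<^sup>2)) * (2 * D * exp (t\<^sup>2 / 2))"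
    by (intro mult_left_mono) simp_all
  also have "exp (- (t\<^sup>2)) * (2 * D * exp (t\<^sup>2 / 2)) = 2 * D * exp (- (t\<^sup>2) / 2)"
  proof -
    have "exp (- (t\<^sup>2)) * exp (t\<^sup>2 / 2) = exp (- (t\<^sup>2) / 2)" by (simp add: exp_add[symmetric])
    then show ?thesis by (simp add: mult_ac)
  qed
  also have "exp (- (t\<^sup>2)) * (exp (t\<^sup>2) * prob S) = prob S"
    by (simp add: mult.assoc[symmetric] exp_add[symmetric])
  finally show ?thesis by (simp add: S_def)
qed

text \<open>The symmetric moment bound is applied to the dilated series, of dimension
  \<open>card I + card J\<close>. The hypotheses \<open>col\<close> and \<open>row\<close> bound the
  two variance parameters, the sums of B_k^T B_k and of B_k B_k^T, by one \<sigma>.\<close>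

theorem (in prob_space) gaussian_series_tail:
  fixes B :: "nat \<Rightarrow> 'i \<Rightarrow> 'j \<Rightarrow> real"
  assumes gauss: "gaussian_vector M n g C" and C: "psd n C" and C_le: "loewner_le n C id_matrix"
    and fin: "finite I" "finite J" and "0 \<le> \<sigma>" "0 \<le> t"
    and col: "\<And>v. (\<Sum>k=1..n. \<Sum>i\<in>I. (\<Sum>j\<in>J. B k i j * v j)\<^sup>2) \<le> \<sigma>\<^sup>2 * (\<Sum>j\<in>J. (v j)\<^sup>2)"
    and row: "\<And>u. (\<Sum>k=1..n. \<Sum>j\<in>J. (\<Sum>i\<in>I. B k i j * u i)\<^sup>2) \<le> \<sigma>\<^sup>2 * (\<Sum>i\<in>I. (u i)\<^sup>2)"
  shows "prob {\<omega> \<in> space M. spectral_norm I J (\<lambda>i j. \<Sum>k=1..n. g \<omega> k * B k i j) > t * \<sigma>}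
    \<le> 2 * (real (card I) + real (card J)) * exp (- (t\<^sup>2) / 2)"
proof -
  define Y where "Y \<omega> = spectral_norm I J (\<lambda>i j. \<Sum>k=1..n. g \<omega> k * B k i j)" for \<omega>
  have trivial: ?thesis if "\<And>\<omega>. Y \<omega> \<le> t * \<sigma>"
  proof -
    have empty: "{\<omega> \<in> space M. Y \<omega> > t * \<sigma>} = {}" using that by (auto simp: not_less)
    have "prob {\<omega> \<in> space M. Y \<omega> > t * \<sigma>} \<le> 2 * (real (card I) + real (card J)) * exp (- (t\<^sup>2) / 2)"
      unfolding empty by simp
    then show ?thesis unfolding Y_def .
  qed
  show ?thesis
  \<comment> \<open>In the degenerate case every summand acts as zero, and the strict event is
    empty. Otherwise \<sigma> may be divided by and the trace of the identity is at least 1.\<close>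
  proof (cases "\<sigma> = 0 \<or> I <+> J = {}")
    case True
    have zero: "(\<Sum>j\<in>J. B k i j * v j) = 0" if "k \<in> {1..n}" "i \<in> I" for k i v
    proof (cases "\<sigma> = 0")
      case True
      then have "(\<Sum>k=1..n. \<Sum>i\<in>I. (\<Sum>j\<in>J. B k i j * v j)\<^sup>2) = 0"
        using col[of v] by (intro antisym sum_nonneg) simp_all
      then have "\<forall>k\<in>{1..n}. (\<Sum>i\<in>I. (\<Sum>j\<in>J. B k i j * v j)\<^sup>2) = 0"
        by (subst (asm) sum_nonneg_eq_0_iff) (simp_all add: sum_nonneg)
      then have "(\<Sum>i\<in>I. (\<Sum>j\<in>J. B k i j * v j)\<^sup>2) = 0" using that(1) by blast
      then have "\<forall>i\<in>I. (\<Sum>j\<in>J. B k i j * v j)\<^sup>2 = 0"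
        using fin by (subst (asm) sum_nonneg_eq_0_iff) simp_all
      then show ?thesis using that(2) by simp
    next
      case False
      then have "I <+> J = {}" using \<open>\<sigma> = 0 \<or> I <+> J = {}\<close> by simp
      then show ?thesis using that(2) by blast
    qed
    have "Y \<omega> \<le> t * \<sigma>" for \<omega>
      unfolding Y_def
    proof (rule spectral_norm_least)
      fix x
      have "(\<Sum>j\<in>J. (\<Sum>k=1..n. g \<omega> k * B k i j) * x j) = 0" if "i \<in> I" for i
      proof -
        have "(\<Sum>j\<in>J. (\<Sum>k=1..n. g \<omega> k * B k i j) * x j)
            = (\<Sum>k=1..n. \<Sum>j\<in>J. g \<omega> k * (B k i j * x j))"
          unfolding sum_distrib_right mult.assoc by (rule sum.swap)
        also have "\<dots> = (\<Sum>k=1..n. g \<omega> k * (\<Sum>j\<in>J. B k i j * x j))"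
          by (simp only: sum_distrib_left)
        also have "\<dots> = 0" by (rule sum.neutral) (simp add: zero that)
        finally show ?thesis .
      qed
      then have "L2_set (\<lambda>i. \<Sum>j\<in>J. (\<Sum>k=1..n. g \<omega> k * B k i j) * x j) I = 0"
        by (simp add: L2_set_def)
      then show "L2_set (\<lambda>i. \<Sum>j\<in>J. (\<Sum>k=1..n. g \<omega> k * B k i j) * x j) I \<le> t * \<sigma>"
        using \<open>0 \<le> \<sigma>\<close> \<open>0 \<le> t\<close> by simp
    qed
    then show ?thesis by (rule trivial)
  next
    case False
    let ?K = "I <+> J"
    let ?A = "\<lambda>k. dilation I J (B k)"
    have finK: "finite ?K" using fin by simp
    \<comment> \<open>The dilation exchanges the two blocks of \<open>y\<close>, so
      \<open>col\<close> and \<open>row\<close> add up without cross terms.\<close>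
    have \<sigma>: "(\<Sum>k=1..n. \<Sum>a\<in>?K. (\<Sum>b\<in>?K. ?A k a b * y b)\<^sup>2) \<le> \<sigma>\<^sup>2 * (\<Sum>b\<in>?K. (y b)\<^sup>2)" for y
    proof -
      have "(\<Sum>a\<in>?K. (\<Sum>b\<in>?K. ?A k a b * y b)\<^sup>2)
          = (\<Sum>i\<in>I. (\<Sum>j\<in>J. B k i j * y (Inr j))\<^sup>2) + (\<Sum>j\<in>J. (\<Sum>i\<in>I. B k i j * y (Inl i))\<^sup>2)" for k
        by (rule trans[OF sum.Plus[OF fin]]) (simp add: dilation_apply[OF fin])
      then have "(\<Sum>k=1..n. \<Sum>a\<in>?K. (\<Sum>b\<in>?K. ?A k a b * y b)\<^sup>2)
          = (\<Sum>k=1..n. \<Sum>i\<in>I. (\<Sum>j\<in>J. B k i j * y (Inr j))\<^sup>2)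
            + (\<Sum>k=1..n. \<Sum>j\<in>J. (\<Sum>i\<in>I. B k i j * y (Inl i))\<^sup>2)"
        by (simp only: sum.distrib)
      also have "\<dots> \<le> \<sigma>\<^sup>2 * (\<Sum>j\<in>J. (y (Inr j))\<^sup>2) + \<sigma>\<^sup>2 * (\<Sum>i\<in>I. (y (Inl i))\<^sup>2)"
        by (intro add_mono col row)
      also have "\<dots> = \<sigma>\<^sup>2 * (\<Sum>b\<in>?K. (y b)\<^sup>2)"
        using fin by (simp add: sum.Plus distrib_left)
      finally show ?thesis .
    qed
    have symA: "sym_mat ?K (?A k)" for k by (rule sym_mat_dilation)
    note ctx = gauss C C_le finK symA \<sigma>
    have ser: "series n ?A x = dilation I J (\<lambda>i j. \<Sum>k=1..n. x k * B k i j)" for x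
    proof (intro ext)
      fix a b
      show "series n ?A x a b = dilation I J (\<lambda>i j. \<Sum>k=1..n. x k * B k i j) a b"
        by (cases a; cases b) (auto simp: series_def[OF ctx] intro!: sum.neutral)
    qed
    define Z where "Z N \<omega> = mat_tr ?K (mat_pow ?K (series n ?A (g \<omega>)) (2 * N))" for N \<omega>
    have YZ: "Y \<omega> ^ (2 * N) \<le> Z N \<omega>" for N \<omega>
      unfolding Y_def Z_def ser by (rule spectral_norm_power_le_trace[OF fin]) (use False in simp)
    have Z: "integrable M (Z N)" for N
      unfolding Z_def by (rule all_moments_integrable[OF trace_moments[OF ctx]])
    have Y: "Y \<in> borel_measurable M"
      unfolding Y_def[abs_def] using gauss unfolding gaussian_vector_def
      by (intro borel_measurable_spectral_norm fin borel_measurable_sum borel_measurable_times) simp_all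
    have Y0: "0 \<le> Y \<omega>" for \<omega> unfolding Y_def by (rule spectral_norm_nonneg[OF fin])
    \<comment> \<open>Trace moments are integrable as polynomials in \<open>g\<close>; the norm is
      not a polynomial and inherits integrability by domination.\<close>
    have int: "integrable M (\<lambda>\<omega>. Y \<omega> ^ (2 * N))" for N
    proof (rule Bochner_Integration.integrable_bound[OF Z[of N]])
      show "(\<lambda>\<omega>. Y \<omega> ^ (2 * N)) \<in> borel_measurable M" using Y by simp
      show "AE \<omega> in M. norm (Y \<omega> ^ (2 * N)) \<le> norm (Z N \<omega>)"
        using YZ by (intro AE_I2) (metis Y0 abs_ge_self abs_of_nonneg order_trans real_norm_def zero_le_power)
    qed
    have "prob {\<omega> \<in> space M. Y \<omega> > t * \<sigma>} \<le> 2 * real (card ?K) * exp (- (t\<^sup>2) / 2)"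
    proof (rule subgaussian_tail_of_moments[OF Y Y0])
      show "0 < \<sigma>" using False \<open>0 \<le> \<sigma>\<close> by simp
      show "(\<integral>\<omega>. Y \<omega> ^ (2 * N) \<partial>M) \<le> real (card ?K) * gauss_moment (2 * N) * \<sigma> ^ (2 * N)" for N
      proof -
        have "(\<integral>\<omega>. Y \<omega> ^ (2 * N) \<partial>M) \<le> (\<integral>\<omega>. Z N \<omega> \<partial>M)"
          by (rule integral_mono[OF int Z YZ])
        also have "\<dots> \<le> real (card ?K) * gauss_moment (2 * N) * \<sigma> ^ (2 * N)"
          unfolding Z_def by (rule trace_moment_bound[OF ctx])
        finally show ?thesis .
      qed
    qed (simp_all add: int \<open>0 \<le> t\<close>)
    then show ?thesis using fin by (simp add: Y_def card_Plus)
  qed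
qed

section \<open>Unfoldings and contraction of one mode\<close>

lemma finite_multi_index: "finite U \<Longrightarrow> finite (multi_index d U)"
  unfolding multi_index_def by (rule finite_PiE) simp_all

lemma card_multi_index: "finite U \<Longrightarrow> card (multi_index d U) = (\<Prod>k\<in>U. d k)"
  unfolding multi_index_def by (simp add: card_PiE)

lemma sum_multi_index_insert:
  assumes "k \<notin> U"
  shows "(\<Sum>x\<in>multi_index d (insert k U). f x) = (\<Sum>l=1..d k. \<Sum>x\<in>multi_index d U. f (x(k := l)))"
proof -
  have "(\<Sum>x\<in>multi_index d (insert k U). f x)
      = (\<Sum>(l, x)\<in>{1..d k} \<times> multi_index d U. f (x(k := l)))"
    unfolding multi_index_def PiE_insert_eq
    by (subst sum.reindex[OF inj_combinator[OF assms]]) (simp add: o_def case_prod_unfold)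
  also have "\<dots> = (\<Sum>l=1..d k. \<Sum>x\<in>multi_index d U. f (x(k := l)))"
    by (rule sum.cartesian_product[symmetric])
  finally show ?thesis .
qed

lemma merge_upd_left:
  "k \<notin> S' \<Longrightarrow> merge (insert k S) S' (x(k := l), y) = (merge S S' (x, y))(k := l)"
  by (auto simp: merge_def fun_eq_iff)

lemma merge_upd_right:
  "k \<notin> S \<Longrightarrow> merge S (insert k S') (x, y(k := l)) = (merge S S' (x, y))(k := l)"
  by (auto simp: merge_def fun_eq_iff)

lemma merge_in_multi_index:
  assumes "x \<in> multi_index d S" "y \<in> multi_index d S'"
  shows "merge S S' (x, y) \<in> multi_index d (S \<union> S')"
  using assms unfolding multi_index_def merge_def
  by (auto simp: PiE_iff extensional_def)

definition contract_mode :: "(nat \<Rightarrow> nat) \<Rightarrow> nat \<Rightarrow> (nat \<Rightarrow> real) \<Rightarrow> ((nat \<Rightarrow> nat) \<Rightarrow> real)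
    \<Rightarrow> (nat \<Rightarrow> nat) \<Rightarrow> real" where
  "contract_mode d k v W x = (\<Sum>l=1..d k. v l * W (x(k := l)))"

definition separating :: "nat \<Rightarrow> nat set set" where
  "separating m = {S. S \<subseteq> {1..m} \<and> 1 \<in> S \<and> 2 \<notin> S}"

definition max_unfolding :: "(nat \<Rightarrow> nat) \<Rightarrow> nat \<Rightarrow> ((nat \<Rightarrow> nat) \<Rightarrow> real) \<Rightarrow> real" where
  "max_unfolding d m W = Max ((\<lambda>S. unfolding_norm d S ({1..m} - S) W) ` separating m)"

lemma finite_separating: "finite (separating m)"
  unfolding separating_def by (rule finite_subset[of _ "Pow {1..m}"]) auto

lemma separating_nonempty: "m \<ge> 1 \<Longrightarrow> {1} \<in> separating m"
  by (simp add: separating_def)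

lemma unfolding_norm_le_max:
  "S \<in> separating m \<Longrightarrow> unfolding_norm d S ({1..m} - S) W \<le> max_unfolding d m W"
  unfolding max_unfolding_def by (rule Max_ge) (simp_all add: finite_separating)

lemma finite_separating_member: "S \<in> separating m \<Longrightarrow> finite S"
  unfolding separating_def using finite_subset by blast

lemma unfolding_norm_nonneg: "finite S \<Longrightarrow> finite S' \<Longrightarrow> 0 \<le> unfolding_norm d S S' W"
  unfolding unfolding_norm_def by (intro spectral_norm_nonneg finite_multi_index)

lemma max_unfolding_nonneg:
  assumes "m \<ge> 1"
  shows "0 \<le> max_unfolding d m W"
  using unfolding_norm_le_max[OF separating_nonempty[OF assms], of d W]
    unfolding_norm_nonneg[of "{1}" "{1..m} - {1}" d W] by simp

lemma spectral_norm_cong: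
  assumes "\<And>i j. i \<in> I \<Longrightarrow> j \<in> J \<Longrightarrow> A i j = B i j"
  shows "spectral_norm I J A = spectral_norm I J B"
proof -
  have "L2_set (\<lambda>i. \<Sum>j\<in>J. A i j * x j) I = L2_set (\<lambda>i. \<Sum>j\<in>J. B i j * x j) I" for x
    by (rule L2_set_cong[OF refl sum.cong[OF refl]]) (simp add: assms)
  then show ?thesis by (simp add: spectral_norm_def)
qed

lemma separating_merge:
  assumes "S \<in> separating m" "x \<in> multi_index d S" "y \<in> multi_index d ({1..m} - S)"
  shows "merge S ({1..m} - S) (x, y) \<in> multi_index d {1..m}"
proof -
  have "S \<union> ({1..m} - S) = {1..m}" using assms(1) by (auto simp: separating_def)
  then show ?thesis using merge_in_multi_index[OF assms(2,3)] by simp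
qed

lemma max_unfolding_cong:
  assumes "\<And>x. x \<in> multi_index d {1..m} \<Longrightarrow> V x = W x"
  shows "max_unfolding d m V = max_unfolding d m W"
proof -
  have "unfolding_norm d S ({1..m} - S) V = unfolding_norm d S ({1..m} - S) W" if "S \<in> separating m" for S
    unfolding unfolding_norm_def
    by (rule spectral_norm_cong) (rule assms, rule separating_merge[OF that])
  then show ?thesis unfolding max_unfolding_def by (simp cong: image_cong)
qed

lemma borel_measurable_unfolding_norm:
  assumes "S \<in> separating m"
    and "\<And>x. x \<in> multi_index d {1..m} \<Longrightarrow> (\<lambda>\<omega>. W \<omega> x) \<in> borel_measurable M"
  shows "(\<lambda>\<omega>. unfolding_norm d S ({1..m} - S) (W \<omega>)) \<in> borel_measurable M"
  unfolding unfolding_norm_def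
  by (intro borel_measurable_spectral_norm finite_multi_index finite_separating_member[OF assms(1)]
      finite_Diff finite_atLeastAtMost assms(2) separating_merge[OF assms(1)])

lemma borel_measurable_max_unfolding:
  assumes "\<And>x. x \<in> multi_index d {1..m} \<Longrightarrow> (\<lambda>\<omega>. W \<omega> x) \<in> borel_measurable M"
  shows "(\<lambda>\<omega>. max_unfolding d m (W \<omega>)) \<in> borel_measurable M"
  unfolding max_unfolding_def
  by (intro borel_measurable_Max finite_separating borel_measurable_unfolding_norm assms)

text \<open>The slices of \<open>W\<close> along mode \<open>k\<close>, stacked on top of each
  other, form the unfolding with \<open>k\<close> among the rows; the sum over \<open>l\<close> is
  the squared norm of the stack applied to \<open>v\<close>.\<close>

lemma unfolding_norm_col_bound:
  assumes "finite S" "finite S'" "k \<notin> S" "k \<notin> S'"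
  shows "(\<Sum>l=1..d k. \<Sum>x\<in>multi_index d S. (\<Sum>y\<in>multi_index d S'. W ((merge S S' (x, y))(k := l)) * v y)\<^sup>2)
    \<le> (unfolding_norm d (insert k S) S' W)\<^sup>2 * (\<Sum>y\<in>multi_index d S'. (v y)\<^sup>2)"
proof -
  let ?I = "multi_index d (insert k S)" and ?J = "multi_index d S'"
  let ?f = "\<lambda>x. \<Sum>y\<in>?J. W (merge (insert k S) S' (x, y)) * v y"
  have "(\<Sum>l=1..d k. \<Sum>x\<in>multi_index d S. (\<Sum>y\<in>?J. W ((merge S S' (x, y))(k := l)) * v y)\<^sup>2)
      = (\<Sum>x\<in>?I. (?f x)\<^sup>2)"
    unfolding sum_multi_index_insert[OF assms(3)] merge_upd_left[OF assms(4)] ..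
  also have "\<dots> = (L2_set ?f ?I)\<^sup>2" by (rule L2_set_sq[symmetric])
  also have "\<dots> \<le> (unfolding_norm d (insert k S) S' W * L2_set v ?J)\<^sup>2"
    unfolding unfolding_norm_def using assms
    by (intro power_mono spectral_norm_bound finite_multi_index L2_set_nonneg) simp_all
  finally show ?thesis by (simp only: power_mult_distrib L2_set_sq)
qed

text \<open>Placed side by side, the slices form the unfolding with \<open>k\<close> among the
  columns, and its transpose acts on \<open>u\<close>.\<close>

lemma unfolding_norm_row_bound:
  assumes "finite S" "finite S'" "k \<notin> S" "k \<notin> S'"
  shows "(\<Sum>l=1..d k. \<Sum>y\<in>multi_index d S'. (\<Sum>x\<in>multi_index d S. W ((merge S S' (x, y))(k := l)) * u x)\<^sup>2)
    \<le> (unfolding_norm d S (insert k S') W)\<^sup>2 * (\<Sum>x\<in>multi_index d S. (u x)\<^sup>2)"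
proof -
  let ?I = "multi_index d S" and ?J = "multi_index d (insert k S')"
  let ?f = "\<lambda>y. \<Sum>x\<in>?I. W (merge S (insert k S') (x, y)) * u x"
  have "(\<Sum>l=1..d k. \<Sum>y\<in>multi_index d S'. (\<Sum>x\<in>?I. W ((merge S S' (x, y))(k := l)) * u x)\<^sup>2)
      = (\<Sum>y\<in>?J. (?f y)\<^sup>2)"
    unfolding sum_multi_index_insert[OF assms(4)] merge_upd_right[OF assms(3)] ..
  also have "\<dots> = (L2_set ?f ?J)\<^sup>2" by (rule L2_set_sq[symmetric])
  also have "\<dots> \<le> (unfolding_norm d S (insert k S') W * L2_set u ?I)\<^sup>2"
    unfolding unfolding_norm_def using assms
    by (intro power_mono spectral_norm_transpose_bound finite_multi_index L2_set_nonneg) simp_all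
  finally show ?thesis by (simp only: power_mult_distrib L2_set_sq)
qed

text \<open>A separating set is 1 together with a subset X of \<open>{3..m}\<close>. The row count
  carries the product over X and the column count the one over its complement; summed over all X,
  both expand the same product.\<close>

lemma sum_card_separating:
  assumes "m \<ge> 2"
  shows "(\<Sum>S\<in>separating m. real (card (multi_index d S)) + real (card (multi_index d ({1..m} - S))))
    = (real (d 1) + real (d 2)) * (\<Prod>j=3..m. 1 + real (d j))"
proof -
  let ?U = "{3..m}"
  have sep: "separating m = insert 1 ` Pow ?U"
  proof (intro set_eqI iffI)
    fix S assume S: "S \<in> separating m"
    have "S - {1} \<subseteq> ?U"
    proof
      fix j assume j: "j \<in> S - {1}"
      then have "j \<noteq> 2" "1 \<le> j" "j \<le> m" "j \<noteq> 1" using S by (auto simp: separating_def)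
      then show "j \<in> ?U" by simp
    qed
    moreover have "S = insert 1 (S - {1})" using S by (auto simp: separating_def)
    ultimately show "S \<in> insert 1 ` Pow ?U" by blast
  qed (use assms in \<open>auto simp: separating_def\<close>)
  have inj: "inj_on (insert (1::nat)) (Pow ?U)"
  proof (rule inj_onI)
    fix X Y assume XY: "X \<in> Pow ?U" "Y \<in> Pow ?U" "insert 1 X = insert 1 Y"
    then have "1 \<notin> X" "1 \<notin> Y" by auto
    from insert_ident[OF this] XY(3) show "X = Y" by (rule iffD1)
  qed
  have c: "real (card (multi_index d (insert 1 X))) + real (card (multi_index d ({1..m} - insert 1 X)))
      = real (d 1) * (\<Prod>j\<in>X. real (d j)) + real (d 2) * (\<Prod>j\<in>?U - X. real (d j))"
    if "X \<in> Pow ?U" for X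
  proof -
    have X: "X \<subseteq> ?U" "finite X" "1 \<notin> X" using that by (auto intro: finite_subset[of _ ?U])
    have "{1..m} - insert 1 X = insert 2 (?U - X)"
    proof (intro set_eqI iffI)
      fix j assume "j \<in> insert 2 (?U - X)"
      then show "j \<in> {1..m} - insert 1 X" using X assms by auto
    qed auto
    then show ?thesis using X by (simp add: card_multi_index)
  qed
  have "(\<Sum>S\<in>separating m. real (card (multi_index d S)) + real (card (multi_index d ({1..m} - S))))
      = (\<Sum>X\<in>Pow ?U. real (d 1) * (\<Prod>j\<in>X. real (d j)) + real (d 2) * (\<Prod>j\<in>?U - X. real (d j)))"
    unfolding sep sum.reindex[OF inj] o_def by (rule sum.cong[OF refl c])
  also have "\<dots> = real (d 1) * (\<Sum>X\<in>Pow ?U. (\<Prod>j\<in>X. real (d j)))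
      + real (d 2) * (\<Sum>X\<in>Pow ?U. (\<Prod>j\<in>?U - X. real (d j)))"
    by (simp only: sum.distrib sum_distrib_left)
  also have "(\<Sum>X\<in>Pow ?U. (\<Prod>j\<in>X. real (d j))) = (\<Prod>j\<in>?U. 1 + real (d j))"
    using prod_add[of ?U "\<lambda>j. real (d j)" "\<lambda>_. 1"] by (simp add: add.commute)
  also have "(\<Sum>X\<in>Pow ?U. (\<Prod>j\<in>?U - X. real (d j))) = (\<Prod>j\<in>?U. 1 + real (d j))"
    using prod_add[of ?U "\<lambda>_. 1" "\<lambda>j. real (d j)"] by simp
  finally show ?thesis by (simp add: distrib_right)
qed

lemma (in prob_space) contract_mode_tail:
  assumes gauss: "gaussian_vector M (d (Suc m)) g C" and C: "psd (d (Suc m)) C"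
    and C_le: "loewner_le (d (Suc m)) C id_matrix" and "m \<ge> 2" "0 \<le> t"
  shows "prob {\<omega> \<in> space M. max_unfolding d m (contract_mode d (Suc m) (g \<omega>) W)
        > t * max_unfolding d (Suc m) W}
    \<le> 2 * ((real (d 1) + real (d 2)) * (\<Prod>j=3..m. 1 + real (d j))) * exp (- (t\<^sup>2) / 2)"
proof -
  define \<sigma> where "\<sigma> = max_unfolding d (Suc m) W"
  have \<sigma>0: "0 \<le> \<sigma>" unfolding \<sigma>_def by (rule max_unfolding_nonneg) simp
  define Y where "Y S \<omega> = unfolding_norm d S ({1..m} - S) (contract_mode d (Suc m) (g \<omega>) W)" for S \<omega>
  define F where "F S = {\<omega> \<in> space M. Y S \<omega> > t * \<sigma>}" for S
  have meas: "F S \<in> sets M" if "S \<in> separating m" for S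
  proof -
    have "Y S \<in> borel_measurable M"
      unfolding Y_def[abs_def] contract_mode_def using gauss that unfolding gaussian_vector_def
      by (intro borel_measurable_unfolding_norm borel_measurable_sum borel_measurable_times
          borel_measurable_const) simp_all
    then show ?thesis unfolding F_def by measurable
  qed
  have tail: "prob (F S) \<le> 2 * (real (card (multi_index d S)) + real (card (multi_index d ({1..m} - S))))
      * exp (- (t\<^sup>2) / 2)" if S: "S \<in> separating m" for S
  proof -
    let ?S' = "{1..m} - S" and ?k = "Suc m"
    have fin: "finite S" "finite ?S'" using finite_separating_member[OF S] by simp_all
    have notin: "?k \<notin> S" "?k \<notin> ?S'" using S by (auto simp: separating_def)
    \<comment> \<open>The contracted mode may join either side without violating the separation of
      modes 1 and 2. Hence one number, the old maximum, controls both variance parameters.\<close>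
    have 1: "insert ?k S \<in> separating ?k" "S \<in> separating ?k"
      using S \<open>m \<ge> 2\<close> by (auto simp: separating_def)
    have 2: "{1..?k} - insert ?k S = ?S'" "{1..?k} - S = insert ?k ?S'"
      using notin(1) by (auto simp: atLeastAtMostSuc_conv)
    have le: "unfolding_norm d (insert ?k S) ?S' W \<le> \<sigma>" "unfolding_norm d S (insert ?k ?S') W \<le> \<sigma>"
      using unfolding_norm_le_max[OF 1(1), of d W] unfolding_norm_le_max[OF 1(2), of d W]
      unfolding 2 \<sigma>_def .
    have sq: "(unfolding_norm d (insert ?k S) ?S' W)\<^sup>2 \<le> \<sigma>\<^sup>2" "(unfolding_norm d S (insert ?k ?S') W)\<^sup>2 \<le> \<sigma>\<^sup>2"
      by (intro power_mono le unfolding_norm_nonneg; use fin in simp)+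
    let ?B = "\<lambda>l x y. W ((merge S ?S' (x, y))(?k := l))"
    have "prob {\<omega> \<in> space M. spectral_norm (multi_index d S) (multi_index d ?S')
          (\<lambda>x y. \<Sum>l=1..d ?k. g \<omega> l * ?B l x y) > t * \<sigma>}
        \<le> 2 * (real (card (multi_index d S)) + real (card (multi_index d ?S'))) * exp (- (t\<^sup>2) / 2)"
    proof (rule gaussian_series_tail[OF gauss C C_le finite_multi_index[OF fin(1)]
          finite_multi_index[OF fin(2)] \<sigma>0 \<open>0 \<le> t\<close>])
      show "(\<Sum>l=1..d ?k. \<Sum>x\<in>multi_index d S. (\<Sum>y\<in>multi_index d ?S'. ?B l x y * v y)\<^sup>2)
          \<le> \<sigma>\<^sup>2 * (\<Sum>y\<in>multi_index d ?S'. (v y)\<^sup>2)" for v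
        by (rule order_trans[OF unfolding_norm_col_bound[OF fin notin] mult_right_mono[OF sq(1)]])
          (simp add: sum_nonneg)
      show "(\<Sum>l=1..d ?k. \<Sum>y\<in>multi_index d ?S'. (\<Sum>x\<in>multi_index d S. ?B l x y * u x)\<^sup>2)
          \<le> \<sigma>\<^sup>2 * (\<Sum>x\<in>multi_index d S. (u x)\<^sup>2)" for u
        by (rule order_trans[OF unfolding_norm_row_bound[OF fin notin] mult_right_mono[OF sq(2)]])
          (simp add: sum_nonneg)
    qed
    then show ?thesis unfolding F_def Y_def unfolding_norm_def contract_mode_def .
  qed
  have "{\<omega> \<in> space M. max_unfolding d m (contract_mode d (Suc m) (g \<omega>) W) > t * \<sigma>}
      = (\<Union>S\<in>separating m. F S)"
  proof -
    have "max_unfolding d m (contract_mode d (Suc m) (g \<omega>) W) > t * \<sigma> \<longleftrightarrow> (\<exists>S\<in>separating m. Y S \<omega> > t * \<sigma>)" for \<omega>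
      unfolding max_unfolding_def Y_def
      using finite_separating separating_nonempty[of m] \<open>m \<ge> 2\<close> by (subst Max_gr_iff) auto
    then show ?thesis unfolding F_def by blast
  qed
  then have "prob {\<omega> \<in> space M. max_unfolding d m (contract_mode d (Suc m) (g \<omega>) W) > t * \<sigma>}
      \<le> (\<Sum>S\<in>separating m. prob (F S))"
    using finite_measure_subadditive_finite[OF finite_separating, of F m] meas by auto
  also have "\<dots> \<le> (\<Sum>S\<in>separating m. 2 * (real (card (multi_index d S))
      + real (card (multi_index d ({1..m} - S)))) * exp (- (t\<^sup>2) / 2))"
    by (rule sum_mono[OF tail])
  also have "\<dots> = 2 * ((real (d 1) + real (d 2)) * (\<Prod>j=3..m. 1 + real (d j))) * exp (- (t\<^sup>2) / 2)"
    unfolding sum_card_separating[OF \<open>m \<ge> 2\<close>, symmetric] sum_distrib_left sum_distrib_right ..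
  finally show ?thesis unfolding \<sigma>_def .
qed

section \<open>Iterated contraction and conditioning on independent vectors\<close>

lemma contract_empty:
  assumes "x \<in> multi_index d U"
  shows "contract d U {} v T x = T x"
proof -
  have "merge U {} (x, y) = x" for y
    using assms by (auto simp: merge_def multi_index_def fun_eq_iff PiE_def extensional_def)
  then show ?thesis by (simp add: contract_def multi_index_def)
qed

lemma contract_insert:
  assumes "k \<notin> K" "k \<notin> U" "finite K"
  shows "contract d U (insert k K) v T x
    = contract_mode d k (v k) (contract d (insert k U) K v T) x"
proof -
  have m: "merge U (insert k K) (x, y(k := l)) = merge (insert k U) K (x(k := l), y)" for y l
    using assms by (auto simp: merge_def fun_eq_iff)
  have p: "(\<Prod>j\<in>insert k K. v j ((y(k := l)) j)) = v k l * (\<Prod>j\<in>K. v j (y j))" for y l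
  proof -
    have "(\<Prod>j\<in>K. v j ((y(k := l)) j)) = (\<Prod>j\<in>K. v j (y j))"
      by (rule prod.cong[OF refl]) (use assms in auto)
    then show ?thesis unfolding prod.insert[OF assms(3,1)] by simp
  qed
  show ?thesis
    unfolding contract_def contract_mode_def sum_multi_index_insert[OF assms(1)] m p sum_distrib_left
    by (intro sum.cong refl) (simp only: mult_ac)
qed

lemma (in prob_space) indep_var_section_bound:
  assumes ind: "indep_var N1 X N2 Y" and E: "E \<in> sets (N1 \<Otimes>\<^sub>M N2)"
    and le: "\<And>b. b \<in> space N2 \<Longrightarrow> prob {\<omega> \<in> space M. (X \<omega>, b) \<in> E} \<le> c" and "0 \<le> c"
  shows "prob {\<omega> \<in> space M. (X \<omega>, Y \<omega>) \<in> E} \<le> c"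
proof -
  have X: "X \<in> measurable M N1" and Y: "Y \<in> measurable M N2"
    and eq: "distr M N1 X \<Otimes>\<^sub>M distr M N2 Y = distr M (N1 \<Otimes>\<^sub>M N2) (\<lambda>\<omega>. (X \<omega>, Y \<omega>))"
    using ind unfolding indep_var_distribution_eq by simp_all
  interpret DX: prob_space "distr M N1 X" by (rule prob_space_distr[OF X])
  interpret DY: prob_space "distr M N2 Y" by (rule prob_space_distr[OF Y])
  interpret P: pair_sigma_finite "distr M N1 X" "distr M N2 Y" ..
  have XY: "(\<lambda>\<omega>. (X \<omega>, Y \<omega>)) \<in> measurable M (N1 \<Otimes>\<^sub>M N2)" using X Y by (rule measurable_Pair)
  have E': "E \<in> sets (distr M N1 X \<Otimes>\<^sub>M distr M N2 Y)" using E by simp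
  have "emeasure M {\<omega> \<in> space M. (X \<omega>, Y \<omega>) \<in> E}
      = emeasure (distr M (N1 \<Otimes>\<^sub>M N2) (\<lambda>\<omega>. (X \<omega>, Y \<omega>))) E"
    unfolding emeasure_distr[OF XY E] by (rule arg_cong[where f = "emeasure M"]) blast
  also have "\<dots> = (\<integral>\<^sup>+b. emeasure (distr M N1 X) ((\<lambda>a. (a, b)) -` E) \<partial>distr M N2 Y)"
    unfolding eq[symmetric] by (rule P.emeasure_pair_measure_alt2[OF E'])
  also have "\<dots> \<le> (\<integral>\<^sup>+b. ennreal c \<partial>distr M N2 Y)"
  proof (rule nn_integral_mono)
    fix b assume "b \<in> space (distr M N2 Y)"
    then have b: "b \<in> space N2" by simp
    have "(\<lambda>a. (a, b)) -` E \<in> sets N1" using sets_Pair2[OF E] .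
    then have "emeasure (distr M N1 X) ((\<lambda>a. (a, b)) -` E) = emeasure M {\<omega> \<in> space M. (X \<omega>, b) \<in> E}"
      by (subst emeasure_distr[OF X]) (auto intro!: arg_cong[where f = "emeasure M"])
    also have "\<dots> \<le> ennreal c" unfolding emeasure_eq_measure by (rule ennreal_leI[OF le[OF b]])
    finally show "emeasure (distr M N1 X) ((\<lambda>a. (a, b)) -` E) \<le> ennreal c" .
  qed
  also have "\<dots> = ennreal c" by (simp only: nn_integral_const DY.emeasure_space_1 mult_1_right)
  finally show ?thesis
    unfolding emeasure_eq_measure using \<open>0 \<le> c\<close> by (simp add: ennreal_le_iff)
qed

section \<open>Contraction of all modes\<close>

lemma contract_cong:
  assumes "\<And>k l. k \<in> K \<Longrightarrow> l \<in> {1..d k} \<Longrightarrow> w k l = w' k l"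
  shows "contract d U K w T = contract d U K w' T"
  unfolding contract_def
proof (intro ext sum.cong refl arg_cong2[where f = "(*)"] prod.cong)
  fix y k assume "y \<in> multi_index d K" "k \<in> K"
  then have "y k \<in> {1..d k}" unfolding multi_index_def by (rule PiE_mem)
  then show "w k (y k) = w' k (y k)" using \<open>k \<in> K\<close> by (intro assms)
qed

lemma borel_measurable_contract:
  assumes "\<And>k l. k \<in> K \<Longrightarrow> l \<in> {1..d k} \<Longrightarrow> (\<lambda>\<omega>. w \<omega> k l) \<in> borel_measurable N"
  shows "(\<lambda>\<omega>. contract d U K (w \<omega>) T x) \<in> borel_measurable N"
  unfolding contract_def
proof (intro borel_measurable_sum borel_measurable_times borel_measurable_const borel_measurable_prod)
  fix y k assume "y \<in> multi_index d K" "k \<in> K"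
  then have "y k \<in> {1..d k}" unfolding multi_index_def by (rule PiE_mem)
  then show "(\<lambda>\<omega>. w \<omega> k (y k)) \<in> borel_measurable N" using \<open>k \<in> K\<close> by (intro assms)
qed

text \<open>Here \<open>k\<close> counts the modes beyond the first two that are still open:
  \<open>k = s\<close> is the original tensor and \<open>k = 0\<close> the fully contracted
  matrix.\<close>

definition partial_norm :: "(nat \<Rightarrow> nat) \<Rightarrow> nat \<Rightarrow> ((nat \<Rightarrow> nat) \<Rightarrow> real) \<Rightarrow> (nat \<Rightarrow> nat \<Rightarrow> real) \<Rightarrow> nat \<Rightarrow> real" where
  "partial_norm d s T w k = max_unfolding d (k + 2) (contract d {1..k+2} {k+3..s+2} w T)"

lemma contract_Suc:
  assumes "k < s"
  shows "contract d {1..k+2} {k+3..s+2} w T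
    = contract_mode d (k + 3) (w (k + 3)) (contract d {1..k+3} {k+4..s+2} w T)"
proof -
  have "{k+3..s+2} = insert (k + 3) {k+4..s+2}" "insert (k + 3) {1..k+2} = {1..k+3}"
    using assms by auto
  then show ?thesis
    using contract_insert[of "k + 3" "{k+4..s+2}" "{1..k+2}" d w T] by (simp add: fun_eq_iff)
qed

context prob_space
begin

context
  fixes d :: "nat \<Rightarrow> nat" and s :: nat and T :: "(nat \<Rightarrow> nat) \<Rightarrow> real"
    and g :: "nat \<Rightarrow> 'a \<Rightarrow> nat \<Rightarrow> real" and \<Sigma> :: "nat \<Rightarrow> nat \<Rightarrow> nat \<Rightarrow> real" and t :: real
  assumes gauss: "\<And>i. i \<in> {1..s} \<Longrightarrow> gaussian_vector M (d (i + 2)) (g i) (\<Sigma> i)"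
    and psd: "\<And>i. i \<in> {1..s} \<Longrightarrow> psd (d (i + 2)) (\<Sigma> i)"
    and le_id: "\<And>i. i \<in> {1..s} \<Longrightarrow> loewner_le (d (i + 2)) (\<Sigma> i) id_matrix"
    and indep: "indep_vars (\<lambda>i. \<Pi>\<^sub>M j\<in>{1..d (i + 2)}. (borel :: real measure))
           (\<lambda>i \<omega>. restrict (g i \<omega>) {1..d (i + 2)}) {1..s}"
    and t: "0 \<le> t"
begin

lemma borel_measurable_partial_norm:
  "(\<lambda>\<omega>. partial_norm d s T (\<lambda>k. g (k - 2) \<omega>) k) \<in> borel_measurable M"
  unfolding partial_norm_def
proof (intro borel_measurable_max_unfolding borel_measurable_contract)
  fix j l assume j: "j \<in> {k+3..s+2}" and l: "l \<in> {1..d j}"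
  from j have "j - 2 \<in> {1..s}" and e: "j - 2 + 2 = j" by auto
  then show "(\<lambda>\<omega>. g (j - 2) \<omega> l) \<in> borel_measurable M"
    using gauss[of "j - 2"] l unfolding gaussian_vector_def e by blast
qed

lemma partial_norm_step_tail:
  assumes k: "k < s"
  shows "prob {\<omega> \<in> space M. partial_norm d s T (\<lambda>k. g (k - 2) \<omega>) k
        > t * partial_norm d s T (\<lambda>k. g (k - 2) \<omega>) (Suc k)}
    \<le> 2 * ((real (d 1) + real (d 2)) * (\<Prod>j=3..k+2. 1 + real (d j))) * exp (- (t\<^sup>2) / 2)"
    (is "_ \<le> ?c")
proof -
  let ?i = "k + 1" and ?J = "{k+2..s}"
  define N where "N i = (\<Pi>\<^sub>M j\<in>{1..d (i + 2)}. (borel :: real measure))" for i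
  define X where "X i \<omega> = restrict (g i \<omega>) {1..d (i + 2)}" for i \<omega>
  \<comment> \<open>A family over a singleton instead of a single vector, to match the two index
    blocks produced by \<open>indep_var_restrict\<close>.\<close>
  define XA where "XA \<omega> = restrict (\<lambda>i. X i \<omega>) {?i}" for \<omega>
  define XB where "XB \<omega> = restrict (\<lambda>i. X i \<omega>) ?J" for \<omega>
  define W where "W b = contract d {1..k+3} {k+4..s+2} (\<lambda>j. b (j - 2)) T" for b :: "nat \<Rightarrow> nat \<Rightarrow> real"
  define P where "P z \<longleftrightarrow> t * max_unfolding d (k + 3) (W (snd z))
      < max_unfolding d (k + 2) (contract_mode d (k + 3) (fst z ?i) (W (snd z)))" for z
  let ?N = "PiM {?i} N \<Otimes>\<^sub>M PiM ?J N"
  have ind: "indep_var (PiM {?i} N) XA (PiM ?J N) XB"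
    unfolding XA_def[abs_def] XB_def[abs_def]
    by (rule indep_var_restrict[of _ _ "{1..s}"])
      (use indep k in \<open>simp_all add: N_def[abs_def] X_def[abs_def]\<close>)
  have XA: "XA \<in> measurable M (PiM {?i} N)" and XB: "XB \<in> measurable M (PiM ?J N)"
    using ind unfolding indep_var_distribution_eq by simp_all
  have comp: "(\<lambda>z. f z i l) \<in> borel_measurable ?N"
    if "f \<in> measurable ?N (PiM K N)" "i \<in> K" "l \<in> {1..d (i + 2)}" for f i l K
  proof -
    have "(\<lambda>x. x l) \<in> borel_measurable (N i)"
      unfolding N_def by (rule measurable_component_singleton[OF that(3)])
    then show ?thesis
      by (rule measurable_compose[OF measurable_compose[OF that(1) measurable_component_singleton[OF that(2)]]])
  qed
  have W_meas: "(\<lambda>z. W (snd z) x) \<in> borel_measurable ?N" for x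
    unfolding W_def
  proof (rule borel_measurable_contract)
    fix j l assume j: "j \<in> {k+4..s+2}" and "l \<in> {1..d j}"
    from j have "j - 2 \<in> ?J" and e: "j - 2 + 2 = j" by auto
    have "l \<in> {1..d (j - 2 + 2)}" unfolding e by fact
    with \<open>j - 2 \<in> ?J\<close> show "(\<lambda>z. snd z (j - 2) l) \<in> borel_measurable ?N" by (rule comp[OF measurable_snd])
  qed
  have fst_meas: "(\<lambda>z. fst z ?i l) \<in> borel_measurable ?N" if "l \<in> {1..d (k + 3)}" for l
    using that by (intro comp[OF measurable_fst]) (simp_all add: eval_nat_numeral)
  have E: "{z \<in> space ?N. P z} \<in> sets ?N"
    unfolding P_def
  proof (rule borel_measurable_less)
    show "(\<lambda>z. t * max_unfolding d (k + 3) (W (snd z))) \<in> borel_measurable ?N"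
      by (intro borel_measurable_times borel_measurable_const borel_measurable_max_unfolding W_meas)
    show "(\<lambda>z. max_unfolding d (k + 2) (contract_mode d (k + 3) (fst z ?i) (W (snd z)))) \<in> borel_measurable ?N"
      unfolding contract_mode_def
      by (intro borel_measurable_max_unfolding borel_measurable_sum borel_measurable_times W_meas fst_meas)
  qed
  have mode: "contract_mode d (k + 3) (XA \<omega> ?i) V = contract_mode d (k + 3) (g ?i \<omega>) V" for \<omega> V
  proof -
    have "XA \<omega> ?i l = g ?i \<omega> l" if "l \<in> {1..d (k + 3)}" for l
      using that by (simp add: XA_def X_def eval_nat_numeral)
    then show ?thesis unfolding contract_mode_def by (intro ext sum.cong refl) simp
  qed
  have "prob {\<omega> \<in> space M. (XA \<omega>, XB \<omega>) \<in> {z \<in> space ?N. P z}} \<le> ?c"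
  proof (rule indep_var_section_bound[OF ind E])
    fix b assume b: "b \<in> space (PiM ?J N)"
    have "{\<omega> \<in> space M. (XA \<omega>, b) \<in> {z \<in> space ?N. P z}}
        = {\<omega> \<in> space M. max_unfolding d (k + 2) (contract_mode d (Suc (k + 2)) (g ?i \<omega>) (W b))
            > t * max_unfolding d (Suc (k + 2)) (W b)}"
      using b measurable_space[OF XA] mode
      by (auto simp: P_def space_pair_measure eval_nat_numeral)
    moreover have "prob {\<omega> \<in> space M. max_unfolding d (k + 2) (contract_mode d (Suc (k + 2)) (g ?i \<omega>) (W b))
            > t * max_unfolding d (Suc (k + 2)) (W b)} \<le> ?c"
    proof -
      have i: "?i \<in> {1..s}" and e: "?i + 2 = Suc (k + 2)" using k by simp_all
      show ?thesis
        using gauss[OF i] psd[OF i] le_id[OF i] unfolding e by (rule contract_mode_tail) (simp_all add: t)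
    qed
    ultimately show "prob {\<omega> \<in> space M. (XA \<omega>, b) \<in> {z \<in> space ?N. P z}} \<le> ?c" by simp
  next
    show "0 \<le> ?c" by (intro mult_nonneg_nonneg prod_nonneg) simp_all
  qed
  also have "{\<omega> \<in> space M. (XA \<omega>, XB \<omega>) \<in> {z \<in> space ?N. P z}}
      = {\<omega> \<in> space M. partial_norm d s T (\<lambda>k. g (k - 2) \<omega>) k
        > t * partial_norm d s T (\<lambda>k. g (k - 2) \<omega>) (Suc k)}"
  proof -
    have W: "W (XB \<omega>) = contract d {1..k+3} {k+4..s+2} (\<lambda>k. g (k - 2) \<omega>) T" for \<omega>
      unfolding W_def
    proof (rule contract_cong)
      fix j l assume j: "j \<in> {k+4..s+2}" and l: "l \<in> {1..d j}"
      from j have J: "j - 2 \<in> ?J" and e: "j - 2 + 2 = j" by auto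
      show "XB \<omega> (j - 2) l = g (j - 2) \<omega> l"
        unfolding XB_def X_def restrict_apply'[OF J] e restrict_apply'[OF l] ..
    qed
    have "partial_norm d s T (\<lambda>k. g (k - 2) \<omega>) (Suc k) = max_unfolding d (k + 3) (W (XB \<omega>))" for \<omega>
      unfolding W partial_norm_def by (simp add: eval_nat_numeral)
    moreover have "partial_norm d s T (\<lambda>k. g (k - 2) \<omega>) k
        = max_unfolding d (k + 2) (contract_mode d (k + 3) (XA \<omega> ?i) (W (XB \<omega>)))" for \<omega>
      unfolding W partial_norm_def mode contract_Suc[OF k] by simp
    ultimately show ?thesis
      using measurable_space[OF XA] measurable_space[OF XB]
      by (auto simp: P_def space_pair_measure)
  qed
  finally show ?thesis .
qed

text \<open>Outside the union of the step events each contraction grows the norm by at most the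
  factor \<open>t\<close>, so the factors multiply to \<open>t ^ s\<close>. The step probabilities
  simply add.\<close>

lemma partial_norm_tail:
  "prob {\<omega> \<in> space M. partial_norm d s T (\<lambda>k. g (k - 2) \<omega>) 0
        > t ^ s * partial_norm d s T (\<lambda>k. g (k - 2) \<omega>) s}
    \<le> (\<Sum>k<s. 2 * ((real (d 1) + real (d 2)) * (\<Prod>j=3..k+2. 1 + real (d j))) * exp (- (t\<^sup>2) / 2))"
proof -
  define A where "A \<omega> k = partial_norm d s T (\<lambda>k. g (k - 2) \<omega>) k" for \<omega> k
  define F where "F k = {\<omega> \<in> space M. A \<omega> k > t * A \<omega> (Suc k)}" for k
  have meas: "(\<lambda>\<omega>. A \<omega> k) \<in> borel_measurable M" for k
    unfolding A_def by (rule borel_measurable_partial_norm)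
  have F: "F k \<in> sets M" for k
    unfolding F_def by (intro borel_measurable_less borel_measurable_times borel_measurable_const meas)
  have "{\<omega> \<in> space M. A \<omega> 0 > t ^ s * A \<omega> s} \<subseteq> (\<Union>k\<in>{..<s}. F k)"
  proof (rule ccontr)
    assume "\<not> ?thesis"
    then obtain \<omega> where \<omega>: "\<omega> \<in> space M" "A \<omega> 0 > t ^ s * A \<omega> s" "\<And>k. k < s \<Longrightarrow> \<omega> \<notin> F k" by blast
    have step: "A \<omega> k \<le> t * A \<omega> (Suc k)" if "k < s" for k
      using \<omega>(1) \<omega>(3)[OF that] by (simp add: F_def not_less)
    have "A \<omega> 0 \<le> t ^ k * A \<omega> k" if "k \<le> s" for k
      using that
    proof (induction k)
      case (Suc k)
      have "A \<omega> 0 \<le> t ^ k * A \<omega> k" using Suc by simp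
      also have "\<dots> \<le> t ^ k * (t * A \<omega> (Suc k))"
        using step[of k] Suc.prems t by (intro mult_left_mono) simp_all
      finally show ?case by (simp add: mult_ac)
    qed simp
    then show False using \<omega>(2) by (meson le_refl not_less)
  qed
  then have "prob {\<omega> \<in> space M. A \<omega> 0 > t ^ s * A \<omega> s} \<le> prob (\<Union>k\<in>{..<s}. F k)"
    using F by (intro finite_measure_mono) auto
  also have "\<dots> \<le> (\<Sum>k<s. prob (F k))"
    using F by (intro finite_measure_subadditive_finite) auto
  also have "\<dots> \<le> (\<Sum>k<s. 2 * ((real (d 1) + real (d 2)) * (\<Prod>j=3..k+2. 1 + real (d j))) * exp (- (t\<^sup>2) / 2))"
    unfolding F_def A_def by (intro sum_mono partial_norm_step_tail) simp
  finally show ?thesis unfolding A_def .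
qed

end

end

text \<open>Keeps the exponent at \<open>s - 1\<close> without a factor \<open>s\<close>, at the
  price of enlarging the base by one: the new term is at most
  \<open>R * (R + 1) ^ (s - 1)\<close>.\<close>

lemma sum_power_le:
  fixes R :: real
  assumes "1 \<le> s" "0 \<le> R"
  shows "(\<Sum>k<s. R ^ k) \<le> (R + 1) ^ (s - 1)"
  using assms(1)
proof (induction s rule: dec_induct)
  case (step s)
  have "(\<Sum>k<Suc s. R ^ k) \<le> (R + 1) ^ (s - 1) + R ^ s" using step by simp
  also have "R ^ s = R * R ^ (s - 1)" using step by (cases s) simp_all
  also have "(R + 1) ^ (s - 1) + R * R ^ (s - 1) \<le> (R + 1) ^ (s - 1) + R * (R + 1) ^ (s - 1)"
    using \<open>0 \<le> R\<close> by (intro add_left_mono mult_left_mono power_mono) simp_all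
  also have "\<dots> = (R + 1) * (R + 1) ^ (s - 1)" by (simp add: distrib_right)
  also have "\<dots> = (R + 1) ^ (Suc s - 1)" using step by (cases s) simp_all
  finally show ?case .
qed simp

theorem theorem6p8:
  fixes M :: "'a measure"
    and p q s :: nat and r :: "nat \<Rightarrow> nat"
    and T :: "(nat \<Rightarrow> nat) \<Rightarrow> real"
    and g :: "nat \<Rightarrow> 'a \<Rightarrow> nat \<Rightarrow> real"
    and \<Sigma> :: "nat \<Rightarrow> nat \<Rightarrow> nat \<Rightarrow> real"
    and t :: real
  defines "d \<equiv> mode_dim p q r"
  assumes "prob_space M"
    and "s \<ge> 1"
    and "\<exists>x \<in> multi_index d {1..s+2}. T x \<noteq> 0"
    and "\<And>i. i \<in> {1..s} \<Longrightarrow> loewner_le (r i) (\<lambda>_ _. 0) (\<Sigma> i)"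
    and "\<And>i. i \<in> {1..s} \<Longrightarrow> loewner_le (r i) (\<Sigma> i) id_matrix"
    and "\<And>i. i \<in> {1..s} \<Longrightarrow> gaussian_vector M (r i) (g i) (\<Sigma> i)"
    and "prob_space.indep_vars M (\<lambda>i. \<Pi>\<^sub>M j\<in>{1..r i}. (borel :: real measure))
           (\<lambda>i \<omega>. restrict (g i \<omega>) {1..r i}) {1..s}"
    and "t \<ge> 0"
  shows "measure M {\<omega> \<in> space M.
           unfolding_norm d {1} {2} (contract d {1, 2} {3..s+2} (\<lambda>k. g (k - 2) \<omega>) T)
             \<ge> t ^ s * Max {unfolding_norm d S ({1..s+2} - S) T | S.
                              S \<subseteq> {1..s+2} \<and> 1 \<in> S \<and> 2 \<notin> S}}
         \<le> 4 * (real p + real q) * real (Max {r i + 2 | i. i \<in> {1..s}}) ^ (s - 1)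
             * exp (- (t\<^sup>2) / 2)"
proof -
  interpret prob_space M by fact
  have d: "d (i + 2) = r i" if "i \<in> {1..s}" for i
    using that by (simp add: d_def mode_dim_def)
  have d12: "d 1 = p" "d 2 = q" by (simp_all add: d_def mode_dim_def)
  \<comment> \<open>The maximum of the \<open>r i + 1\<close>, which dominates every factor
    \<open>1 + real (d j)\<close>; the base in the statement is \<open>R + 1\<close>.\<close>
  define R where "R = real (Max {r i + 2 | i. i \<in> {1..s}}) - 1"
  have R: "1 + real (r i) \<le> R" if "i \<in> {1..s}" for i
  proof -
    have "{r i + 2 | i. i \<in> {1..s}} = (\<lambda>i. r i + 2) ` {1..s}" by blast
    then have "r i + 2 \<le> Max {r i + 2 | i. i \<in> {1..s}}" using that by simp
    then have "real (r i + 2) \<le> real (Max {r i + 2 | i. i \<in> {1..s}})" by (rule of_nat_mono)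
    then show ?thesis by (simp add: R_def)
  qed
  have R1: "1 \<le> R" using R[of 1] \<open>s \<ge> 1\<close> by simp
  define w where "w = (\<lambda>\<omega> k. g (k - 2) \<omega>)"
  define K where "K = max_unfolding d (s + 2) T"
  define Y where "Y \<omega> = unfolding_norm d {1} {2} (contract d {1, 2} {3..s+2} (w \<omega>) T)" for \<omega>

  have norm_s: "partial_norm d s T v s = K" for v
    unfolding partial_norm_def K_def by (rule max_unfolding_cong) (simp add: contract_empty)
  have norm_0: "partial_norm d s T (w \<omega>) 0 = Y \<omega>" for \<omega>
  proof -
    have two: "{1..2::nat} = {1, 2}" by auto
    \<comment> \<open>With two modes left there is a single bipartition, so the maximal norm is the
      norm of the contracted matrix.\<close>
    have sep: "separating 2 = {{1}}"
    proof (intro set_eqI iffI)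
      fix S assume "S \<in> separating 2"
      then have "S \<subseteq> {1, 2}" "1 \<in> S" "2 \<notin> S" unfolding separating_def two by auto
      then have "S = {1}" by auto
      then show "S \<in> {{1}}" by simp
    qed (simp add: separating_def)
    have diff: "{1, 2} - {1} = {2::nat}" by auto
    have "partial_norm d s T (w \<omega>) 0 = Max ((\<lambda>S. unfolding_norm d S ({1..2} - S)
        (contract d {1..2} {3..s+2} (w \<omega>) T)) ` separating 2)"
      by (simp only: partial_norm_def max_unfolding_def add_0)
    then show ?thesis
      by (simp only: Y_def two sep diff image_insert image_empty Max_singleton)
  qed

  have gauss: "gaussian_vector M (d (i + 2)) (g i) (\<Sigma> i)" and psd: "psd (d (i + 2)) (\<Sigma> i)"
    and le_id: "loewner_le (d (i + 2)) (\<Sigma> i) id_matrix" if "i \<in> {1..s}" for i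
    using assms(5-7)[OF that] unfolding d[OF that] loewner_le_def by simp_all
  have indep: "indep_vars (\<lambda>i. \<Pi>\<^sub>M j\<in>{1..d (i + 2)}. (borel :: real measure))
      (\<lambda>i \<omega>. restrict (g i \<omega>) {1..d (i + 2)}) {1..s}"
    using assms(8) by (rule indep_vars_cong[THEN iffD1, rotated -1]) (simp_all only: d)
  have strict: "prob {\<omega> \<in> space M. Y \<omega> > u ^ s * K}
      \<le> 2 * (real p + real q) * (R + 1) ^ (s - 1) * exp (- (u\<^sup>2) / 2)" if "0 \<le> u" for u
  proof -
    have "prob {\<omega> \<in> space M. Y \<omega> > u ^ s * K}
        \<le> (\<Sum>k<s. 2 * ((real (d 1) + real (d 2)) * (\<Prod>j=3..k+2. 1 + real (d j))) * exp (- (u\<^sup>2) / 2))"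
      using partial_norm_tail[OF gauss psd le_id indep that, of T]
      unfolding norm_s norm_0[unfolded w_def] .
    also have "\<dots> \<le> (\<Sum>k<s. 2 * ((real p + real q) * R ^ k) * exp (- (u\<^sup>2) / 2))"
    proof (intro sum_mono mult_right_mono mult_left_mono)
      fix k assume k: "k \<in> {..<s}"
      have "(\<Prod>j=3..k+2. 1 + real (d j)) \<le> (\<Prod>j=3..k+2. R)"
      proof (rule prod_mono)
        fix j assume j: "j \<in> {3..k+2}"
        then have "j - 2 \<in> {1..s}" "j - 2 + 2 = j" using k by auto
        then have "1 + real (d j) \<le> R" using d R by metis
        then show "0 \<le> 1 + real (d j) \<and> 1 + real (d j) \<le> R" by simp
      qed
      then have "(\<Prod>j=3..k+2. 1 + real (d j)) \<le> R ^ k" by simp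
      then show "(real (d 1) + real (d 2)) * (\<Prod>j=3..k+2. 1 + real (d j)) \<le> (real p + real q) * R ^ k"
        unfolding d12 by (intro mult_left_mono) simp_all
    qed simp_all
    also have "\<dots> = 2 * (real p + real q) * exp (- (u\<^sup>2) / 2) * (\<Sum>k<s. R ^ k)"
      unfolding sum_distrib_left by (intro sum.cong refl) (simp only: mult_ac)
    also have "\<dots> \<le> 2 * (real p + real q) * exp (- (u\<^sup>2) / 2) * (R + 1) ^ (s - 1)"
      using R1 \<open>s \<ge> 1\<close> by (intro mult_left_mono sum_power_le) simp_all
    finally show ?thesis by (simp only: mult_ac)
  qed

  obtain x where x: "x \<in> multi_index d {1..s+2}" "T x \<noteq> 0" using assms(4) by blast
  \<comment> \<open>A spectral norm dominates each entry, and \<open>T x\<close> is a nonzero entry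
    of the unfolding with row mode 1.\<close>
  have "K > 0"
  proof -
    let ?S' = "{1..s+2} - {1}"
    have "merge {1} ?S' (restrict x {1}, restrict x ?S') = x"
    proof
      fix j
      show "merge {1} ?S' (restrict x {1}, restrict x ?S') j = x j"
        using x(1) by (auto simp: merge_def multi_index_def PiE_def extensional_def)
    qed
    moreover have "restrict x {1} \<in> multi_index d {1}" "restrict x ?S' \<in> multi_index d ?S'"
      using x(1) by (auto simp: multi_index_def PiE_iff)
    ultimately have "\<bar>T x\<bar> \<le> unfolding_norm d {1} ?S' T"
      unfolding unfolding_norm_def
      using spectral_norm_entry[OF finite_multi_index finite_multi_index, of "{1}" ?S' "restrict x {1}" d
          "restrict x ?S'" d "\<lambda>x y. T (merge {1} ?S' (x, y))"] by simp
    also have "\<dots> \<le> K" unfolding K_def by (rule unfolding_norm_le_max[OF separating_nonempty]) simp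
    finally show ?thesis using x(2) by simp
  qed
  \<comment> \<open>The multi-index \<open>x\<close> has a first coordinate in
    \<open>{1..p}\<close>, so this range is nonempty.\<close>
  have p: "p \<ge> 1"
  proof -
    have "x 1 \<in> {1..d 1}" using x(1) unfolding multi_index_def by (rule PiE_mem) simp
    then show ?thesis unfolding d12 by simp
  qed
  have pos: "1 \<le> (real p + real q) * (R + 1) ^ (s - 1)"
  proof -
    have "1 * 1 \<le> (real p + real q) * (R + 1) ^ (s - 1)"
      using p R1 by (intro mult_mono one_le_power) simp_all
    then show ?thesis by simp
  qed

  have "prob {\<omega> \<in> space M. Y \<omega> \<ge> t ^ s * K} \<le> 2 * (real p + real q) * (R + 1) ^ (s - 1) * exp (- (t\<^sup>2) / 2)"
  proof (cases "t = 0")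
    case True
    \<comment> \<open>At \<open>t = 0\<close> there is no smaller parameter to approximate from, but
      the exponential is 1 and the right-hand side is at least 2.\<close>
    have "prob {\<omega> \<in> space M. Y \<omega> \<ge> t ^ s * K} \<le> 1" by (rule prob_le_1)
    also have "1 \<le> 2 * ((real p + real q) * (R + 1) ^ (s - 1))" using pos by linarith
    finally show ?thesis using True by (simp add: algebra_simps)
  next
    case False
    then have "t > 0" using \<open>t \<ge> 0\<close> by simp
    have "Y \<in> borel_measurable M"
      using borel_measurable_partial_norm[OF gauss psd le_id indep \<open>t \<ge> 0\<close>, of T 0]
      unfolding norm_0[unfolded w_def] .
    then have meas: "{\<omega> \<in> space M. Y \<omega> > u} \<in> sets M" for u by measurable
    have le: "prob {\<omega> \<in> space M. Y \<omega> \<ge> t ^ s * K}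
        \<le> 2 * (real p + real q) * (R + 1) ^ (s - 1) * exp (- (u\<^sup>2) / 2)" if u: "u \<in> {0<..<t}" for u
    proof -
      \<comment> \<open>Since \<open>s \<ge> 1\<close> and \<open>K > 0\<close>, the threshold
        strictly increases with \<open>u\<close>. The closed event at \<open>t\<close> therefore
        lies in the open event at each smaller \<open>u\<close>, and continuity in \<open>u\<close>
        gives the bound at \<open>t\<close>.\<close>
      have "u ^ s < t ^ s" using u \<open>s \<ge> 1\<close> by (intro power_strict_mono) simp_all
      then have "u ^ s * K < t ^ s * K" using \<open>K > 0\<close> by simp
      then have "{\<omega> \<in> space M. Y \<omega> \<ge> t ^ s * K} \<subseteq> {\<omega> \<in> space M. Y \<omega> > u ^ s * K}" by auto
      then have "prob {\<omega> \<in> space M. Y \<omega> \<ge> t ^ s * K} \<le> prob {\<omega> \<in> space M. Y \<omega> > u ^ s * K}"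
        by (rule finite_measure_mono[OF _ meas])
      also have "\<dots> \<le> 2 * (real p + real q) * (R + 1) ^ (s - 1) * exp (- (u\<^sup>2) / 2)"
        using u by (intro strict) simp
      finally show ?thesis .
    qed
    have ev: "\<forall>\<^sub>F u in at_left t. prob {\<omega> \<in> space M. Y \<omega> \<ge> t ^ s * K}
        \<le> 2 * (real p + real q) * (R + 1) ^ (s - 1) * exp (- (u\<^sup>2) / 2)"
      by (rule eventually_at_leftI[OF _ \<open>t > 0\<close>]) (rule le)
    have "((\<lambda>u. 2 * (real p + real q) * (R + 1) ^ (s - 1) * exp (- (u\<^sup>2) / 2))
        \<longlongrightarrow> 2 * (real p + real q) * (R + 1) ^ (s - 1) * exp (- (t\<^sup>2) / 2)) (at_left t)"
      by (intro tendsto_intros) simp_all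
    from tendsto_lowerbound[OF this ev] show ?thesis by simp
  qed
  \<comment> \<open>The constant 2 obtained so far is relaxed to the stated 4.\<close>
  also have "\<dots> \<le> 4 * (real p + real q) * (R + 1) ^ (s - 1) * exp (- (t\<^sup>2) / 2)"
    using R1 by (intro mult_right_mono) simp_all
  finally have "prob {\<omega> \<in> space M. Y \<omega> \<ge> t ^ s * K}
      \<le> 4 * (real p + real q) * (R + 1) ^ (s - 1) * exp (- (t\<^sup>2) / 2)" .
  moreover have "R + 1 = real (Max {r i + 2 | i. i \<in> {1..s}})" by (simp add: R_def)
  moreover have "K = Max {unfolding_norm d S ({1..s+2} - S) T | S. S \<subseteq> {1..s+2} \<and> 1 \<in> S \<and> 2 \<notin> S}"
    unfolding K_def max_unfolding_def separating_def by (rule arg_cong[where f = Max]) blast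
  ultimately show ?thesis by (simp only: Y_def w_def)
qed

end
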